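(* Let $J$ be a spectrally positive Lévy process with $\mathrm{Var}\,J_1=\sigma^2\in(0,\infty)$. Fix $r>0$ and, for $0<\epsilon<r$, consider the fluid tandem queue with input $J$ and service rates $r_1=\mathbb{E}J_1+r$ and $r_2=\mathbb{E}J_1+\epsilon$, with stationary workloads $(Q^{(1)},Q^{(2)})$ (the law of $Q^{(1)}$ does not depend on $\epsilon$; that of $Q^{(2)}$ does). Then, as $\epsilon\downarrow0$, $(Q^{(1)},\epsilon Q^{(2)})$ converges in distribution to a pair of independent random variables, the first of which has the law of $Q^{(1)}$, given by $$\mathbb{E}\,e^{-sQ^{(1)}}=\frac{s\,\phi'(0)}{\phi(s)},\qquad s>0,$$ and the second of which is exponentially distributed with rate $2/\sigma^2$.
   Context: Fluid tandem queue: $J=\{J_t,t\ge 0\}$ is a spectrally positive Lévy process (no negative jumps), $J_0=0$, $\mathbb{E}|J_1|<\infty$. Two servers in series work at constant rates $r_1>r_2>\mathbb{E}J_1$. The input $J$ feeds the first (upstream) queue, whose server empties it at rate $r_1$; its output flows continuously into the second (downstream) queue, which is emptied at rate $r_2$. Formally, for $i=1,2$ let $X^{(i)}_t=J_t-r_it$ and $L^{(i)}_t=-\inf_{0\le s\le t}X^{(i)}_s$. Starting empty, the upstream workload is $Q^{(1)}_t=X^{(1)}_t+L^{(1)}_t$, the total workload is $Q^{(1)}_t+Q^{(2)}_t=X^{(2)}_t+L^{(2)}_t$, and hence the downstream workload is $Q^{(2)}_t=X^{(2)}_t+L^{(2)}_t-Q^{(1)}_t$. The pair $(Q^{(1)},Q^{(2)})$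 denotes the steady-state workloads, i.e. a random vector whose law is the limit in distribution of $(Q^{(1)}_t,Q^{(2)}_t)$ as $t\to\infty$. The Laplace exponent is $\phi(s)=\log\mathbb{E}[e^{-sX^{(1)}_1}]$, $s\ge0$, and $\phi'(0)$ is its (right) derivative at $0$. *)

theory Defs
  imports "HOL-Probability.Probability"
begin

definition cadlag :: "(real \<Rightarrow> real) \<Rightarrow> bool" where
  "cadlag f \<longleftrightarrow>
     (\<forall>t\<ge>0. continuous (at_right t) f) \<and> (\<forall>t>0. \<exists>l. (f \<longlongrightarrow> l) (at_left t))"

text \<open>The time index is \<^typ>\<open>real\<close>, but only times \<open>t \<ge> 0\<close> are constrained or used.\<close>

locale levy_process = prob_space M for M :: "'a measure" +
  fixes J :: "real \<Rightarrow> 'a \<Rightarrow> real"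
  assumes measurable_at: "0 \<le> t \<Longrightarrow> random_variable borel (J t)"
    and start_zero: "AE \<omega> in M. J 0 \<omega> = 0"
    and indep_increments:
      "\<lbrakk>0 \<le> \<tau> 0; \<And>k. k < n \<Longrightarrow> \<tau> k \<le> \<tau> (Suc k)\<rbrakk> \<Longrightarrow>
         indep_vars (\<lambda>_. borel) (\<lambda>k \<omega>. J (\<tau> (Suc k)) \<omega> - J (\<tau> k) \<omega>) {..<n}"
    and stationary_increments:
      "\<lbrakk>0 \<le> s; 0 \<le> h\<rbrakk> \<Longrightarrow> distr M borel (\<lambda>\<omega>. J (s + h) \<omega> - J s \<omega>) = distr M borel (J h)"
    and cadlag_paths: "AE \<omega> in M. cadlag (\<lambda>t. J t \<omega>)"

locale spectrally_positive_levy_process = levy_process +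
  assumes no_negative_jumps:
    "AE \<omega> in M. \<forall>t>0. \<forall>l. ((\<lambda>s. J s \<omega>) \<longlongrightarrow> l) (at_left t) \<longrightarrow> l \<le> J t \<omega>"

definition net_input :: "(real \<Rightarrow> 'a \<Rightarrow> real) \<Rightarrow> real \<Rightarrow> real \<Rightarrow> 'a \<Rightarrow> real" where
  "net_input J r t \<omega> = J t \<omega> - r * t"

definition regulator :: "(real \<Rightarrow> 'a \<Rightarrow> real) \<Rightarrow> real \<Rightarrow> real \<Rightarrow> 'a \<Rightarrow> real" where
  "regulator J r t \<omega> = - (INF s\<in>{0..t}. net_input J r s \<omega>)"

definition upstream :: "(real \<Rightarrow> 'a \<Rightarrow> real) \<Rightarrow> real \<Rightarrow> real \<Rightarrow> 'a \<Rightarrow> real" where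
  "upstream J r1 t \<omega> = net_input J r1 t \<omega> + regulator J r1 t \<omega>"

definition downstream :: "(real \<Rightarrow> 'a \<Rightarrow> real) \<Rightarrow> real \<Rightarrow> real \<Rightarrow> real \<Rightarrow> 'a \<Rightarrow> real" where
  "downstream J r1 r2 t \<omega> = net_input J r2 t \<omega> + regulator J r2 t \<omega> - upstream J r1 t \<omega>"

text \<open>
  Convergence in distribution, as weak convergence of laws, along an arbitrary filter.  The
  library's \<^const>\<open>weak_conv_m\<close> covers only sequences of laws on the real line.
\<close>

definition converges_weakly ::
    "('i \<Rightarrow> 'b::topological_space measure) \<Rightarrow> 'b measure \<Rightarrow> 'i filter \<Rightarrow> bool" where
  "converges_weakly \<mu> \<nu> F \<longleftrightarrow>
     prob_space \<nu> \<and> sets \<nu> = sets borel \<and>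
     (\<forall>f :: 'b \<Rightarrow> real. continuous_on UNIV f \<and> bounded (range f) \<longrightarrow>
        ((\<lambda>i. \<integral>x. f x \<partial>\<mu> i) \<longlongrightarrow> (\<integral>x. f x \<partial>\<nu>)) F)"

text \<open>
  Path regularity holds only almost surely, so the infimum defining the regulator need only be
  measurable with respect to the completion of \<^term>\<open>M\<close>; hence laws are taken there.
\<close>

definition workload_law ::
    "'a measure \<Rightarrow> (real \<Rightarrow> 'a \<Rightarrow> real) \<Rightarrow> real \<Rightarrow> real \<Rightarrow> real \<Rightarrow> (real \<times> real) measure" where
  "workload_law M J r1 r2 t =
     distr (completion M) borel (\<lambda>\<omega>. (upstream J r1 t \<omega>, downstream J r1 r2 t \<omega>))"

text \<open>
  Weak limits are unique, so this is the law of the steady-state pair (upstream, downstream)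
  whenever the limit exists; like \<^const>\<open>lim\<close>, it is unspecified otherwise.
\<close>

definition steady_state_law ::
    "'a measure \<Rightarrow> (real \<Rightarrow> 'a \<Rightarrow> real) \<Rightarrow> real \<Rightarrow> real \<Rightarrow> (real \<times> real) measure" where
  "steady_state_law M J r1 r2 = (THE \<pi>. converges_weakly (workload_law M J r1 r2) \<pi> at_top)"

definition laplace_exponent :: "'a measure \<Rightarrow> (real \<Rightarrow> 'a \<Rightarrow> real) \<Rightarrow> real \<Rightarrow> real \<Rightarrow> real" where
  "laplace_exponent M J r1 s = ln (\<integral>\<omega>. exp (- s * net_input J r1 1 \<omega>) \<partial>M)"

definition right_deriv :: "(real \<Rightarrow> real) \<Rightarrow> real \<Rightarrow> real" where
  "right_deriv f x = (THE d. (f has_real_derivative d) (at_right x))"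

end

theory Submission
  imports Defs "HOL-Real_Asymp.Real_Asymp"
begin

text \<open>
  Write \<open>m\<close> for the mean of \<open>J 1\<close> and \<open>S c\<close> for the all-time maximum of \<open>J t - c * t\<close>.  Three ideas
  carry the proof.

  \<^emph>\<open>Time reversal.\<close>  A reflected process at time \<open>t\<close> is a maximum of the path read backwards from
  \<open>t\<close>, and the increments of \<open>J\<close> read backwards are again independent with the same laws.  So the
  upstream and the total workload at time \<open>t\<close> are jointly distributed as the maxima over \<open>[0, t]\<close> of the
  two net inputs; these increase to \<open>S (m + r)\<close> and \<open>S (m + \<epsilon>)\<close>.  The stationary workloads for
  all \<open>\<epsilon>\<close> are thereby realised on the space of \<open>J\<close>, as \<open>S (m + r)\<close> and
  \<open>S (m + \<epsilon>) - S (m + r)\<close> (\<open>steady_state_law_eq\<close>).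

  \<^emph>\<open>The Pollaczek-Khinchine formula\<close> (\<open>pollaczek_khinchine\<close>).  On a grid of mesh \<open>h\<close> the maximum \<open>W\<close>
  of the walk satisfies Lindley's recursion: \<open>max 0 (D + W)\<close>, with an independent step \<open>D\<close>, has the law
  of \<open>W\<close> with one step more.  With the undershoot \<open>U = max 0 (- (D + W))\<close> one has
  \<open>exp (- s * max 0 (D + W)) = exp (- s * (D + W)) + 1 - exp (s * U)\<close>, so in the limit of many steps
  \<open>E exp (- s * W) * (E exp (- s * D) - 1) = E (exp (s * U) - 1)\<close>, while \<open>E U = - E D\<close> is of order \<open>h\<close>.
  Without negative jumps undershoots are small enough that \<open>exp (s * U) - 1\<close> may be
  replaced by \<open>s * U\<close> up to an error \<open>o(h)\<close>; dividing by \<open>h\<close> gives the formula.  The absence of negative jumps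
  also makes the exponential moments finite (\<open>exp_moment\<close>), and Kingman's bound on \<open>E W\<close>,
  uniform in the mesh, makes the all-time maximum finite (\<open>expectation_W_le\<close>).

  \<^emph>\<open>Heavy traffic.\<close>  The formula for \<open>S (m + \<epsilon>)\<close> at the argument \<open>l * \<epsilon>\<close>, with the second-order expansion
  of the log-Laplace transform at \<open>0\<close>, yields the exponential limit of \<open>\<epsilon> * S (m + \<epsilon>)\<close>.  Independence
  appears because \<open>S (m + r)\<close> is nearly determined by the path up to a fixed time \<open>T\<close>, whereas
  \<open>S (m + \<epsilon>)\<close> stays within a random distance, the same for all \<open>\<epsilon>\<close>, of the all-time maximum of the path
  restarted at \<open>T\<close>; the factor \<open>\<epsilon>\<close> wipes this distance out (\<open>joint_laplace_limit\<close>).  Finally, on the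
  quadrant, convergence of Laplace transforms at integer arguments implies weak convergence
  (\<open>converges_weakly_laplace\<close>).
\<close>

section \<open>Suprema and drops of cadlag paths\<close>

lemma cadlag_right_close:
  assumes "cadlag f" "0 \<le> x" "0 < e"
  shows "\<exists>d>0. \<forall>y. x \<le> y \<and> y < x + d \<longrightarrow> \<bar>f y - f x\<bar> < e"
proof -
  have "(f \<longlongrightarrow> f x) (at_right x)"
    using assms by (simp add: cadlag_def continuous_within)
  then have "\<forall>\<^sub>F y in at_right x. dist (f y) (f x) < e"
    using assms(3) by (simp add: tendsto_iff)
  then obtain b where b: "b > x" "\<And>y. y > x \<Longrightarrow> y < b \<Longrightarrow> dist (f y) (f x) < e"
    unfolding eventually_at_right_field by blast
  have "\<bar>f y - f x\<bar> < e" if "x \<le> y" "y < x + (b - x)" for y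
    using b(2)[of y] that assms(3) by (cases "y = x") (auto simp: dist_real_def)
  then show ?thesis using b(1) by (intro exI[of _ "b - x"]) auto
qed

lemma cadlag_left_close:
  assumes "cadlag f" "0 < x"
  obtains l where "(f \<longlongrightarrow> l) (at_left x)"
    and "\<And>e. 0 < e \<Longrightarrow> \<exists>d>0. \<forall>y. x - d < y \<and> y < x \<longrightarrow> \<bar>f y - l\<bar> < e"
proof -
  obtain l where l: "(f \<longlongrightarrow> l) (at_left x)"
    using assms by (auto simp: cadlag_def)
  have "\<exists>d>0. \<forall>y. x - d < y \<and> y < x \<longrightarrow> \<bar>f y - l\<bar> < e" if "0 < e" for e
  proof -
    have "\<forall>\<^sub>F y in at_left x. dist (f y) l < e"
      using l that by (simp add: tendsto_iff)
    then obtain b where "b < x" "\<And>y. y > b \<Longrightarrow> y < x \<Longrightarrow> dist (f y) l < e"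
      unfolding eventually_at_left_field by blast
    then show ?thesis by (intro exI[of _ "x - b"]) (auto simp: dist_real_def)
  qed
  with l that show thesis by blast
qed

lemma cadlag_bounded:
  assumes f: "cadlag f" and t: "0 \<le> t"
  obtains B where "\<And>s. 0 \<le> s \<Longrightarrow> s \<le> t \<Longrightarrow> \<bar>f s\<bar> \<le> B"
proof -
  have "\<exists>B. \<forall>s. 0 \<le> s \<and> 0 \<le> s \<and> s \<le> t \<longrightarrow> \<bar>f s\<bar> \<le> B"
  proof (rule Bolzano[of 0 t "\<lambda>a b. \<exists>B. \<forall>s. 0 \<le> s \<and> a \<le> s \<and> s \<le> b \<longrightarrow> \<bar>f s\<bar> \<le> B"])
    fix a b c :: real
    assume "\<exists>B. \<forall>s. 0 \<le> s \<and> a \<le> s \<and> s \<le> b \<longrightarrow> \<bar>f s\<bar> \<le> B"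
      and "\<exists>B. \<forall>s. 0 \<le> s \<and> b \<le> s \<and> s \<le> c \<longrightarrow> \<bar>f s\<bar> \<le> B"
    then obtain B1 B2 where "\<forall>s. 0 \<le> s \<and> a \<le> s \<and> s \<le> b \<longrightarrow> \<bar>f s\<bar> \<le> B1"
      "\<forall>s. 0 \<le> s \<and> b \<le> s \<and> s \<le> c \<longrightarrow> \<bar>f s\<bar> \<le> B2" by blast
    then show "\<exists>B. \<forall>s. 0 \<le> s \<and> a \<le> s \<and> s \<le> c \<longrightarrow> \<bar>f s\<bar> \<le> B"
      by (intro exI[of _ "max B1 B2"]) (metis le_cases le_max_iff_disj)
  next
    fix x :: real assume x: "0 \<le> x" "x \<le> t"
    obtain d1 where d1: "d1 > 0" "\<And>y. x \<le> y \<Longrightarrow> y < x + d1 \<Longrightarrow> \<bar>f y - f x\<bar> < 1"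
      using cadlag_right_close[OF f x(1), of 1] by auto
    have "\<exists>d l. d > 0 \<and> (\<forall>y. 0 \<le> y \<and> x - d < y \<and> y < x \<longrightarrow> \<bar>f y - l\<bar> < 1)"
    proof (cases "x = 0")
      case True
      then show ?thesis by (intro exI[of _ 1]) auto
    next
      case False
      with x have "0 < x" by simp
      from cadlag_left_close[OF f this] obtain l where
        "\<And>e. 0 < e \<Longrightarrow> \<exists>d>0. \<forall>y. x - d < y \<and> y < x \<longrightarrow> \<bar>f y - l\<bar> < e" by blast
      from this[of 1] show ?thesis by auto
    qed
    then obtain d2 l where d2: "d2 > 0" "\<And>y. 0 \<le> y \<Longrightarrow> x - d2 < y \<Longrightarrow> y < x \<Longrightarrow> \<bar>f y - l\<bar> < 1"
      by blast
    have "\<bar>f s\<bar> \<le> \<bar>f x\<bar> + \<bar>l\<bar> + 1"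
      if "a \<le> x" "x \<le> b" "b - a < min d1 d2" "0 \<le> s" "a \<le> s" "s \<le> b" for a b s
      using that d1(2)[of s] d2(2)[of s] by (cases "x \<le> s") auto
    then show "\<exists>d>0. \<forall>a b. a \<le> x \<and> x \<le> b \<and> b - a < d \<longrightarrow>
        (\<exists>B. \<forall>s. 0 \<le> s \<and> a \<le> s \<and> s \<le> b \<longrightarrow> \<bar>f s\<bar> \<le> B)"
      using d1(1) d2(1) by (intro exI[of _ "min d1 d2"]) (auto intro!: exI[of _ "\<bar>f x\<bar> + \<bar>l\<bar> + 1"])
  qed (use t in auto)
  with that show thesis by auto
qed

text \<open>
  A left limit lies below the value at the point, so a fall of more than \<open>e\<close> cannot straddle \<open>x\<close>; on
  either side of \<open>x\<close> the path is nearly constant.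
\<close>

lemma local_drop_small:
  assumes f: "cadlag f" and up: "\<forall>t>0. \<forall>l. (f \<longlongrightarrow> l) (at_left t) \<longrightarrow> l \<le> f t"
    and x: "0 \<le> x" and e: "0 < e"
  shows "\<exists>d>0. \<forall>u v. 0 \<le> u \<and> u \<le> v \<and> \<bar>u - x\<bar> < d \<and> \<bar>v - x\<bar> < d \<longrightarrow> f u - f v \<le> e"
proof -
  obtain d1 where d1: "d1 > 0" "\<And>y. x \<le> y \<Longrightarrow> y < x + d1 \<Longrightarrow> \<bar>f y - f x\<bar> < e/2"
    using cadlag_right_close[OF f x, of "e/2"] e by auto
  have "\<exists>d l. d > 0 \<and> l \<le> f x \<and> (\<forall>y. 0 \<le> y \<and> x - d < y \<and> y < x \<longrightarrow> \<bar>f y - l\<bar> < e/2)"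
  proof (cases "x = 0")
    case True
    then show ?thesis by (intro exI[of _ 1] exI[of _ "f x"]) auto
  next
    case False
    with x have x0: "0 < x" by simp
    from cadlag_left_close[OF f this] obtain l where
      l: "(f \<longlongrightarrow> l) (at_left x)" "\<And>e. 0 < e \<Longrightarrow> \<exists>d>0. \<forall>y. x - d < y \<and> y < x \<longrightarrow> \<bar>f y - l\<bar> < e"
      by blast
    from l(2)[of "e/2"] l(1) up x0 e show ?thesis by (metis half_gt_zero)
  qed
  then obtain d2 l where d2: "d2 > 0" "l \<le> f x"
      "\<And>y. 0 \<le> y \<Longrightarrow> x - d2 < y \<Longrightarrow> y < x \<Longrightarrow> \<bar>f y - l\<bar> < e/2"
    by blast
  have "f u - f v \<le> e" if "0 \<le> u" "u \<le> v" "\<bar>u - x\<bar> < min d1 d2" "\<bar>v - x\<bar> < min d1 d2" for u v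
  proof -
    have u: "x \<le> u \<Longrightarrow> \<bar>f u - f x\<bar> < e/2" "u < x \<Longrightarrow> \<bar>f u - l\<bar> < e/2"
      using d1(2)[of u] d2(3)[of u] that by auto
    have v: "x \<le> v \<Longrightarrow> \<bar>f v - f x\<bar> < e/2" "v < x \<Longrightarrow> \<bar>f v - l\<bar> < e/2"
      using d1(2)[of v] d2(3)[of v] that by auto
    have "f u < f x + e/2 \<or> f u < l + e/2 \<and> u < x" "f x - e/2 < f v \<or> l - e/2 < f v \<and> v < x"
      using u v by (cases "x \<le> u"; cases "x \<le> v"; argo)+
    then show ?thesis using u v d2(2) that(2) by argo
  qed
  then show ?thesis using d1(1) d2(1) by (intro exI[of _ "min d1 d2"]) auto
qed

lemma grid_drops_small:
  assumes f: "cadlag f" and up: "\<forall>t>0. \<forall>l. (f \<longlongrightarrow> l) (at_left t) \<longrightarrow> l \<le> f t"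
    and e: "0 < e"
  shows "\<forall>\<^sub>F n in sequentially. \<forall>k<2^n. f (real k / 2^n) - f (real (Suc k) / 2^n) \<le> e"
proof -
  have "\<forall>x\<in>{0..1}. \<exists>d>0. \<forall>u v. 0 \<le> u \<and> u \<le> v \<and> \<bar>u - x\<bar> < d \<and> \<bar>v - x\<bar> < d \<longrightarrow> f u - f v \<le> e"
    using local_drop_small[OF f up _ e] by auto
  then obtain d where d: "\<And>x. x \<in> {0..1} \<Longrightarrow> d x > 0"
     "\<And>x u v. x \<in> {0..1} \<Longrightarrow> 0 \<le> u \<Longrightarrow> u \<le> v \<Longrightarrow> \<bar>u - x\<bar> < d x \<Longrightarrow> \<bar>v - x\<bar> < d x \<Longrightarrow> f u - f v \<le> e"
    by metis
  \<comment> \<open>A Lebesgue number for the cover by the neighbourhoods of local smallness.\<close>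
  obtain r where r: "0 < r" "\<And>x. x \<in> {0..1::real} \<Longrightarrow> \<exists>G \<in> (\<lambda>x. ball x (d x)) ` {0..1}. ball x r \<subseteq> G"
  proof (rule Heine_Borel_lemma[of "{0..1::real}" "(\<lambda>x. ball x (d x)) ` {0..1}"])
    show "{0..1} \<subseteq> \<Union> ((\<lambda>x. ball x (d x)) ` {0..1})" using d(1) by (auto intro!: bexI)
  qed auto
  have "(\<lambda>n. (1/2::real)^n) \<longlonglongrightarrow> 0" by (intro LIMSEQ_realpow_zero) auto
  then have "\<forall>\<^sub>F n in sequentially. (1/2::real)^n < r"
    using r(1) by (auto dest: order_tendstoD(2))
  then show ?thesis
  proof eventually_elim
    case (elim n)
    show ?case
    proof safe
      fix k :: nat assume k: "k < 2^n"
      then have "real k < 2^n" by (simp flip: of_nat_less_iff)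
      then have "real k / 2^n \<in> {0..1}" by auto
      from r(2)[OF this] obtain x where x: "x \<in> {0..1}" "ball (real k / 2^n) r \<subseteq> ball x (d x)" by auto
      have "real k / 2^n \<in> ball (real k / 2^n) r" "real (Suc k) / 2^n \<in> ball (real k / 2^n) r"
        using elim r(1) by (auto simp: dist_real_def field_simps)
      then have "real k / 2^n \<in> ball x (d x)" "real (Suc k) / 2^n \<in> ball x (d x)"
        using x(2) by blast+
      then show "f (real k / 2^n) - f (real (Suc k) / 2^n) \<le> e"
        by (intro d(2)[OF x(1)]) (auto simp: dist_real_def divide_right_mono)
    qed
  qed
qed

text \<open>
  By right continuity the value at \<open>s\<close> is approximated by values at grid points slightly to the right of
  \<open>s\<close>.
\<close>

lemma SUP_right_dense:
  fixes f :: "real \<Rightarrow> real" and G :: "nat \<Rightarrow> real set"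
  assumes f: "cadlag f" and A: "A \<subseteq> {0..}" "A \<noteq> {}"
    and G: "\<And>n. finite (G n)" "\<And>n. G n \<noteq> {}" "\<And>n. G n \<subseteq> A" "\<And>n. G n \<subseteq> G (Suc n)"
    and dense: "\<And>s d. s \<in> A \<Longrightarrow> 0 < d \<Longrightarrow> \<exists>n. \<exists>q\<in>G n. s \<le> q \<and> q < s + d"
    and bd: "\<And>n. Max (f ` G n) \<le> B"
  shows "\<And>s. s \<in> A \<Longrightarrow> f s \<le> B" and "(\<lambda>n. Max (f ` G n)) \<longlonglongrightarrow> (SUP s\<in>A. f s)"
proof -
  have *: "\<exists>n. f s - e < Max (f ` G n)" if s: "s \<in> A" and e: "0 < e" for s e
  proof -
    obtain d where d: "d > 0" "\<And>y. s \<le> y \<Longrightarrow> y < s + d \<Longrightarrow> \<bar>f y - f s\<bar> < e"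
      using cadlag_right_close[OF f _ e, of s] s A by blast
    obtain n q where q: "q \<in> G n" "s \<le> q" "q < s + d" using dense[OF s d(1)] by blast
    have "f s - e < f q" using d(2)[OF q(2,3)] by auto
    also have "f q \<le> Max (f ` G n)" using G(1) q(1) by auto
    finally show ?thesis by blast
  qed
  show B: "f s \<le> B" if "s \<in> A" for s
  proof (rule field_le_epsilon)
    fix e :: real assume "0 < e"
    from *[OF that this] bd show "f s \<le> B + e" by (smt (verit))
  qed
  then have bdd: "bdd_above (f ` A)" by (intro bdd_aboveI[of _ B]) auto
  have mono: "incseq (\<lambda>n. Max (f ` G n))"
    using G by (intro incseq_SucI Max_mono image_mono) auto
  have le: "Max (f ` G n) \<le> (SUP s\<in>A. f s)" for n
    using G bdd by (auto simp: subset_iff intro!: cSUP_upper)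
  show "(\<lambda>n. Max (f ` G n)) \<longlonglongrightarrow> (SUP s\<in>A. f s)"
  proof (rule increasing_tendsto)
    show "\<forall>\<^sub>F n in sequentially. Max (f ` G n) \<le> (SUP s\<in>A. f s)" using le by simp
    fix x assume "x < (SUP s\<in>A. f s)"
    then obtain s where s: "s \<in> A" "x < f s" using less_cSUP_iff[OF A(2) bdd] by blast
    from *[OF s(1), of "f s - x"] s(2) obtain n where "x < Max (f ` G n)" by auto
    then have "x < Max (f ` G m)" if "n \<le> m" for m
      using incseqD[OF mono that] by simp
    then show "\<forall>\<^sub>F n in sequentially. x < Max (f ` G n)"
      unfolding eventually_sequentially by blast
  qed
qed

lemma dyadic_above:
  fixes s d :: real
  assumes "0 \<le> s" "0 < d"
  shows "\<exists>N. \<forall>n\<ge>N. \<exists>k. s \<le> real k / 2^n \<and> real k / 2^n < s + d \<and> k \<le> nat \<lceil>s * 2^n\<rceil>"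
proof -
  have "(\<lambda>n. (1/2::real)^n) \<longlonglongrightarrow> 0" by (intro LIMSEQ_realpow_zero) auto
  then have "\<forall>\<^sub>F n in sequentially. (1/2::real)^n < d"
    using assms by (auto dest: order_tendstoD(2))
  then obtain N where N: "\<And>n. n \<ge> N \<Longrightarrow> (1/2::real)^n < d" by (auto simp: eventually_sequentially)
  have "s \<le> real (nat \<lceil>s * 2^n\<rceil>) / 2^n \<and> real (nat \<lceil>s * 2^n\<rceil>) / 2^n < s + d" if "n \<ge> N" for n
  proof -
    have "real (nat \<lceil>s * 2^n\<rceil>) = of_int \<lceil>s * 2^n\<rceil>"
      using assms(1) by (simp add: ceiling_le_iff)
    moreover have "s * 2^n \<le> of_int \<lceil>s * 2^n\<rceil>" "of_int \<lceil>s * 2^n\<rceil> < s * 2^n + 1" by linarith+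
    moreover have "1 < d * 2^n" using N[OF that] by (simp add: field_simps power_one_over)
    ultimately show ?thesis by (auto simp: field_simps)
  qed
  then show ?thesis by blast
qed

text \<open>
  The grid of mesh \<open>1 / 2^n\<close> with \<open>4^n\<close> steps reaches up to time \<open>2^n\<close>, so one index refines the mesh and
  extends the horizon together.
\<close>

lemma SUP_grid_halfline:
  assumes f: "cadlag f" and bd: "\<And>n. (MAX k\<in>{..4^n}. f (real k / 2^n)) \<le> B"
  shows "\<And>s. 0 \<le> s \<Longrightarrow> f s \<le> B"
    and "(\<lambda>n. MAX k\<in>{..4^n}. f (real k / 2^n)) \<longlonglongrightarrow> (SUP s\<in>{0..}. f s)"
proof -
  define G where "G n = (\<lambda>k. real k / 2^n) ` {..(4::nat)^n}" for n
  have eq: "f ` G n = (\<lambda>k. f (real k / 2^n)) ` {..4^n}" for n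
    by (auto simp: G_def)
  have mono: "G n \<subseteq> G (Suc n)" for n
  proof
    fix q assume "q \<in> G n"
    then obtain k where "k \<le> 4^n" "q = real k / 2^n" by (auto simp: G_def)
    then show "q \<in> G (Suc n)" by (auto simp: G_def intro!: image_eqI[of _ _ "2*k"])
  qed
  have dense: "\<exists>n. \<exists>q\<in>G n. s \<le> q \<and> q < s + d" if s: "s \<in> {0..}" "0 < d" for s d :: real
  proof -
    obtain N where N: "\<And>n. n \<ge> N \<Longrightarrow> \<exists>k. s \<le> real k / 2^n \<and> real k / 2^n < s + d \<and> k \<le> nat \<lceil>s * 2^n\<rceil>"
      using dyadic_above[of s d] s by auto
    obtain N2 where N2: "s \<le> 2^N2"
      using real_arch_pow[of 2 s] by (auto intro: less_imp_le)
    define n where "n = max N N2"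
    have "s \<le> 2^n" using N2 by (rule order_trans) (auto simp: n_def)
    then have "s * 2^n \<le> 2^n * 2^n" by simp
    then have "s * 2^n \<le> real (4^n)" by (simp flip: power_mult_distrib)
    then have "nat \<lceil>s * 2^n\<rceil> \<le> 4^n" by (simp add: nat_le_iff ceiling_le_iff)
    moreover have "n \<ge> N" by (simp add: n_def)
    ultimately obtain k where k: "s \<le> real k / 2^n" "real k / 2^n < s + d" "k \<le> nat \<lceil>s * 2^n\<rceil>"
      using N[of n] by blast
    from k(3) \<open>nat \<lceil>s * 2^n\<rceil> \<le> 4^n\<close> have "k \<le> 4^n" by (rule order_trans)
    then have "real k / 2^n \<in> G n" unfolding G_def by blast
    with k show ?thesis by blast
  qed
  have bd': "Max (f ` G n) \<le> B" for n using bd[of n] unfolding eq .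
  have fin: "finite (G n)" "G n \<noteq> {}" "G n \<subseteq> {0..}" for n by (auto simp: G_def)
  note * = SUP_right_dense[where A = "{0..}" and G = G, OF f _ _ fin mono dense bd']
  show "f s \<le> B" if "0 \<le> s" for s using *(1)[of s] that by auto
  show "(\<lambda>n. MAX k\<in>{..4^n}. f (real k / 2^n)) \<longlonglongrightarrow> (SUP s\<in>{0..}. f s)"
    using *(2) by (auto simp: eq)
qed

lemma SUP_grid_interval:
  assumes f: "cadlag f" and t: "0 \<le> t"
  shows "(\<lambda>n. MAX k\<in>{..2^n}. f (t * (real k / 2^n))) \<longlonglongrightarrow> (SUP s\<in>{0..t}. f s)"
proof -
  define G where "G n = (\<lambda>k. t * (real k / 2^n)) ` {..(2::nat)^n}" for n
  have eq: "f ` G n = (\<lambda>k. f (t * (real k / 2^n))) ` {..2^n}" for n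
    by (auto simp: G_def)
  have mono: "G n \<subseteq> G (Suc n)" for n
  proof
    fix q assume "q \<in> G n"
    then obtain k where "k \<le> 2^n" "q = t * (real k / 2^n)" by (auto simp: G_def)
    then show "q \<in> G (Suc n)" by (auto simp: G_def intro!: image_eqI[of _ _ "2*k"])
  qed
  have dense: "\<exists>n. \<exists>q\<in>G n. s \<le> q \<and> q < s + d" if s: "s \<in> {0..t}" "0 < d" for s d :: real
  proof (cases "t = 0")
    case True
    then show ?thesis using s by (auto simp: G_def)
  next
    case False
    with t have t0: "0 < t" by simp
    obtain n k where k: "s/t \<le> real k / 2^n" "real k / 2^n < s/t + d/t" "k \<le> nat \<lceil>s/t * 2^n\<rceil>"
      using dyadic_above[of "s/t" "d/t"] s t0 by auto
    have "s/t * 2^n \<le> real (2^n)" using s t0 by (simp add: field_simps)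
    then have "nat \<lceil>s/t * 2^n\<rceil> \<le> 2^n" by (simp add: nat_le_iff ceiling_le_iff)
    with k(3) have "k \<le> 2^n" by (rule order_trans)
    then have "t * (real k / 2^n) \<in> G n" by (auto simp: G_def)
    moreover have "s \<le> t * (real k / 2^n)" "t * (real k / 2^n) < s + d"
      using k(1,2) t0 by (simp_all add: field_simps)
    ultimately show ?thesis by blast
  qed
  obtain B where B: "\<And>s. 0 \<le> s \<Longrightarrow> s \<le> t \<Longrightarrow> \<bar>f s\<bar> \<le> B"
    using cadlag_bounded[OF f t] by blast
  have sub: "G n \<subseteq> {0..t}" for n
  proof
    fix q assume "q \<in> G n"
    then obtain k where k: "k \<le> 2^n" "q = t * (real k / 2^n)" by (auto simp: G_def)
    from k(1) have "real k \<le> 2^n" by (simp flip: of_nat_le_iff)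
    then have "real k / 2^n \<le> 1" by (simp add: field_simps)
    then have "t * (real k / 2^n) \<le> t" using t by (intro mult_left_le) auto
    then show "q \<in> {0..t}" using k(2) t by auto
  qed
  have fin: "finite (G n)" "G n \<noteq> {}" for n by (auto simp: G_def)
  have bd': "Max (f ` G n) \<le> B" for n
  proof (rule Max.boundedI)
    fix y assume "y \<in> f ` G n"
    then obtain q where "q \<in> {0..t}" "y = f q" using sub[of n] by auto
    then show "y \<le> B" using B[of q] by auto
  qed (use fin in auto)
  have "(\<lambda>n. Max (f ` G n)) \<longlonglongrightarrow> (SUP s\<in>{0..t}. f s)"
    by (rule SUP_right_dense(2)[OF f _ _ fin sub mono dense bd']) (use t in auto)
  then show ?thesis by (simp add: eq)
qed

lemma SUP_interval_tendsto:
  fixes f :: "real \<Rightarrow> real"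
  assumes "\<And>s. 0 \<le> s \<Longrightarrow> f s \<le> B"
  shows "((\<lambda>t. SUP s\<in>{0..t}. f s) \<longlongrightarrow> (SUP s\<in>{0..}. f s)) at_top"
proof (rule increasing_tendsto)
  have bdd: "bdd_above (f ` {0..})" "bdd_above (f ` {0..t})" for t
    using assms by (intro bdd_aboveI[of _ B]; auto)+
  show "\<forall>\<^sub>F t in at_top. (SUP s\<in>{0..t}. f s) \<le> (SUP s\<in>{0..}. f s)"
    using eventually_ge_at_top[of 0]
    by eventually_elim (auto intro!: cSUP_subset_mono bdd)
  fix x assume "x < (SUP s\<in>{0..}. f s)"
  then obtain s where s: "0 \<le> s" "x < f s"
    using less_cSUP_iff[of "{0::real..}" f x, OF _ bdd(1)] by auto
  show "\<forall>\<^sub>F t in at_top. x < (SUP s\<in>{0..t}. f s)"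
    using eventually_ge_at_top[of s]
  proof eventually_elim
    case (elim t)
    then have "f s \<le> (SUP s\<in>{0..t}. f s)" using s by (intro cSUP_upper bdd) auto
    with s show ?case by simp
  qed
qed

section \<open>Maxima of random walks\<close>

text \<open>
  The recursion removes the first step rather than the last one: the steps that remain are a shifted copy of the
  walk, which is how Lindley's recursion appears below.
\<close>

primrec wmax :: "nat \<Rightarrow> (nat \<Rightarrow> real) \<Rightarrow> real" where
  "wmax 0 x = 0"
| "wmax (Suc k) x = max 0 (x 0 + wmax k (\<lambda>i. x (Suc i)))"

lemma wmax_nonneg: "0 \<le> wmax k x"
  by (cases k) auto

lemma wmax_cong: "(\<And>i. i < k \<Longrightarrow> x i = y i) \<Longrightarrow> wmax k x = wmax k y"
proof (induction k arbitrary: x y)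
  case (Suc k)
  have "wmax k (\<lambda>i. x (Suc i)) = wmax k (\<lambda>i. y (Suc i))" by (rule Suc.IH) (use Suc.prems in auto)
  then show ?case using Suc.prems[of 0] by simp
qed simp

lemma wmax_le_Suc: "wmax k x \<le> wmax (Suc k) x"
proof (induction k arbitrary: x)
  case (Suc k)
  show ?case using Suc.IH[of "\<lambda>i. x (Suc i)"] by (simp add: max_def)
qed (simp add: wmax_nonneg)

lemma wmax_eq_Max: "wmax k x = (MAX j\<in>{..k}. \<Sum>i<j. x i)"
proof (induction k arbitrary: x)
  case (Suc k)
  have "(MAX j\<in>{..Suc k}. \<Sum>i<j. x i) = Max (insert 0 ((\<lambda>j. (\<Sum>i<j. x (Suc i)) + x 0) ` {..k}))"
    by (simp add: atMost_Suc_eq_insert_0 image_image sum.lessThan_Suc_shift add.commute del: sum.lessThan_Suc)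
  also have "\<dots> = max 0 ((MAX j\<in>{..k}. \<Sum>i<j. x (Suc i)) + x 0)"
    by (subst Max_insert) (auto simp: Max_add_commute)
  finally show ?case by (simp add: Suc.IH add.commute)
qed simp

lemma borel_measurable_wmax [measurable (raw)]:
  assumes "\<And>i. i < k \<Longrightarrow> D i \<in> borel_measurable M"
  shows "(\<lambda>\<omega>. wmax k (\<lambda>i. D i \<omega>)) \<in> borel_measurable M"
  using assms
proof (induction k arbitrary: D)
  case (Suc k)
  have [measurable]: "D 0 \<in> borel_measurable M" "(\<lambda>\<omega>. wmax k (\<lambda>i. D (Suc i) \<omega>)) \<in> borel_measurable M"
    using Suc.prems by (auto intro!: Suc.IH)
  show ?case by simp
qed simp

context prob_space
begin

definition iid :: "real measure \<Rightarrow> (nat \<Rightarrow> 'a \<Rightarrow> real) \<Rightarrow> nat \<Rightarrow> bool" where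
  "iid \<mu> D n \<longleftrightarrow> indep_vars (\<lambda>_. borel) D {..<n} \<and> (\<forall>i<n. distr M borel (D i) = \<mu>)"

lemma iid_measurable: "iid \<mu> D n \<Longrightarrow> i < n \<Longrightarrow> D i \<in> borel_measurable M"
  by (auto simp: iid_def indep_vars_def)

lemma iid_reindex:
  assumes "iid \<mu> D n" and inj: "inj_on p {..<k}" and img: "p ` {..<k} \<subseteq> {..<n}"
  shows "iid \<mu> (\<lambda>i. D (p i)) k"
proof -
  let ?F = "\<lambda>i. {D i -` A \<inter> space M | A. A \<in> sets borel}"
  have ind: "indep_sets ?F {..<n}" and rv: "\<And>i. i < n \<Longrightarrow> D i \<in> borel_measurable M"
    using assms(1) by (auto simp: iid_def indep_vars_def2)
  have "indep_sets (\<lambda>i. ?F (p i)) {..<k}"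
    unfolding indep_sets_def
  proof (intro conjI allI impI ballI)
    fix i assume "i \<in> {..<k}"
    then show "?F (p i) \<subseteq> events" using img ind by (auto simp: indep_sets_def)
  next
    fix J A assume J: "J \<subseteq> {..<k}" "J \<noteq> {}" "finite J" and A: "A \<in> Pi J (\<lambda>i. ?F (p i))"
    have injJ: "inj_on p J" using inj J(1) by (rule inj_on_subset)
    define B where "B i = A (the_inv_into J p i)" for i
    have B: "B (p j) = A j" if "j \<in> J" for j
      using that injJ by (simp add: B_def the_inv_into_f_f)
    have "B \<in> Pi (p ` J) ?F"
    proof (rule Pi_I)
      fix i assume "i \<in> p ` J"
      then obtain j where "j \<in> J" "i = p j" by blast
      then show "B i \<in> ?F i" using Pi_mem[OF A, of j] B[of j] by simp
    qed
    then have "prob (\<Inter>i\<in>p`J. B i) = (\<Prod>i\<in>p`J. prob (B i))"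
      using ind J img unfolding indep_sets_def by (meson finite_imageI image_is_empty image_mono order_trans)
    then show "prob (\<Inter>j\<in>J. A j) = (\<Prod>j\<in>J. prob (A j))"
      by (simp add: prod.reindex[OF injJ] B)
  qed
  then show ?thesis
    using assms(1) img rv unfolding iid_def indep_vars_def2 by (auto simp: subset_iff)
qed

text \<open>
  Applied to shifted steps (stationarity of the walk) and to steps in reversed order (time reversal).
\<close>

lemma iid_functional_distr:
  assumes D: "iid \<mu> D n" and D': "iid \<mu> D' n"
    and F: "F \<in> measurable (PiM {..<n} (\<lambda>_. borel)) N"
  shows "distr M N (\<lambda>\<omega>. F (\<lambda>i\<in>{..<n}. D i \<omega>)) = distr M N (\<lambda>\<omega>. F (\<lambda>i\<in>{..<n}. D' i \<omega>))"
proof (cases "n = 0")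
  case False
  then have ne: "{..<n} \<noteq> {}" by auto
  have joint: "distr M (PiM {..<n} (\<lambda>_. borel)) (\<lambda>\<omega>. \<lambda>i\<in>{..<n}. E i \<omega>) = PiM {..<n} (\<lambda>_. \<mu>)"
    if E: "iid \<mu> E n" for E
  proof -
    have "distr M (PiM {..<n} (\<lambda>_. borel)) (\<lambda>\<omega>. \<lambda>i\<in>{..<n}. E i \<omega>) = PiM {..<n} (\<lambda>i. distr M borel (E i))"
      using E iid_measurable[OF E]
      by (intro indep_vars_iff_distr_eq_PiM'[THEN iffD1] ne) (auto simp: iid_def)
    also have "\<dots> = PiM {..<n} (\<lambda>_. \<mu>)"
      using E by (intro PiM_cong) (auto simp: iid_def)
    finally show ?thesis .
  qed
  have d: "distr M N (\<lambda>\<omega>. F (\<lambda>i\<in>{..<n}. E i \<omega>)) = distr (PiM {..<n} (\<lambda>_. \<mu>)) N F" if E: "iid \<mu> E n" for E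
  proof -
    have "(\<lambda>\<omega>. \<lambda>i\<in>{..<n}. E i \<omega>) \<in> measurable M (PiM {..<n} (\<lambda>_. borel))"
      using iid_measurable[OF E] by (intro measurable_restrict) auto
    from distr_distr[OF F this] show ?thesis by (simp add: joint[OF E] comp_def)
  qed
  show ?thesis by (simp add: d[OF D] d[OF D'])
qed (simp add: restrict_def)

lemma wmax_measurable_PiM:
  "k \<le> n \<Longrightarrow> (\<lambda>x. wmax k (\<lambda>i. x i - c)) \<in> borel_measurable (PiM {..<n} (\<lambda>_. borel))"
  by (intro borel_measurable_wmax borel_measurable_diff measurable_component_singleton) auto

lemma iid_nn_integral_prod:
  fixes f :: "real \<Rightarrow> ennreal"
  assumes D: "iid \<mu> D n" and n: "0 < n" and f [measurable]: "f \<in> borel_measurable borel"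
  shows "(\<integral>\<^sup>+\<omega>. (\<Prod>k<n. f (D k \<omega>)) \<partial>M) = (\<integral>\<^sup>+\<omega>. f (D 0 \<omega>) \<partial>M) ^ n"
proof -
  note rv = iid_measurable[OF D]
  have ind: "indep_vars (\<lambda>_. borel) (\<lambda>k \<omega>. f (D k \<omega>)) {..<n}"
    by (rule indep_vars_compose2[where X = D and M' = "\<lambda>_. borel"]) (use D in \<open>auto simp: iid_def\<close>)
  have same: "(\<integral>\<^sup>+\<omega>. f (D k \<omega>) \<partial>M) = (\<integral>\<^sup>+x. f x \<partial>\<mu>)" if "k < n" for k
  proof -
    have "(\<integral>\<^sup>+x. f x \<partial>distr M borel (D k)) = (\<integral>\<^sup>+\<omega>. f (D k \<omega>) \<partial>M)"
      using rv[OF that] by (subst nn_integral_distr) auto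
    then show ?thesis using D that by (simp add: iid_def)
  qed
  have "(\<integral>\<^sup>+\<omega>. (\<Prod>k<n. f (D k \<omega>)) \<partial>M) = (\<Prod>k<n. \<integral>\<^sup>+\<omega>. f (D k \<omega>) \<partial>M)"
    by (rule indep_vars_nn_integral[OF _ ind]) auto
  also have "\<dots> = (\<Prod>k<n. \<integral>\<^sup>+\<omega>. f (D 0 \<omega>) \<partial>M)"
    using same same[OF n] by (intro prod.cong) auto
  finally show ?thesis by simp
qed

lemma iid_wmax_distr:
  assumes "iid \<mu> D n" "iid \<mu> D' n"
  shows "distr M borel (\<lambda>\<omega>. wmax n (\<lambda>i. D i \<omega>)) = distr M borel (\<lambda>\<omega>. wmax n (\<lambda>i. D' i \<omega>))"
proof -
  have *: "wmax n (\<lambda>i. E i \<omega>) = wmax n (\<lambda>i. (\<lambda>i\<in>{..<n}. E i \<omega>) i - 0)" for E :: "nat \<Rightarrow> 'a \<Rightarrow> real" and \<omega>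
    by (rule wmax_cong) auto
  show ?thesis
    unfolding *[of D] *[of D']
    by (rule iid_functional_distr[OF assms wmax_measurable_PiM]) simp
qed

lemma wmax_indep:
  assumes ind: "indep_vars (\<lambda>_. borel) D {..<a + b}"
  shows "indep_var borel (\<lambda>\<omega>. wmax a (\<lambda>i. D i \<omega> - c)) borel (\<lambda>\<omega>. wmax b (\<lambda>i. D (a + i) \<omega> - c'))"
proof -
  let ?A = "{..<a}" and ?B = "{a..<a+b}"
  have 1: "indep_var (PiM ?A (\<lambda>_. borel)) (\<lambda>\<omega>. restrict (\<lambda>i. D i \<omega>) ?A)
     (PiM ?B (\<lambda>_. borel)) (\<lambda>\<omega>. restrict (\<lambda>i. D i \<omega>) ?B)"
    by (rule indep_var_restrict[OF ind]) auto
  have 2: "(\<lambda>x. wmax b (\<lambda>i. x (a + i) - c')) \<in> borel_measurable (PiM ?B (\<lambda>_. borel))"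
    by (intro borel_measurable_wmax borel_measurable_diff measurable_component_singleton) auto
  have "indep_var borel ((\<lambda>x. wmax a (\<lambda>i. x i - c)) \<circ> (\<lambda>\<omega>. restrict (\<lambda>i. D i \<omega>) ?A))
     borel ((\<lambda>x. wmax b (\<lambda>i. x (a + i) - c')) \<circ> (\<lambda>\<omega>. restrict (\<lambda>i. D i \<omega>) ?B))"
    by (rule indep_var_compose[OF 1 wmax_measurable_PiM[OF order_refl] 2])
  moreover have "((\<lambda>x. wmax a (\<lambda>i. x i - c)) \<circ> (\<lambda>\<omega>. restrict (\<lambda>i. D i \<omega>) ?A)) = (\<lambda>\<omega>. wmax a (\<lambda>i. D i \<omega> - c))"
    by (auto simp: fun_eq_iff intro!: wmax_cong)
  moreover have "((\<lambda>x. wmax b (\<lambda>i. x (a + i) - c')) \<circ> (\<lambda>\<omega>. restrict (\<lambda>i. D i \<omega>) ?B)) = (\<lambda>\<omega>. wmax b (\<lambda>i. D (a + i) \<omega> - c'))"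
    by (auto simp: fun_eq_iff intro!: wmax_cong)
  ultimately show ?thesis by simp
qed

lemma integral_cong_distr:
  fixes f :: "real \<Rightarrow> real"
  assumes "distr M borel X = distr M borel Y" "X \<in> borel_measurable M" "Y \<in> borel_measurable M"
    "f \<in> borel_measurable borel"
  shows "expectation (\<lambda>\<omega>. f (X \<omega>)) = expectation (\<lambda>\<omega>. f (Y \<omega>))"
    and "integrable M (\<lambda>\<omega>. f (X \<omega>)) \<longleftrightarrow> integrable M (\<lambda>\<omega>. f (Y \<omega>))"
  using integral_distr[OF assms(2,4)] integral_distr[OF assms(3,4)]
    integrable_distr_eq[OF assms(2,4)] integrable_distr_eq[OF assms(3,4)] assms(1) by auto

lemma integrable_of_square:
  assumes [measurable]: "(X :: 'a \<Rightarrow> real) \<in> borel_measurable M" and "integrable M (\<lambda>\<omega>. (X \<omega>)\<^sup>2)"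
  shows "integrable M X"
  using square_integrable_imp_integrable[OF assms] .

lemma integrable_add_square:
  assumes [measurable]: "(X :: 'a \<Rightarrow> real) \<in> borel_measurable M" "Y \<in> borel_measurable M"
    and "integrable M (\<lambda>\<omega>. (X \<omega>)\<^sup>2)" "integrable M (\<lambda>\<omega>. (Y \<omega>)\<^sup>2)"
  shows "integrable M (\<lambda>\<omega>. (X \<omega> + Y \<omega>)\<^sup>2)"
proof (rule Bochner_Integration.integrable_bound)
  show "integrable M (\<lambda>\<omega>. 2 * (X \<omega>)\<^sup>2 + 2 * (Y \<omega>)\<^sup>2)" using assms by auto
  show "AE x in M. norm ((X x + Y x)\<^sup>2) \<le> norm (2 * (X x)\<^sup>2 + 2 * (Y x)\<^sup>2)"
  proof (rule AE_I2)
    fix x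
    have "(X x + Y x)\<^sup>2 \<le> 2 * (X x)\<^sup>2 + 2 * (Y x)\<^sup>2"
      using sum_squares_ge_zero[of "X x - Y x" 0] by (simp add: power2_eq_square algebra_simps)
    then show "norm ((X x + Y x)\<^sup>2) \<le> norm (2 * (X x)\<^sup>2 + 2 * (Y x)\<^sup>2)" by simp
  qed
qed simp

end

text \<open>
  Dropping the first step turns \<open>W\<close> into \<open>V\<close>, which has the law of \<open>W\<close> and is independent of that step.
  Hence \<open>W_Suc\<close> is Lindley's recursion in law.
\<close>

locale random_walk = prob_space +
  fixes D :: "nat \<Rightarrow> 'a \<Rightarrow> real" and \<mu> :: "real measure" and a :: real
  assumes iid: "iid \<mu> D n"
    and square_integrable_step: "integrable M (\<lambda>\<omega>. (D 0 \<omega>)\<^sup>2)"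
    and mean_step: "expectation (D 0) = - a"
    and neg_drift: "0 < a"
begin

definition W :: "nat \<Rightarrow> 'a \<Rightarrow> real" where "W k \<omega> = wmax k (\<lambda>i. D i \<omega>)"

definition V :: "nat \<Rightarrow> 'a \<Rightarrow> real" where "V k \<omega> = wmax k (\<lambda>i. D (Suc i) \<omega>)"

lemma measurable_step [measurable]: "D i \<in> borel_measurable M"
  using iid_measurable[OF iid[of "Suc i"]] by simp

lemma measurable_W [measurable]: "W k \<in> borel_measurable M"
  and measurable_V [measurable]: "V k \<in> borel_measurable M"
  unfolding W_def V_def by measurable

lemma W_Suc: "W (Suc k) \<omega> = max 0 (D 0 \<omega> + V k \<omega>)"
  by (simp add: W_def V_def)

lemma W_nonneg: "0 \<le> W k \<omega>" and V_nonneg: "0 \<le> V k \<omega>"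
  by (simp_all add: W_def V_def wmax_nonneg)

lemma W_mono: "W k \<omega> \<le> W (Suc k) \<omega>"
  unfolding W_def by (rule wmax_le_Suc)

lemma distr_V: "distr M borel (V k) = distr M borel (W k)"
  unfolding V_def W_def
  by (rule iid_wmax_distr[OF iid_reindex[OF iid[of "Suc k"]] iid]) auto

lemma indep_step_V: "indep_var borel (D 0) borel (V k)"
proof -
  have 1: "indep_var (PiM {0} (\<lambda>_. borel)) (\<lambda>\<omega>. restrict (\<lambda>i. D i \<omega>) {0})
     (PiM {1..<Suc k} (\<lambda>_. borel)) (\<lambda>\<omega>. restrict (\<lambda>i. D i \<omega>) {1..<Suc k})"
    using iid[of "Suc k"] by (intro indep_var_restrict[where I = "{..<Suc k}"]) (auto simp: iid_def)
  have 2: "(\<lambda>x. wmax k (\<lambda>i. x (Suc i))) \<in> borel_measurable (PiM {1..<Suc k} (\<lambda>_. borel))"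
    by (intro borel_measurable_wmax measurable_component_singleton) auto
  have 3: "(\<lambda>x. x 0) \<in> borel_measurable (PiM {0::nat} (\<lambda>_. borel :: real measure))"
    by (intro measurable_component_singleton) auto
  have "indep_var borel ((\<lambda>x. x 0) \<circ> (\<lambda>\<omega>. restrict (\<lambda>i. D i \<omega>) {0}))
     borel ((\<lambda>x. wmax k (\<lambda>i. x (Suc i))) \<circ> (\<lambda>\<omega>. restrict (\<lambda>i. D i \<omega>) {1..<Suc k}))"
    by (rule indep_var_compose[OF 1 3 2])
  moreover have "((\<lambda>x. x 0) \<circ> (\<lambda>\<omega>. restrict (\<lambda>i. D i \<omega>) {0})) = D 0"
    by (auto simp: fun_eq_iff)
  moreover have "((\<lambda>x. wmax k (\<lambda>i. x (Suc i))) \<circ> (\<lambda>\<omega>. restrict (\<lambda>i. D i \<omega>) {1..<Suc k})) = V k"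
    by (auto simp: fun_eq_iff V_def intro!: wmax_cong)
  ultimately show ?thesis by simp
qed

lemma integrable_step: "integrable M (D 0)"
  by (rule integrable_of_square[OF measurable_step square_integrable_step])

lemma expectation_V: "f \<in> borel_measurable borel \<Longrightarrow> expectation (\<lambda>\<omega>. f (V k \<omega>) :: real) = expectation (\<lambda>\<omega>. f (W k \<omega>))"
  by (rule integral_cong_distr[OF distr_V]) auto

lemma integrable_V: "f \<in> borel_measurable borel \<Longrightarrow> integrable M (\<lambda>\<omega>. f (V k \<omega>) :: real) \<longleftrightarrow> integrable M (\<lambda>\<omega>. f (W k \<omega>))"
  by (rule integral_cong_distr[OF distr_V]) auto

lemma square_integrable_W: "integrable M (\<lambda>\<omega>. (W k \<omega>)\<^sup>2)"
proof (induction k)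
  case 0
  then show ?case by (simp add: W_def)
next
  case (Suc k)
  have V2: "integrable M (\<lambda>\<omega>. (V k \<omega>)\<^sup>2)"
    using Suc integrable_V[of "\<lambda>x. x\<^sup>2" k] by simp
  show ?case
  proof (rule Bochner_Integration.integrable_bound)
    show "integrable M (\<lambda>\<omega>. (D 0 \<omega> + V k \<omega>)\<^sup>2)"
      by (rule integrable_add_square[OF _ _ square_integrable_step V2]) auto
  qed (auto simp: W_Suc max_def)
qed

lemma integrable_W: "integrable M (W k)"
  by (rule integrable_of_square[OF measurable_W square_integrable_W])

lemma integrable_V1: "integrable M (V k)" and expectation_V1: "expectation (V k) = expectation (W k)"
  using integrable_V[of "\<lambda>x. x" k] expectation_V[of "\<lambda>x. x" k] integrable_W by auto

text \<open>
  Kingman's bound: the second moment of \<open>W k\<close> increases with \<open>k\<close>, and one step of the recursion changes it by at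
  most \<open>E (D 0)^2 - 2 * a * E (W k)\<close>.  For steps of a Levy process over time \<open>h\<close> numerator and
  denominator are both of order \<open>h\<close>, so the bound survives refinement of the mesh.
\<close>

lemma expectation_W_le: "expectation (W k) \<le> expectation (\<lambda>\<omega>. (D 0 \<omega>)\<^sup>2) / (2 * a)"
proof -
  have V2: "integrable M (\<lambda>\<omega>. (V k \<omega>)\<^sup>2)" "expectation (\<lambda>\<omega>. (V k \<omega>)\<^sup>2) = expectation (\<lambda>\<omega>. (W k \<omega>)\<^sup>2)"
    using integrable_V[of "\<lambda>x. x\<^sup>2" k] expectation_V[of "\<lambda>x. x\<^sup>2" k] square_integrable_W by auto
  have DV: "integrable M (\<lambda>\<omega>. D 0 \<omega> * V k \<omega>)"
     "expectation (\<lambda>\<omega>. D 0 \<omega> * V k \<omega>) = - a * expectation (W k)"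
    using indep_var_integrable[OF indep_step_V integrable_step integrable_V1]
      indep_var_lebesgue_integral[OF indep_step_V integrable_step integrable_V1]
    by (auto simp: mean_step expectation_V1)
  have "expectation (\<lambda>\<omega>. (W k \<omega>)\<^sup>2) \<le> expectation (\<lambda>\<omega>. (W (Suc k) \<omega>)\<^sup>2)"
    by (intro integral_mono square_integrable_W power_mono W_mono W_nonneg)
  also have "\<dots> \<le> expectation (\<lambda>\<omega>. (D 0 \<omega>)\<^sup>2 + (V k \<omega>)\<^sup>2 + 2 * (D 0 \<omega> * V k \<omega>))"
  proof (rule integral_mono)
    fix \<omega>
    show "(W (Suc k) \<omega>)\<^sup>2 \<le> (D 0 \<omega>)\<^sup>2 + (V k \<omega>)\<^sup>2 + 2 * (D 0 \<omega> * V k \<omega>)"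
      using power2_sum[of "D 0 \<omega>" "V k \<omega>"] zero_le_power2[of "D 0 \<omega> + V k \<omega>"]
      by (auto simp: W_Suc max_def algebra_simps)
  qed (use square_integrable_W square_integrable_step V2 DV in auto)
  also have "\<dots> = expectation (\<lambda>\<omega>. (D 0 \<omega>)\<^sup>2) + expectation (\<lambda>\<omega>. (W k \<omega>)\<^sup>2) - 2 * a * expectation (W k)"
    using square_integrable_step V2 DV by simp
  finally show ?thesis using neg_drift by (simp add: field_simps)
qed

end

section \<open>Second-order bounds for the exponential\<close>

lemma exp_quadratic_upper:
  fixes z a :: real
  assumes "z \<le> a" "0 \<le> a"
  shows "exp z \<le> 1 + z + z\<^sup>2 / 2 * exp a"
proof (cases "0 \<le> z")
  case True
  obtain t where t: "\<bar>t\<bar> \<le> \<bar>z\<bar>" "exp z = (\<Sum>m<2. z ^ m / fact m) + exp t / fact 2 * z ^ 2"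
    using Maclaurin_exp_le[of z 2] by blast
  have "exp t \<le> exp a" using t(1) True assms by simp
  then have "exp t / 2 * z\<^sup>2 \<le> exp a / 2 * z\<^sup>2" by (intro mult_right_mono) auto
  then show ?thesis using t(2) by (simp add: numeral_2_eq_2 mult.commute)
next
  case False
  define y where "y = - z"
  have y: "0 < y" using False by (simp add: y_def)
  have "1 \<le> (1 - y + y\<^sup>2/2) * (1 + y + y\<^sup>2/2)"
    using zero_le_power[of "y\<^sup>2" 2] by (simp add: algebra_simps power2_eq_square)
  also have "\<dots> \<le> (1 - y + y\<^sup>2/2) * exp y"
  proof (rule mult_left_mono)
    show "1 + y + y\<^sup>2/2 \<le> exp y" using y by (intro exp_lower_Taylor_quadratic) auto
    have "0 \<le> (1 - y)\<^sup>2 + 1" by simp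
    then show "0 \<le> 1 - y + y\<^sup>2/2" by (simp add: power2_eq_square algebra_simps)
  qed
  finally have "exp z \<le> 1 + z + z\<^sup>2/2"
    by (simp add: y_def exp_minus field_simps)
  also have "z\<^sup>2/2 \<le> z\<^sup>2/2 * exp a" using assms(2) by (simp add: mult_le_cancel_left1)
  finally show ?thesis by simp
qed

lemma exp_remainder_mono:
  fixes u v :: real
  assumes "0 \<le> u" "u \<le> v"
  shows "exp u - 1 - u \<le> exp v - 1 - v"
proof -
  have "exp u + (v - u) \<le> exp u * (1 + (v - u))"
    using mult_right_mono[of 1 "exp u" "v - u"] assms by (simp add: algebra_simps)
  also have "\<dots> \<le> exp u * exp (v - u)" by (intro mult_left_mono exp_ge_add_one_self) auto
  also have "\<dots> = exp v" by (simp flip: exp_add)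
  finally show ?thesis by simp
qed

text \<open>
  The remainder \<open>exp (s * u) - 1 - s * u\<close> of an undershoot \<open>u\<close> is controlled in three ranges: for small \<open>u\<close> by a
  small multiple of \<open>u\<close>, for large \<open>u\<close> by a small multiple of the same remainder at \<open>2 * s\<close>, and in between by a
  constant, which is paid only when \<open>u\<close> exceeds \<open>\<delta>\<close>.
\<close>

lemma exp_remainder_split:
  fixes s \<eta> :: real
  assumes s: "0 < s" and \<eta>: "0 < \<eta>"
  obtains \<delta> K where "0 < \<delta>" "0 \<le> K"
    "\<And>u. 0 \<le> u \<Longrightarrow> exp (s * u) - 1 - s * u
        \<le> \<eta> * u + K * (if \<delta> < u then 1 else 0) + \<eta> * (exp (2 * s * u) - 1 - 2 * s * u)"
proof -
  have "((\<lambda>d. s\<^sup>2 * d * exp (s * d) / 2) \<longlongrightarrow> s\<^sup>2 * 0 * exp (s * 0) / 2) (at_right 0)"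
    by (intro tendsto_intros) auto
  then have "\<forall>\<^sub>F d in at_right 0. s\<^sup>2 * d * exp (s * d) / 2 < \<eta>"
    using \<eta> by (auto dest: order_tendstoD(2))
  then have "\<exists>d>0. s\<^sup>2 * d * exp (s * d) / 2 < \<eta>"
    unfolding eventually_at_right_field by (metis dense)
  then obtain \<delta> where \<delta>: "\<delta> > 0" "s\<^sup>2 * \<delta> * exp (s * \<delta>) / 2 < \<eta>" by blast
  have "\<forall>\<^sub>F u in at_top. exp (s * u) \<le> \<eta> * (exp (2 * s * u) - 1 - 2 * s * u)"
    using s \<eta> by real_asymp
  then obtain A where A: "\<And>u. u \<ge> A \<Longrightarrow> exp (s * u) \<le> \<eta> * (exp (2 * s * u) - 1 - 2 * s * u)"
    by (auto simp: eventually_at_top_linorder)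
  show thesis
  proof (rule that[of \<delta> "exp (s * A)"])
    show "0 < \<delta>" "0 \<le> exp (s * A)" using \<delta> by auto
    fix u :: real assume u: "0 \<le> u"
    have pos: "0 \<le> \<eta> * (exp (2 * s * u) - 1 - 2 * s * u)"
      using \<eta> exp_ge_add_one_self[of "2 * s * u"] by (intro mult_nonneg_nonneg) linarith+
    have su: "0 \<le> s * u" "0 \<le> \<eta> * u" using s u \<eta> by auto
    show "exp (s * u) - 1 - s * u \<le> \<eta> * u + exp (s * A) * (if \<delta> < u then 1 else 0) + \<eta> * (exp (2 * s * u) - 1 - 2 * s * u)"
    proof (cases "\<delta> < u")
      case False
      have "exp (s * u) \<le> 1 + s * u + (s * u)\<^sup>2 / 2 * exp (s * \<delta>)"
        using False s \<delta> by (intro exp_quadratic_upper) auto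
      also have "(s * u)\<^sup>2 / 2 * exp (s * \<delta>) = u * (s\<^sup>2 * u * exp (s * \<delta>) / 2)"
        by (simp add: power2_eq_square)
      also have "\<dots> \<le> u * (s\<^sup>2 * \<delta> * exp (s * \<delta>) / 2)"
        using False u by (intro mult_left_mono divide_right_mono mult_right_mono) auto
      also have "\<dots> \<le> u * \<eta>" using \<delta> u by (intro mult_left_mono) auto
      finally show ?thesis using False pos by (simp add: mult.commute)
    next
      case True
      then show ?thesis
      proof (cases "u \<ge> A")
        case True
        have "0 < exp (s * A)" by simp
        with A[OF True] su \<open>\<delta> < u\<close> show ?thesis unfolding if_P[OF \<open>\<delta> < u\<close>] by argo
      next
        case False
        then have "exp (s * u) \<le> exp (s * A)" using s by simp
        with su pos show ?thesis unfolding if_P[OF \<open>\<delta> < u\<close>] by argo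
      qed
    qed
  qed
qed

section \<open>The Lindley recursion under the Laplace transform\<close>

context random_walk
begin

text \<open>
  The limit \<open>A\<close> is the Laplace transform of the maximum over all steps.  Passing to the limit in the recursion
  for the means gives \<open>E U = a\<close>, which turns the identity for Laplace transforms into a two-sided bound with the
  error terms of \<open>exp_remainder_split\<close>.
\<close>

lemma lindley_laplace:
  assumes s: "0 < s"
    and int1: "integrable M (\<lambda>\<omega>. exp (- s * D 0 \<omega>))"
    and int2: "integrable M (\<lambda>\<omega>. exp (- (2 * s) * D 0 \<omega>))"
    and \<delta>: "0 < \<delta>" and K: "0 \<le> K" and \<eta>: "0 < \<eta>"
    and split: "\<And>u. 0 \<le> u \<Longrightarrow> exp (s * u) - 1 - s * u
        \<le> \<eta> * u + K * (if \<delta> < u then 1 else 0) + \<eta> * (exp (2 * s * u) - 1 - 2 * s * u)"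
  obtains A where "\<And>k. A \<le> expectation (\<lambda>\<omega>. exp (- s * W k \<omega>))"
    and "(\<lambda>k. expectation (\<lambda>\<omega>. exp (- s * W k \<omega>))) \<longlonglongrightarrow> A"
    and "0 \<le> A * (expectation (\<lambda>\<omega>. exp (- s * D 0 \<omega>)) - 1) - s * a"
    and "A * (expectation (\<lambda>\<omega>. exp (- s * D 0 \<omega>)) - 1) - s * a
      \<le> \<eta> * a + K * prob {\<omega>\<in>space M. D 0 \<omega> < - \<delta>}
        + \<eta> * (expectation (\<lambda>\<omega>. exp (- (2 * s) * D 0 \<omega>)) - 1 - 2 * s * a)"
proof -
  define E where "E = expectation (\<lambda>\<omega>. exp (- s * D 0 \<omega>))"
  define L where "L k = expectation (\<lambda>\<omega>. exp (- s * W k \<omega>))" for k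
  define U where "U k \<omega> = max 0 (- (D 0 \<omega> + V k \<omega>))" for k \<omega>
  have [measurable]: "U k \<in> borel_measurable M" for k unfolding U_def by measurable
  have U0: "0 \<le> U k \<omega>" for k \<omega> by (simp add: U_def)
  \<comment> \<open>As \<open>V\<close> is nonnegative, only a negative step can cause an undershoot.\<close>
  have U_le: "U k \<omega> \<le> max 0 (- D 0 \<omega>)" for k \<omega> using V_nonneg[of k \<omega>] by (auto simp: U_def)
  have intW: "integrable M (\<lambda>\<omega>. exp (- s * W k \<omega>))" for k
    by (rule integrable_const_bound[of _ 1]) (use s W_nonneg in auto)
  have intV: "integrable M (\<lambda>\<omega>. exp (- s * V k \<omega>))" for k
    by (rule integrable_const_bound[of _ 1]) (use s V_nonneg in auto)
  have LV: "expectation (\<lambda>\<omega>. exp (- s * V k \<omega>)) = L k" for k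
    unfolding L_def by (rule expectation_V[of "\<lambda>x. exp (- s * x)"]) simp
  have U_eq: "U k \<omega> = W (Suc k) \<omega> - V k \<omega> - D 0 \<omega>" for k \<omega>
    by (auto simp: U_def W_Suc max_def)
  have intU: "integrable M (U k)" for k
    unfolding U_eq[abs_def] using integrable_W integrable_V1 integrable_step by auto
  have EU: "expectation (U k) = expectation (W (Suc k)) - expectation (W k) + a" for k
    unfolding U_eq[abs_def] using integrable_W integrable_V1 integrable_step
    by (simp add: expectation_V1 mean_step)
  have exp_eq: "exp (s * U k \<omega>) = exp (- s * D 0 \<omega>) * exp (- s * V k \<omega>) + 1 - exp (- s * W (Suc k) \<omega>)" for k \<omega>
  proof -
    have *: "exp (- s * D 0 \<omega>) * exp (- s * V k \<omega>) = exp (- s * (D 0 \<omega> + V k \<omega>))"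
      by (simp add: algebra_simps flip: exp_add)
    show ?thesis
      unfolding * U_def W_Suc by (cases "0 \<le> D 0 \<omega> + V k \<omega>") (simp_all add: algebra_simps)
  qed
  have ind: "indep_var borel (\<lambda>\<omega>. exp (- s * D 0 \<omega>)) borel (\<lambda>\<omega>. exp (- s * V k \<omega>))" for k
    using indep_var_compose[OF indep_step_V, of "\<lambda>x. exp (- s * x)" borel "\<lambda>x. exp (- s * x)" borel k]
    by (simp add: comp_def)
  have intDV: "integrable M (\<lambda>\<omega>. exp (- s * D 0 \<omega>) * exp (- s * V k \<omega>))" for k
    by (rule indep_var_integrable[OF ind int1 intV])
  have EDV: "expectation (\<lambda>\<omega>. exp (- s * D 0 \<omega>) * exp (- s * V k \<omega>)) = E * L k" for k
    unfolding indep_var_lebesgue_integral[OF ind int1 intV] LV E_def ..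
  have intEU: "integrable M (\<lambda>\<omega>. exp (s * U k \<omega>))" for k
    unfolding exp_eq[abs_def] using intDV intW by auto
  have EEU: "expectation (\<lambda>\<omega>. exp (s * U k \<omega>)) = E * L k + 1 - L (Suc k)" for k
    unfolding exp_eq[abs_def] using intDV intW EDV[of k] by (simp add: prob_space L_def)
  define R where "R k = expectation (\<lambda>\<omega>. exp (s * U k \<omega>) - 1 - s * U k \<omega>)" for k
  have R_eq: "R k = E * L k - L (Suc k) - s * (expectation (W (Suc k)) - expectation (W k) + a)" for k
    unfolding R_def using intEU intU by (simp add: EEU EU prob_space)
  have R0: "0 \<le> R k" for k
    unfolding R_def
  proof (rule integral_nonneg_AE[OF AE_I2])
    fix \<omega> show "0 \<le> exp (s * U k \<omega>) - 1 - s * U k \<omega>"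
      using exp_ge_add_one_self[of "s * U k \<omega>"] by linarith
  qed
  have R_le: "R k \<le> \<eta> * expectation (U k) + K * prob {\<omega>\<in>space M. D 0 \<omega> < - \<delta>}
        + \<eta> * (expectation (\<lambda>\<omega>. exp (- (2 * s) * D 0 \<omega>)) - 1 - 2 * s * a)" for k
  proof -
    let ?B = "{\<omega>\<in>space M. D 0 \<omega> < - \<delta>}"
    have B [measurable]: "?B \<in> events" by measurable
    have intB: "integrable M (indicat_real ?B)" and EB: "expectation (indicat_real ?B) = prob ?B"
      using integrable_real_indicator[OF B] by (auto simp: less_top[symmetric])
    have "R k \<le> expectation (\<lambda>\<omega>. \<eta> * U k \<omega> + K * indicator ?B \<omega>
        + \<eta> * (exp (- (2 * s) * D 0 \<omega>) - 1 + 2 * s * D 0 \<omega>))"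
      unfolding R_def
    proof (rule integral_mono)
      fix \<omega> assume \<omega>: "\<omega> \<in> space M"
      have 1: "K * (if \<delta> < U k \<omega> then 1 else 0) \<le> K * indicator ?B \<omega>"
        using K U_le[of k \<omega>] \<delta> \<omega> by (intro mult_left_mono) (auto simp: indicator_def max_def split: if_splits)
      have "exp (2 * s * U k \<omega>) - 1 - 2 * s * U k \<omega> \<le> exp (2 * s * max 0 (- D 0 \<omega>)) - 1 - 2 * s * max 0 (- D 0 \<omega>)"
        using U_le[of k \<omega>] U0[of k \<omega>] s by (intro exp_remainder_mono mult_left_mono) auto
      also have "\<dots> \<le> exp (- (2 * s) * D 0 \<omega>) - 1 + 2 * s * D 0 \<omega>"
        using exp_ge_add_one_self[of "- (2 * s) * D 0 \<omega>"] by (auto simp: max_def)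
      finally have 2: "\<eta> * (exp (2 * s * U k \<omega>) - 1 - 2 * s * U k \<omega>) \<le> \<eta> * (exp (- (2 * s) * D 0 \<omega>) - 1 + 2 * s * D 0 \<omega>)"
        using \<eta> by (intro mult_left_mono) auto
      show "exp (s * U k \<omega>) - 1 - s * U k \<omega> \<le> \<eta> * U k \<omega> + K * indicator ?B \<omega>
        + \<eta> * (exp (- (2 * s) * D 0 \<omega>) - 1 + 2 * s * D 0 \<omega>)"
        using split[OF U0[of k \<omega>]] 1 2 by linarith
    qed (use intEU intU int2 integrable_step intB in auto)
    also have "\<dots> = \<eta> * expectation (U k) + K * prob ?B
        + \<eta> * (expectation (\<lambda>\<omega>. exp (- (2 * s) * D 0 \<omega>)) - 1 - 2 * s * a)"
      using intU int2 integrable_step intB by (simp add: mean_step prob_space EB)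
    finally show ?thesis .
  qed
  have L_dec: "decseq L"
    unfolding L_def using s by (intro decseq_SucI integral_mono intW) (auto intro: W_mono)
  have L0: "0 \<le> L k" for k unfolding L_def by simp
  obtain A where A: "L \<longlonglongrightarrow> A" "\<And>k. A \<le> L k" using decseq_convergent[OF L_dec, of 0] L0 by blast
  define w where "w k = expectation (W k)" for k
  have w_inc: "incseq w"
    unfolding w_def by (intro incseq_SucI integral_mono integrable_W W_mono)
  obtain w' where w: "w \<longlonglongrightarrow> w'"
    using incseq_convergent[OF w_inc, of "expectation (\<lambda>\<omega>. (D 0 \<omega>)\<^sup>2) / (2 * a)"] expectation_W_le
    unfolding w_def by blast
  have wS: "(\<lambda>k. w (Suc k)) \<longlonglongrightarrow> w'" and LS: "(\<lambda>k. L (Suc k)) \<longlonglongrightarrow> A"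
    using w A(1) by (auto simp: filterlim_sequentially_Suc)
  have Rlim: "R \<longlonglongrightarrow> E * A - A - s * (w' - w' + a)"
    unfolding R_eq[abs_def] w_def[symmetric] by (intro tendsto_intros A w wS LS)
  have "0 \<le> E * A - A - s * (w' - w' + a)"
    by (rule LIMSEQ_le_const[OF Rlim]) (use R0 in auto)
  moreover have "E * A - A - s * (w' - w' + a) \<le> \<eta> * (w' - w' + a) + K * prob {\<omega>\<in>space M. D 0 \<omega> < - \<delta>}
        + \<eta> * (expectation (\<lambda>\<omega>. exp (- (2 * s) * D 0 \<omega>)) - 1 - 2 * s * a)" (is "_ \<le> ?bound (w' - w' + a)")
  proof (rule LIMSEQ_le[OF Rlim])
    show "(\<lambda>k. ?bound (w (Suc k) - w k + a)) \<longlonglongrightarrow> ?bound (w' - w' + a)"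
      by (intro tendsto_intros w wS)
    show "\<exists>N. \<forall>k\<ge>N. R k \<le> ?bound (w (Suc k) - w k + a)"
      using R_le unfolding EU w_def[symmetric] by blast
  qed
  moreover have "(\<lambda>k. expectation (\<lambda>\<omega>. exp (- s * W k \<omega>))) \<longlonglongrightarrow> A"
    using A(1) unfolding L_def[abs_def] .
  ultimately show thesis using A(2)
    by (intro that[of A]) (auto simp: L_def E_def algebra_simps)
qed

end

section \<open>Moments of Levy increments\<close>

lemma (in prob_space) expectation_exp_pos:
  assumes "integrable M (\<lambda>\<omega>. exp (X \<omega>) :: real)"
  shows "0 < expectation (\<lambda>\<omega>. exp (X \<omega>))"
proof -
  have "expectation (\<lambda>\<omega>. exp (X \<omega>)) \<noteq> 0"
  proof
    assume "expectation (\<lambda>\<omega>. exp (X \<omega>)) = 0"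
    then have "AE \<omega> in M. exp (X \<omega>) = 0"
      using integral_nonneg_eq_0_iff_AE[OF assms] by auto
    then show False by simp
  qed
  moreover have "0 \<le> expectation (\<lambda>\<omega>. exp (X \<omega>))" by simp
  ultimately show ?thesis by linarith
qed

text \<open>
  By Fubini \<open>X + y\<close> is square integrable for almost every value \<open>y\<close> of \<open>Y\<close>, hence for at least one.
\<close>

lemma (in prob_space) square_integrable_summand:
  assumes ind: "indep_var borel X borel (Y :: 'a \<Rightarrow> real)"
    and int: "integrable M (\<lambda>\<omega>. (X \<omega> + Y \<omega>)\<^sup>2)"
  shows "integrable M (\<lambda>\<omega>. (X \<omega> :: real)\<^sup>2)"
proof -
  have X [measurable]: "X \<in> borel_measurable M" and Y [measurable]: "Y \<in> borel_measurable M"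
    using indep_var_rv1[OF ind] indep_var_rv2[OF ind] by auto
  interpret PX: prob_space "distr M borel X" by (rule prob_space_distr) simp
  interpret PY: prob_space "distr M borel Y" by (rule prob_space_distr) simp
  interpret pair_sigma_finite "distr M borel Y" "distr M borel X" ..
  interpret P2: pair_sigma_finite "distr M borel X" "distr M borel Y" ..
  have "integrable (distr M (borel \<Otimes>\<^sub>M borel) (\<lambda>\<omega>. (X \<omega>, Y \<omega>))) (\<lambda>p. (fst p + snd p)\<^sup>2)"
    using int by (subst integrable_distr_eq) auto
  then have "integrable (distr M borel X \<Otimes>\<^sub>M distr M borel Y) (\<lambda>p. (fst p + snd p)\<^sup>2)"
    using ind by (simp add: indep_var_distribution_eq)
  then have "integrable (distr M borel Y \<Otimes>\<^sub>M distr M borel X) (\<lambda>(y, x). (x + y)\<^sup>2)"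
    using P2.integrable_product_swap[of "\<lambda>p. (fst p + snd p)\<^sup>2"] by (simp add: split_beta')
  from AE_integrable_fst'[OF this]
  have ae: "AE y in distr M borel Y. integrable (distr M borel X) (\<lambda>x. (x + y)\<^sup>2)" by simp
  have "\<exists>y. integrable (distr M borel X) (\<lambda>x. (x + y)\<^sup>2)"
  proof (rule ccontr)
    assume "\<not> ?thesis"
    with ae have "AE y in distr M borel Y. False" by auto
    then show False by simp
  qed
  then obtain y where "integrable (distr M borel X) (\<lambda>x. (x + y)\<^sup>2)" by blast
  then have y: "integrable M (\<lambda>\<omega>. (X \<omega> + y)\<^sup>2)"
    by (subst (asm) integrable_distr_eq) auto
  have "integrable M (\<lambda>\<omega>. ((X \<omega> + y) + (- y))\<^sup>2)"
    by (rule integrable_add_square[OF _ _ y]) auto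
  then show ?thesis by simp
qed

lemma (in prob_space) iid_sum_moments:
  assumes D: "iid \<mu> D n" and n: "0 < n" and sq: "integrable M (\<lambda>\<omega>. (\<Sum>i<n. D i \<omega>)\<^sup>2)"
  shows "integrable M (\<lambda>\<omega>. (D 0 \<omega>)\<^sup>2)"
    and "expectation (D 0) = expectation (\<lambda>\<omega>. \<Sum>i<n. D i \<omega>) / n"
    and "expectation (\<lambda>\<omega>. (D 0 \<omega>)\<^sup>2) \<le> expectation (\<lambda>\<omega>. (\<Sum>i<n. D i \<omega>)\<^sup>2) / n"
proof -
  have rv [measurable]: "\<And>i. i < n \<Longrightarrow> D i \<in> borel_measurable M" using iid_measurable[OF D] by auto
  have same: "distr M borel (D i) = distr M borel (D 0)" if "i < n" for i
    using D that by (auto simp: iid_def)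
  have ind0: "indep_var borel (D 0) borel (\<lambda>\<omega>. \<Sum>i\<in>{1..<n}. D i \<omega>)"
    by (rule indep_vars_sum, simp, simp, rule indep_vars_subset[where I = "{..<n}"])
       (use D n in \<open>auto simp: iid_def\<close>)
  have eq0: "(\<Sum>i<n. D i \<omega>) = D 0 \<omega> + (\<Sum>i\<in>{1..<n}. D i \<omega>)" for \<omega>
    using n by (simp add: lessThan_atLeast0 sum.atLeast_Suc_lessThan)
  show sq0: "integrable M (\<lambda>\<omega>. (D 0 \<omega>)\<^sup>2)"
    using sq unfolding eq0 by (rule square_integrable_summand[OF ind0])
  have sqi: "integrable M (\<lambda>\<omega>. (D i \<omega>)\<^sup>2)"
     "expectation (\<lambda>\<omega>. (D i \<omega>)\<^sup>2) = expectation (\<lambda>\<omega>. (D 0 \<omega>)\<^sup>2)"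
     "expectation (D i) = expectation (D 0)" if "i < n" for i
    using integral_cong_distr[OF same[OF that] rv[OF that] rv[OF n], of "\<lambda>x. x\<^sup>2"] sq0
      integral_cong_distr[OF same[OF that] rv[OF that] rv[OF n], of "\<lambda>x. x"] by auto
  have int: "integrable M (D i)" if "i < n" for i
    using integrable_of_square[OF rv sqi(1)] that by auto
  have sum1: "expectation (\<lambda>\<omega>. \<Sum>i<k. D i \<omega>) = k * expectation (D 0)" if "k \<le> n" for k
  proof -
    have "expectation (\<lambda>\<omega>. \<Sum>i<k. D i \<omega>) = (\<Sum>i<k. expectation (D i))"
      by (rule Bochner_Integration.integral_sum) (use int that in auto)
    also have "\<dots> = (\<Sum>i<k. expectation (D 0))"
      by (rule sum.cong[OF refl], rule sqi(3)) (use that in simp)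
    finally show ?thesis by simp
  qed
  show "expectation (D 0) = expectation (\<lambda>\<omega>. \<Sum>i<n. D i \<omega>) / n"
    using sum1[of n] n by simp
  \<comment> \<open>The off-diagonal terms of the squared sum contribute the nonnegative amount \<open>k * (k - 1) * (E (D 0))^2\<close>.\<close>
  have sum2: "integrable M (\<lambda>\<omega>. (\<Sum>i<k. D i \<omega>)\<^sup>2) \<and> expectation (\<lambda>\<omega>. (\<Sum>i<k. D i \<omega>)\<^sup>2)
      = k * expectation (\<lambda>\<omega>. (D 0 \<omega>)\<^sup>2) + k * (real k - 1) * (expectation (D 0))\<^sup>2"
    if "k \<le> n" for k
    using that
  proof (induction k)
    case (Suc k)
    then have k: "k < n" and IH: "integrable M (\<lambda>\<omega>. (\<Sum>i<k. D i \<omega>)\<^sup>2)"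
      "expectation (\<lambda>\<omega>. (\<Sum>i<k. D i \<omega>)\<^sup>2) = k * expectation (\<lambda>\<omega>. (D 0 \<omega>)\<^sup>2) + k * (real k - 1) * (expectation (D 0))\<^sup>2"
      by auto
    have ind: "indep_var borel (D k) borel (\<lambda>\<omega>. \<Sum>i<k. D i \<omega>)"
      by (rule indep_vars_sum, simp, simp, rule indep_vars_subset[where I = "{..<n}"])
         (use D k in \<open>auto simp: iid_def\<close>)
    have intS: "integrable M (\<lambda>\<omega>. \<Sum>i<k. D i \<omega>)" using int k by auto
    have prd: "integrable M (\<lambda>\<omega>. D k \<omega> * (\<Sum>i<k. D i \<omega>))"
      "expectation (\<lambda>\<omega>. D k \<omega> * (\<Sum>i<k. D i \<omega>)) = expectation (D 0) * (k * expectation (D 0))"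
      using indep_var_integrable[OF ind int[OF k] intS] indep_var_lebesgue_integral[OF ind int[OF k] intS]
        sum1[of k] k sqi(3)[OF k] by auto
    have eq: "(\<Sum>i<Suc k. D i \<omega>)\<^sup>2 = (\<Sum>i<k. D i \<omega>)\<^sup>2 + (D k \<omega>)\<^sup>2 + 2 * (D k \<omega> * (\<Sum>i<k. D i \<omega>))" for \<omega>
      by (simp add: power2_sum)
    have "integrable M (\<lambda>\<omega>. (\<Sum>i<Suc k. D i \<omega>)\<^sup>2)"
      unfolding eq using IH(1) prd(1) sqi(1)[OF k] by simp
    moreover have "expectation (\<lambda>\<omega>. (\<Sum>i<Suc k. D i \<omega>)\<^sup>2)
        = expectation (\<lambda>\<omega>. (\<Sum>i<k. D i \<omega>)\<^sup>2) + expectation (\<lambda>\<omega>. (D k \<omega>)\<^sup>2)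
          + 2 * expectation (\<lambda>\<omega>. D k \<omega> * (\<Sum>i<k. D i \<omega>))"
      unfolding eq using IH(1) prd(1) sqi(1)[OF k] by simp
    ultimately show ?case
      unfolding IH(2) prd(2) sqi(2)[OF k] by (simp add: algebra_simps power2_eq_square)
  qed simp
  have "n * expectation (\<lambda>\<omega>. (D 0 \<omega>)\<^sup>2) \<le> expectation (\<lambda>\<omega>. (\<Sum>i<n. D i \<omega>)\<^sup>2)"
    using sum2[of n] n by (auto simp: zero_le_mult_iff)
  then show "expectation (\<lambda>\<omega>. (D 0 \<omega>)\<^sup>2) \<le> expectation (\<lambda>\<omega>. (\<Sum>i<n. D i \<omega>)\<^sup>2) / n"
    using n by (simp add: field_simps)
qed

definition increment :: "(real \<Rightarrow> 'a \<Rightarrow> real) \<Rightarrow> real \<Rightarrow> nat \<Rightarrow> 'a \<Rightarrow> real" where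
  "increment J h i \<omega> = J (h * real (Suc i)) \<omega> - J (h * real i) \<omega>"

abbreviation mesh :: "nat \<Rightarrow> real" where "mesh n \<equiv> 1 / 2^n"

lemma sum_increment: "(\<Sum>i<k. increment J h i \<omega>) = J (h * real k) \<omega> - J 0 \<omega>"
  by (induction k) (auto simp: increment_def)

lemma sum_increment_mesh: "(\<Sum>i<2^n. increment J (mesh n) i \<omega>) = J 1 \<omega> - J 0 \<omega>"
  by (simp add: sum_increment)

context levy_process
begin

abbreviation incr :: "real \<Rightarrow> nat \<Rightarrow> 'a \<Rightarrow> real" where "incr \<equiv> increment J"

lemma iid_incr:
  assumes "0 \<le> h"
  shows "iid (distr M borel (J h)) (incr h) n"
proof -
  have "indep_vars (\<lambda>_. borel) (\<lambda>k \<omega>. J (h * real (Suc k)) \<omega> - J (h * real k) \<omega>) {..<n}"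
    using assms by (intro indep_increments[where \<tau> = "\<lambda>k. h * real k"]) (auto intro!: mult_left_mono)
  moreover have "distr M borel (incr h i) = distr M borel (J h)" for i
    using stationary_increments[of "h * real i" h] assms
    by (simp add: increment_def[abs_def] algebra_simps)
  ultimately show ?thesis by (simp add: iid_def increment_def[abs_def])
qed

lemma measurable_incr [measurable]: "0 \<le> h \<Longrightarrow> incr h i \<in> borel_measurable M"
  using iid_measurable[OF iid_incr, of h i "Suc i"] by simp

end

locale square_integrable_levy = spectrally_positive_levy_process +
  assumes square_integrable: "integrable M (\<lambda>\<omega>. (J 1 \<omega>)\<^sup>2)"
begin

lemma measurable_J1 [measurable]: "J 1 \<in> borel_measurable M" and measurable_J0 [measurable]: "J 0 \<in> borel_measurable M"
  using measurable_at by auto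

lemma AE_unit_increment: "AE \<omega> in M. (\<Sum>i<2^n. incr (mesh n) i \<omega>) = J 1 \<omega>"
  using start_zero by (auto simp: sum_increment_mesh)

lemma incr_moments:
  shows "integrable M (\<lambda>\<omega>. (incr (mesh n) 0 \<omega>)\<^sup>2)"
    and "expectation (incr (mesh n) 0) = expectation (J 1) * mesh n"
    and "expectation (\<lambda>\<omega>. (incr (mesh n) 0 \<omega>)\<^sup>2) \<le> expectation (\<lambda>\<omega>. (J 1 \<omega>)\<^sup>2) * mesh n"
proof -
  have [measurable]: "incr (mesh n) i \<in> borel_measurable M" for i by (rule measurable_incr) simp
  have 1: "integrable M (\<lambda>\<omega>. (\<Sum>i<2^n. incr (mesh n) i \<omega>)\<^sup>2)"
    by (rule integrable_cong_AE_imp[OF square_integrable]) (use AE_unit_increment[of n] in auto)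
  have 2: "expectation (\<lambda>\<omega>. (\<Sum>i<2^n. incr (mesh n) i \<omega>)\<^sup>2) = expectation (\<lambda>\<omega>. (J 1 \<omega>)\<^sup>2)"
     "expectation (\<lambda>\<omega>. (\<Sum>i<2^n. incr (mesh n) i \<omega>)) = expectation (J 1)"
    using AE_unit_increment[of n] by (auto intro!: integral_cong_AE)
  note * = iid_sum_moments[OF iid_incr[of "mesh n"] _ 1, simplified]
  show "integrable M (\<lambda>\<omega>. (incr (mesh n) 0 \<omega>)\<^sup>2)"
    "expectation (incr (mesh n) 0) = expectation (J 1) * mesh n"
    "expectation (\<lambda>\<omega>. (incr (mesh n) 0 \<omega>)\<^sup>2) \<le> expectation (\<lambda>\<omega>. (J 1 \<omega>)\<^sup>2) * mesh n"
    using * 2 by simp_all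
qed

text \<open>
  Through this fact the absence of negative jumps enters the exponential moments and the Pollaczek-Khinchine formula.
\<close>

lemma AE_drops_small:
  assumes "0 < \<delta>"
  shows "AE \<omega> in M. \<forall>\<^sub>F n in sequentially. \<forall>k<2^n. - \<delta> \<le> incr (mesh n) k \<omega>"
  using cadlag_paths no_negative_jumps
proof eventually_elim
  case (elim \<omega>)
  from grid_drops_small[OF elim assms] show ?case
    by eventually_elim (auto simp: increment_def algebra_simps)
qed

text \<open>
  The \<open>2^n\<close> independent increments over the unit interval eventually all exceed \<open>- \<delta>\<close>, so
  \<open>(1 - p)^(2^n)\<close> tends to \<open>1\<close> for the probability \<open>p\<close> of a drop.
\<close>

lemma prob_drop_mesh:
  assumes \<delta>: "0 < \<delta>"
  shows "(\<lambda>n. 2^n * prob {\<omega>\<in>space M. incr (mesh n) 0 \<omega> < - \<delta>}) \<longlonglongrightarrow> 0"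
proof -
  have [measurable]: "incr (mesh n) i \<in> borel_measurable M" for n i by (rule measurable_incr) simp
  define p where "p n = prob {\<omega>\<in>space M. incr (mesh n) 0 \<omega> < - \<delta>}" for n
  define B where "B n = {\<omega>\<in>space M. \<forall>k\<in>{..<2^n}. - \<delta> \<le> incr (mesh n) k \<omega>}" for n
  have [measurable]: "B n \<in> events" for n unfolding B_def by measurable
  have p01: "0 \<le> p n" "p n \<le> 1" for n by (auto simp: p_def)
  have PB: "prob (B n) = (1 - p n) ^ (2^n)" for n
  proof -
    let ?A = "{\<omega>\<in>space M. - \<delta> \<le> incr (mesh n) 0 \<omega>}"
    have "emeasure M (B n) = (\<integral>\<^sup>+\<omega>. indicator (B n) \<omega> \<partial>M)" by simp
    also have "\<dots> = (\<integral>\<^sup>+\<omega>. (\<Prod>k<2^n. indicator {- \<delta>..} (incr (mesh n) k \<omega>)) \<partial>M)"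
      by (intro nn_integral_cong) (auto simp: B_def indicator_def prod_zero_iff)
    also have "\<dots> = (\<integral>\<^sup>+\<omega>. indicator {- \<delta>..} (incr (mesh n) 0 \<omega>) \<partial>M) ^ 2^n"
      by (rule iid_nn_integral_prod[OF iid_incr]) auto
    also have "(\<integral>\<^sup>+\<omega>. indicator {- \<delta>..} (incr (mesh n) 0 \<omega>) \<partial>M) = (\<integral>\<^sup>+\<omega>. indicator ?A \<omega> \<partial>M)"
      by (intro nn_integral_cong) (auto simp: indicator_def)
    also have "\<dots> = emeasure M ?A" by (rule nn_integral_indicator) measurable
    finally have "prob (B n) = prob ?A ^ 2^n" by (simp add: emeasure_eq_measure ennreal_power)
    also have "?A = space M - {\<omega>\<in>space M. incr (mesh n) 0 \<omega> < - \<delta>}" by auto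
    also have "prob \<dots> = 1 - p n" unfolding p_def by (rule prob_compl) measurable
    finally show ?thesis by simp
  qed
  have "(\<lambda>n. expectation (indicat_real (B n))) \<longlonglongrightarrow> expectation (\<lambda>_. 1 :: real)"
  proof (rule integral_dominated_convergence[where w = "\<lambda>_. 1"])
    show "AE \<omega> in M. (\<lambda>n. indicat_real (B n) \<omega>) \<longlonglongrightarrow> 1"
      using AE_drops_small[OF \<delta>] AE_space
    proof eventually_elim
      case (elim \<omega>)
      have "\<forall>\<^sub>F n in sequentially. indicat_real (B n) \<omega> = 1"
        using elim(1) by eventually_elim (use elim(2) in \<open>auto simp: B_def\<close>)
      then show ?case by (rule tendsto_eventually)
    qed
    show "AE \<omega> in M. norm (indicat_real (B n) \<omega>) \<le> 1" for n by (auto simp: indicator_def)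
  qed simp_all
  then have lim: "(\<lambda>n. prob (B n)) \<longlonglongrightarrow> 1" by (simp add: prob_space)
  have "(\<lambda>n. - ln (prob (B n))) \<longlonglongrightarrow> - ln 1"
    by (intro tendsto_intros lim) simp
  then have lim0: "(\<lambda>n. - ln (prob (B n))) \<longlonglongrightarrow> 0" by simp
  show ?thesis
    unfolding p_def[symmetric]
  proof (rule tendsto_sandwich[OF _ _ tendsto_const lim0])
    show "\<forall>\<^sub>F n in sequentially. 0 \<le> 2^n * p n" using p01 by simp
    have "\<forall>\<^sub>F n in sequentially. 0 < prob (B n)" using order_tendstoD(1)[OF lim, of 0] by simp
    then show "\<forall>\<^sub>F n in sequentially. 2^n * p n \<le> - ln (prob (B n))"
    proof eventually_elim
      case (elim n)
      have "prob (B n) \<le> exp (- p n) ^ (2^n)"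
        unfolding PB using p01[of n] exp_ge_add_one_self[of "- p n"] by (intro power_mono) auto
      also have "\<dots> = exp (- (2^n * p n))" by (simp flip: exp_of_nat_mult)
      finally have "ln (prob (B n)) \<le> ln (exp (- (2^n * p n)))" using elim by (subst ln_le_cancel_iff) auto
      then show ?case by simp
    qed
  qed
qed

text \<open>
  The increments are truncated below at \<open>- 1\<close>.  Their exponential moments are then at most \<open>1 + C / 2^n\<close>, with
  \<open>C\<close> depending on the first two moments only, so the sum of \<open>2^n\<close> of them has an exponential moment of at most \<open>exp C\<close>.
  Almost surely the truncation is eventually void, and Fatou's lemma carries the bound over to \<open>J 1\<close>.
\<close>

lemma exp_moment:
  assumes s: "0 < s"
  shows "(\<integral>\<^sup>+\<omega>. ennreal (exp (- s * J 1 \<omega>)) \<partial>M) < \<infinity>"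
proof -
  have [measurable]: "incr (mesh n) i \<in> borel_measurable M" for n i by (rule measurable_incr) simp
  define m q where "m = expectation (J 1)" and "q = expectation (\<lambda>\<omega>. (J 1 \<omega>)\<^sup>2)"
  define C where "C = s * \<bar>m\<bar> + s\<^sup>2 / 2 * exp s * q"
  define T where "T n k \<omega> = max (incr (mesh n) k \<omega>) (- 1)" for n k \<omega>
  define Y where "Y n \<omega> = (\<Sum>k<2^n. T n k \<omega>)" for n \<omega>
  have [measurable]: "T n k \<in> borel_measurable M" "Y n \<in> borel_measurable M" for n k
    unfolding T_def Y_def by measurable
  have sT: "- s * T n k \<omega> \<le> s" for n k \<omega>
    using mult_left_mono[of "- 1" "T n k \<omega>" s] s by (simp add: T_def)
  have intT: "integrable M (\<lambda>\<omega>. exp (- s * T n k \<omega>))" for n k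
    by (rule integrable_const_bound[of _ "exp s"]) (use sT in auto)
  have step: "expectation (\<lambda>\<omega>. exp (- s * T n 0 \<omega>)) \<le> 1 + C * mesh n" for n
  proof -
    have intD: "integrable M (incr (mesh n) 0)" by (rule integrable_of_square[OF _ incr_moments(1)]) simp
    have "expectation (\<lambda>\<omega>. exp (- s * T n 0 \<omega>))
        \<le> expectation (\<lambda>\<omega>. 1 - s * incr (mesh n) 0 \<omega> + (s\<^sup>2 / 2 * exp s) * (incr (mesh n) 0 \<omega>)\<^sup>2)"
    proof (rule integral_mono)
      fix \<omega>
      have "exp (- s * T n 0 \<omega>) \<le> 1 + (- s * T n 0 \<omega>) + (- s * T n 0 \<omega>)\<^sup>2 / 2 * exp s"
        using s sT by (intro exp_quadratic_upper) auto
      also have "(- s * T n 0 \<omega>)\<^sup>2 / 2 * exp s = (s\<^sup>2 / 2 * exp s) * (T n 0 \<omega>)\<^sup>2"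
        by (simp add: power_mult_distrib)
      also have "\<dots> \<le> (s\<^sup>2 / 2 * exp s) * (incr (mesh n) 0 \<omega>)\<^sup>2"
        by (intro mult_left_mono) (auto simp: T_def max_def abs_le_square_iff[symmetric])
      also have "- s * T n 0 \<omega> \<le> - s * incr (mesh n) 0 \<omega>"
        using s by (simp add: T_def)
      finally show "exp (- s * T n 0 \<omega>) \<le> 1 - s * incr (mesh n) 0 \<omega> + (s\<^sup>2 / 2 * exp s) * (incr (mesh n) 0 \<omega>)\<^sup>2"
        by simp
    qed (use intD incr_moments(1) intT[of n 0] in auto)
    also have "\<dots> = 1 - s * (m * mesh n) + (s\<^sup>2 / 2 * exp s) * expectation (\<lambda>\<omega>. (incr (mesh n) 0 \<omega>)\<^sup>2)"
      using intD incr_moments(1) by (simp add: incr_moments(2) prob_space m_def)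
    also have "\<dots> \<le> 1 + s * (\<bar>m\<bar> * mesh n) + (s\<^sup>2 / 2 * exp s) * (q * mesh n)"
    proof -
      have "- (m * mesh n) \<le> \<bar>m\<bar> * mesh n"
        unfolding minus_mult_left by (rule mult_right_mono) auto
      then have "- (s * (m * mesh n)) \<le> s * (\<bar>m\<bar> * mesh n)"
        unfolding minus_mult_right using s by (intro mult_left_mono) auto
      moreover have "(s\<^sup>2 / 2 * exp s) * expectation (\<lambda>\<omega>. (incr (mesh n) 0 \<omega>)\<^sup>2) \<le> (s\<^sup>2 / 2 * exp s) * (q * mesh n)"
        unfolding q_def by (intro mult_left_mono incr_moments(3)) auto
      ultimately show ?thesis by linarith
    qed
    also have "\<dots> = 1 + C * mesh n" by (simp add: C_def field_simps)
    finally show ?thesis .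
  qed
  have C0: "0 \<le> C" using s by (auto simp: C_def q_def)
  have bound: "(\<integral>\<^sup>+\<omega>. ennreal (exp (- s * Y n \<omega>)) \<partial>M) \<le> ennreal (exp C)" for n
  proof -
    have eq: "ennreal (exp (- s * Y n \<omega>)) = (\<Prod>k<2^n. ennreal (exp (- s * max (incr (mesh n) k \<omega>) (- 1))))" for \<omega>
      by (simp add: Y_def T_def sum_distrib_left sum_negf[symmetric] exp_sum prod_ennreal)
    have "(\<integral>\<^sup>+\<omega>. ennreal (exp (- s * Y n \<omega>)) \<partial>M) = (\<integral>\<^sup>+\<omega>. ennreal (exp (- s * T n 0 \<omega>)) \<partial>M) ^ 2^n"
      unfolding eq T_def by (rule iid_nn_integral_prod[OF iid_incr]) auto
    also have "(\<integral>\<^sup>+\<omega>. ennreal (exp (- s * T n 0 \<omega>)) \<partial>M) = ennreal (expectation (\<lambda>\<omega>. exp (- s * T n 0 \<omega>)))"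
      by (intro nn_integral_eq_integral intT) auto
    also have "ennreal (expectation (\<lambda>\<omega>. exp (- s * T n 0 \<omega>))) ^ 2^n
        = ennreal (expectation (\<lambda>\<omega>. exp (- s * T n 0 \<omega>)) ^ 2^n)"
      by (simp add: ennreal_power)
    also have "\<dots> \<le> ennreal (exp (C * mesh n) ^ 2^n)"
      using step[of n] exp_ge_add_one_self[of "C * mesh n"]
      by (intro ennreal_leI power_mono) (auto intro: order_trans)
    also have "exp (C * mesh n) ^ 2^n = exp C" by (simp flip: exp_of_nat_mult)
    finally show ?thesis .
  qed
  have conv: "AE \<omega> in M. liminf (\<lambda>n. ennreal (exp (- s * Y n \<omega>))) = ennreal (exp (- s * J 1 \<omega>))"
    using AE_drops_small[OF zero_less_one] start_zero
  proof eventually_elim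
    case (elim \<omega>)
    have "\<forall>\<^sub>F n in sequentially. ennreal (exp (- s * Y n \<omega>)) = ennreal (exp (- s * J 1 \<omega>))"
      using elim(1)
    proof eventually_elim
      case (elim n)
      have "Y n \<omega> = (\<Sum>k<2^n. incr (mesh n) k \<omega>)"
        unfolding Y_def T_def using elim by (intro sum.cong) (auto simp: max_def)
      then show ?case using \<open>J 0 \<omega> = 0\<close> by (simp add: sum_increment_mesh)
    qed
    then have "(\<lambda>n. ennreal (exp (- s * Y n \<omega>))) \<longlonglongrightarrow> ennreal (exp (- s * J 1 \<omega>))"
      by (rule tendsto_eventually)
    then show ?case by (intro lim_imp_Liminf) simp_all
  qed
  have "(\<integral>\<^sup>+\<omega>. ennreal (exp (- s * J 1 \<omega>)) \<partial>M) = (\<integral>\<^sup>+\<omega>. liminf (\<lambda>n. ennreal (exp (- s * Y n \<omega>))) \<partial>M)"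
    using conv by (intro nn_integral_cong_AE) auto
  also have "\<dots> \<le> liminf (\<lambda>n. \<integral>\<^sup>+\<omega>. ennreal (exp (- s * Y n \<omega>)) \<partial>M)"
    by (rule nn_integral_liminf) simp
  also have "\<dots> \<le> limsup (\<lambda>n. \<integral>\<^sup>+\<omega>. ennreal (exp (- s * Y n \<omega>)) \<partial>M)"
    by (rule Liminf_le_Limsup) simp
  also have "\<dots> \<le> ennreal (exp C)"
    using bound by (intro Limsup_bounded) auto
  also have "\<dots> < \<infinity>" by simp
  finally show ?thesis .
qed

lemma integrable_exp_J1: "0 \<le> s \<Longrightarrow> integrable M (\<lambda>\<omega>. exp (- s * J 1 \<omega>))"
  using exp_moment[of s] by (cases "s = 0") (auto intro!: integrableI_nonneg)

lemma exp_incr: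
  assumes s: "0 < s"
  shows "integrable M (\<lambda>\<omega>. exp (- s * incr (mesh n) 0 \<omega>))"
    and "expectation (\<lambda>\<omega>. exp (- s * incr (mesh n) 0 \<omega>)) = exp (ln (expectation (\<lambda>\<omega>. exp (- s * J 1 \<omega>))) / 2^n)"
proof -
  have [measurable]: "incr (mesh n) i \<in> borel_measurable M" for n i by (rule measurable_incr) simp
  let ?g = "\<integral>\<^sup>+\<omega>. ennreal (exp (- s * incr (mesh n) 0 \<omega>)) \<partial>M"
  have eq: "(\<Prod>k<2^n. ennreal (exp (- s * incr (mesh n) k \<omega>))) = ennreal (exp (- s * (J 1 \<omega> - J 0 \<omega>)))" for \<omega>
    by (simp add: sum_increment_mesh[where n = n, symmetric] sum_distrib_left sum_negf[symmetric] exp_sum prod_ennreal)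
  have "(\<integral>\<^sup>+\<omega>. ennreal (exp (- s * J 1 \<omega>)) \<partial>M) = (\<integral>\<^sup>+\<omega>. (\<Prod>k<2^n. ennreal (exp (- s * incr (mesh n) k \<omega>))) \<partial>M)"
    unfolding eq using start_zero by (intro nn_integral_cong_AE) auto
  also have "\<dots> = ?g ^ 2^n"
    by (rule iid_nn_integral_prod[OF iid_incr]) auto
  finally have pow: "(\<integral>\<^sup>+\<omega>. ennreal (exp (- s * J 1 \<omega>)) \<partial>M) = ?g ^ 2^n" .
  have "?g < \<infinity>"
    using exp_moment[OF s] unfolding pow by (simp add: power_less_top_ennreal)
  then show int: "integrable M (\<lambda>\<omega>. exp (- s * incr (mesh n) 0 \<omega>))"
    by (intro integrableI_nonneg) auto
  let ?e = "expectation (\<lambda>\<omega>. exp (- s * incr (mesh n) 0 \<omega>))"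
  have "0 < ?e" by (rule expectation_exp_pos[OF int])
  have "ennreal (expectation (\<lambda>\<omega>. exp (- s * J 1 \<omega>))) = ennreal ?e ^ 2^n"
    using pow int integrable_exp_J1[of s] s by (simp add: nn_integral_eq_integral)
  then have *: "expectation (\<lambda>\<omega>. exp (- s * J 1 \<omega>)) = ?e ^ 2^n"
    using \<open>0 < ?e\<close> by (simp add: ennreal_power)
  from \<open>0 < ?e\<close> show "?e = exp (ln (expectation (\<lambda>\<omega>. exp (- s * J 1 \<omega>))) / 2^n)"
    unfolding * by (simp add: ln_realpow)
qed

end

section \<open>The all-time maximum and the Pollaczek-Khinchine formula\<close>

definition grid_max :: "(real \<Rightarrow> 'a \<Rightarrow> real) \<Rightarrow> nat \<Rightarrow> 'a \<Rightarrow> real" where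
  "grid_max J n \<omega> = wmax (4^n) (\<lambda>i. increment J (mesh n) i \<omega>)"

text \<open>
  The limit along grids is measurable for every process with measurable coordinates; under negative drift it is almost surely
  the supremum over all times.
\<close>

definition all_time_max :: "(real \<Rightarrow> 'a \<Rightarrow> real) \<Rightarrow> 'a \<Rightarrow> real" where
  "all_time_max J \<omega> = lim (\<lambda>n. grid_max J n \<omega>)"

lemma wmax_increment: "wmax k (\<lambda>i. increment J h i \<omega>) = (MAX j\<in>{..k}. J (h * real j) \<omega> - J 0 \<omega>)"
  by (simp add: wmax_eq_Max sum_increment)

lemma grid_max_eq: "grid_max J n \<omega> = (MAX k\<in>{..4^n}. J (real k / 2^n) \<omega> - J 0 \<omega>)"
  by (simp add: grid_max_def wmax_increment)

lemma grid_max_mono: "grid_max J n \<omega> \<le> grid_max J (Suc n) \<omega>"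
  unfolding grid_max_eq
proof (intro Max_mono subsetI)
  fix x assume "x \<in> (\<lambda>k. J (real k / 2^n) \<omega> - J 0 \<omega>) ` {..4^n}"
  then obtain k where "k \<le> 4^n" "x = J (real k / 2^n) \<omega> - J 0 \<omega>" by auto
  then show "x \<in> (\<lambda>k. J (real k / 2^Suc n) \<omega> - J 0 \<omega>) ` {..4^Suc n}"
    by (auto intro!: image_eqI[of _ _ "2 * k"])
qed auto

lemma grid_max_nonneg: "0 \<le> grid_max J n \<omega>"
  by (simp add: grid_max_def wmax_nonneg)

lemma (in levy_process) measurable_grid_max [measurable]: "grid_max J n \<in> borel_measurable M"
proof -
  have [measurable]: "incr (mesh n) i \<in> borel_measurable M" for i by (rule measurable_incr) simp
  show ?thesis unfolding grid_max_def[abs_def] by measurable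
qed

lemma (in levy_process) measurable_all_time_max [measurable]: "all_time_max J \<in> borel_measurable M"
  unfolding all_time_max_def[abs_def] by (intro borel_measurable_lim_metric) simp

locale negative_drift_levy = square_integrable_levy +
  assumes negative_drift: "expectation (J 1) < 0"
begin

lemma random_walk_incr:
  "random_walk M (incr (mesh n)) (distr M borel (J (mesh n))) (- expectation (J 1) * mesh n)"
proof unfold_locales
  show "iid (distr M borel (J (mesh n))) (incr (mesh n)) k" for k by (rule iid_incr) simp
  show "0 < - expectation (J 1) * mesh n" using negative_drift by (simp add: divide_less_0_iff)
qed (simp_all add: incr_moments)

lemma expectation_grid_max_le:
  "integrable M (grid_max J n)"
  "expectation (grid_max J n) \<le> expectation (\<lambda>\<omega>. (J 1 \<omega>)\<^sup>2) / (2 * (- expectation (J 1)))"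
proof -
  interpret rw: random_walk M "incr (mesh n)" "distr M borel (J (mesh n))" "- expectation (J 1) * mesh n"
    by (rule random_walk_incr)
  have eq: "rw.W (4^n) = grid_max J n" by (simp add: fun_eq_iff rw.W_def grid_max_def)
  show "integrable M (grid_max J n)" using rw.integrable_W[of "4^n"] by (simp add: eq)
  have "expectation (grid_max J n) \<le> expectation (\<lambda>\<omega>. (incr (mesh n) 0 \<omega>)\<^sup>2) / (2 * (- expectation (J 1) * mesh n))"
    using rw.expectation_W_le[of "4^n"] by (simp add: eq)
  also have "\<dots> \<le> (expectation (\<lambda>\<omega>. (J 1 \<omega>)\<^sup>2) * mesh n) / (2 * (- expectation (J 1) * mesh n))"
    using negative_drift by (intro divide_right_mono incr_moments(3)) (auto simp: divide_le_0_iff)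
  also have "\<dots> = expectation (\<lambda>\<omega>. (J 1 \<omega>)\<^sup>2) / (2 * (- expectation (J 1)))" by simp
  finally show "expectation (grid_max J n) \<le> expectation (\<lambda>\<omega>. (J 1 \<omega>)\<^sup>2) / (2 * (- expectation (J 1)))" .
qed

text \<open>
  The grid maxima increase with bounded means, so their limit is finite by monotone convergence.
\<close>

lemma AE_grid_max_bounded: "AE \<omega> in M. \<exists>B. \<forall>n. grid_max J n \<omega> \<le> B"
proof -
  define C where "C = expectation (\<lambda>\<omega>. (J 1 \<omega>)\<^sup>2) / (2 * (- expectation (J 1)))"
  have "(\<integral>\<^sup>+\<omega>. (SUP n. ennreal (grid_max J n \<omega>)) \<partial>M) = (SUP n. \<integral>\<^sup>+\<omega>. ennreal (grid_max J n \<omega>) \<partial>M)"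
    by (rule nn_integral_monotone_convergence_SUP)
       (auto intro!: incseq_SucI le_funI ennreal_leI grid_max_mono)
  also have "\<dots> \<le> ennreal C"
  proof (rule SUP_least)
    fix n
    have "(\<integral>\<^sup>+\<omega>. ennreal (grid_max J n \<omega>) \<partial>M) = ennreal (expectation (grid_max J n))"
      by (rule nn_integral_eq_integral) (auto simp: expectation_grid_max_le grid_max_nonneg)
    also have "\<dots> \<le> ennreal C" using expectation_grid_max_le(2) by (intro ennreal_leI) (simp add: C_def)
    finally show "(\<integral>\<^sup>+\<omega>. ennreal (grid_max J n \<omega>) \<partial>M) \<le> ennreal C" .
  qed
  finally have "(\<integral>\<^sup>+\<omega>. (SUP n. ennreal (grid_max J n \<omega>)) \<partial>M) \<noteq> \<infinity>"
    by (auto simp: top_unique)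
  then have "AE \<omega> in M. (SUP n. ennreal (grid_max J n \<omega>)) \<noteq> \<infinity>"
    by (intro nn_integral_PInf_AE) auto
  then show ?thesis
  proof eventually_elim
    case (elim \<omega>)
    then obtain B where B: "0 \<le> B" "(SUP n. ennreal (grid_max J n \<omega>)) = ennreal B"
      by (cases "SUP n. ennreal (grid_max J n \<omega>)") auto
    have "grid_max J n \<omega> \<le> B" for n
    proof -
      have "ennreal (grid_max J n \<omega>) \<le> ennreal B" unfolding B(2)[symmetric] by (rule SUP_upper) simp
      then show ?thesis using B(1) by (simp add: ennreal_le_iff)
    qed
    then show ?case by blast
  qed
qed

lemma AE_all_time_max:
  "AE \<omega> in M. J 0 \<omega> = 0 \<and> cadlag (\<lambda>t. J t \<omega>) \<and> (\<lambda>n. grid_max J n \<omega>) \<longlonglongrightarrow> all_time_max J \<omega> \<and>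
     (\<forall>t\<ge>0. J t \<omega> \<le> all_time_max J \<omega>) \<and> all_time_max J \<omega> = (SUP t\<in>{0..}. J t \<omega>)"
  using AE_grid_max_bounded start_zero cadlag_paths
proof eventually_elim
  case (elim \<omega>)
  then obtain B where "\<And>n. grid_max J n \<omega> \<le> B" by blast
  then have bd: "(MAX k\<in>{..4^n}. J (real k / 2^n) \<omega>) \<le> B" for n
    using elim(2) by (simp add: grid_max_eq)
  note * = SUP_grid_halfline[OF elim(3) bd]
  have lim: "(\<lambda>n. grid_max J n \<omega>) \<longlonglongrightarrow> (SUP t\<in>{0..}. J t \<omega>)"
    using *(2) elim(2) by (simp add: grid_max_eq)
  then have eq: "all_time_max J \<omega> = (SUP t\<in>{0..}. J t \<omega>)"
    unfolding all_time_max_def by (rule limI)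
  have "J t \<omega> \<le> (SUP t\<in>{0..}. J t \<omega>)" if "0 \<le> t" for t
    using that *(1) by (intro cSUP_upper bdd_aboveI[of _ B]) auto
  with lim eq elim show ?case by auto
qed

lemma exp_difference_quotient: "(\<lambda>n. 2^n * (exp (x / 2^n) - 1)) \<longlonglongrightarrow> (x::real)"
proof -
  have "((\<lambda>h. exp (x * h)) has_real_derivative x) (at 0)"
    by (auto intro!: derivative_eq_intros)
  then have "((\<lambda>h. (exp (x * h) - 1) / h) \<longlongrightarrow> x) (at 0)"
    by (simp add: has_field_derivative_iff)
  moreover have "filterlim (\<lambda>n. (1/2::real)^n) (at 0) sequentially"
    unfolding filterlim_at by (auto intro!: LIMSEQ_realpow_zero)
  ultimately have "(\<lambda>n. (exp (x * (1/2)^n) - 1) / (1/2)^n) \<longlonglongrightarrow> x"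
    by (rule filterlim_compose)
  then show ?thesis by (simp add: power_one_over field_simps)
qed

text \<open>
  On the grid of mesh \<open>1 / 2^n\<close> the limits \<open>A n\<close> of \<open>lindley_laplace\<close> lie between the transform of the all-time
  maximum and that of the grid maximum, so they converge to the former.  Multiplying the bounds by \<open>2^n\<close> and letting \<open>n\<close>
  grow leaves an error proportional to \<open>\<eta>\<close>, which is arbitrary.
\<close>

theorem pollaczek_khinchine:
  assumes s: "0 < s"
  shows "expectation (\<lambda>\<omega>. exp (- s * all_time_max J \<omega>)) * ln (expectation (\<lambda>\<omega>. exp (- s * J 1 \<omega>)))
    = s * (- expectation (J 1))"
proof -
  have [measurable]: "incr (mesh n) i \<in> borel_measurable M" for n i by (rule measurable_incr) simp
  define r where "r = - expectation (J 1)"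
  define \<phi> where "\<phi> s = ln (expectation (\<lambda>\<omega>. exp (- s * J 1 \<omega>)))" for s
  define L where "L = expectation (\<lambda>\<omega>. exp (- s * all_time_max J \<omega>))"
  have r: "0 < r" using negative_drift by (simp add: r_def)
  have max0: "AE \<omega> in M. 0 \<le> all_time_max J \<omega>"
    using AE_all_time_max by eventually_elim fastforce
  have intL: "integrable M (\<lambda>\<omega>. exp (- s * all_time_max J \<omega>))"
    by (rule integrable_const_bound[of _ 1]) (use max0 s in auto)
  have limL: "(\<lambda>n. expectation (\<lambda>\<omega>. exp (- s * grid_max J n \<omega>))) \<longlonglongrightarrow> L"
    unfolding L_def
  proof (rule integral_dominated_convergence[where w = "\<lambda>_. 1"])
    show "AE \<omega> in M. (\<lambda>n. exp (- s * grid_max J n \<omega>)) \<longlonglongrightarrow> exp (- s * all_time_max J \<omega>)"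
      using AE_all_time_max by eventually_elim (auto intro!: tendsto_intros)
  qed (use s in \<open>auto intro!: AE_I2 mult_nonneg_nonneg grid_max_nonneg\<close>)
  have bounds: "0 \<le> L * \<phi> s - s * r" "L * \<phi> s - s * r \<le> \<eta> * (r + \<phi> (2 * s) - 2 * s * r)"
    if \<eta>: "0 < \<eta>" for \<eta>
  proof -
    obtain \<delta> K where \<delta>: "0 < \<delta>" and K: "0 \<le> K" and split: "\<And>u. 0 \<le> u \<Longrightarrow> exp (s * u) - 1 - s * u
        \<le> \<eta> * u + K * (if \<delta> < u then 1 else 0) + \<eta> * (exp (2 * s * u) - 1 - 2 * s * u)"
      using exp_remainder_split[OF s \<eta>] by blast
    define p where "p n = prob {\<omega>\<in>space M. incr (mesh n) 0 \<omega> < - \<delta>}" for n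
    have "\<exists>A. L \<le> A \<and> A \<le> expectation (\<lambda>\<omega>. exp (- s * grid_max J n \<omega>)) \<and>
        0 \<le> A * (exp (\<phi> s / 2^n) - 1) - s * (r * mesh n) \<and>
        A * (exp (\<phi> s / 2^n) - 1) - s * (r * mesh n)
          \<le> \<eta> * (r * mesh n) + K * p n + \<eta> * (exp (\<phi> (2 * s) / 2^n) - 1 - 2 * s * (r * mesh n))" for n
    proof -
      interpret rw: random_walk M "incr (mesh n)" "distr M borel (J (mesh n))" "r * mesh n"
        unfolding r_def by (rule random_walk_incr)
      have s2: "0 < 2 * s" using s by simp
      obtain A where A: "\<And>k. A \<le> expectation (\<lambda>\<omega>. exp (- s * rw.W k \<omega>))"
          "(\<lambda>k. expectation (\<lambda>\<omega>. exp (- s * rw.W k \<omega>))) \<longlonglongrightarrow> A"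
          "0 \<le> A * (exp (\<phi> s / 2^n) - 1) - s * (r * mesh n)"
          "A * (exp (\<phi> s / 2^n) - 1) - s * (r * mesh n)
            \<le> \<eta> * (r * mesh n) + K * p n + \<eta> * (exp (\<phi> (2 * s) / 2^n) - 1 - 2 * s * (r * mesh n))"
        using rw.lindley_laplace[OF s exp_incr(1)[OF s] exp_incr(1)[OF s2] \<delta> K \<eta> split]
        unfolding exp_incr(2)[OF s] exp_incr(2)[OF s2] \<phi>_def p_def by blast
      have "L \<le> expectation (\<lambda>\<omega>. exp (- s * rw.W k \<omega>))" for k
        unfolding L_def
      proof (rule integral_mono_AE[OF intL])
        show "integrable M (\<lambda>\<omega>. exp (- s * rw.W k \<omega>))"
          by (rule integrable_const_bound[of _ 1]) (use s rw.W_nonneg in auto)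
        show "AE \<omega> in M. exp (- s * all_time_max J \<omega>) \<le> exp (- s * rw.W k \<omega>)"
          using AE_all_time_max
        proof eventually_elim
          case (elim \<omega>)
          then have "rw.W k \<omega> \<le> all_time_max J \<omega>"
            by (auto simp: rw.W_def wmax_increment)
          then show ?case using s by simp
        qed
      qed
      then have "L \<le> A" by (intro LIMSEQ_le_const[OF A(2)]) auto
      moreover have "A \<le> expectation (\<lambda>\<omega>. exp (- s * grid_max J n \<omega>))"
        using A(1)[of "4^n"] by (simp add: rw.W_def grid_max_def)
      ultimately show ?thesis using A(3,4) by blast
    qed
    then obtain A where A: "\<And>n. L \<le> A n" "\<And>n. A n \<le> expectation (\<lambda>\<omega>. exp (- s * grid_max J n \<omega>))"
      "\<And>n. 0 \<le> A n * (exp (\<phi> s / 2^n) - 1) - s * (r * mesh n)"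
      "\<And>n. A n * (exp (\<phi> s / 2^n) - 1) - s * (r * mesh n)
          \<le> \<eta> * (r * mesh n) + K * p n + \<eta> * (exp (\<phi> (2 * s) / 2^n) - 1 - 2 * s * (r * mesh n))"
      by metis
    have A_lim: "A \<longlonglongrightarrow> L"
      by (rule tendsto_sandwich[OF _ _ tendsto_const limL]) (use A in auto)
    have lim1: "(\<lambda>n. A n * (2^n * (exp (\<phi> s / 2^n) - 1)) - s * r) \<longlonglongrightarrow> L * \<phi> s - s * r"
      by (intro tendsto_intros A_lim exp_difference_quotient)
    have lim2: "(\<lambda>n. \<eta> * r + K * (2^n * p n) + \<eta> * (2^n * (exp (\<phi> (2 * s) / 2^n) - 1) - 2 * s * r))
        \<longlonglongrightarrow> \<eta> * r + K * 0 + \<eta> * (\<phi> (2 * s) - 2 * s * r)"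
      unfolding p_def by (intro tendsto_intros exp_difference_quotient prob_drop_mesh[OF \<delta>])
    have scaled1: "2^n * (A n * (exp (\<phi> s / 2^n) - 1) - s * (r * mesh n)) = A n * (2^n * (exp (\<phi> s / 2^n) - 1)) - s * r" for n
      by (simp add: field_simps)
    have scaled2: "2^n * (\<eta> * (r * mesh n) + K * p n + \<eta> * (exp (\<phi> (2 * s) / 2^n) - 1 - 2 * s * (r * mesh n)))
        = \<eta> * r + K * (2^n * p n) + \<eta> * (2^n * (exp (\<phi> (2 * s) / 2^n) - 1) - 2 * s * r)" for n
      by (simp add: field_simps)
    have nonneg: "0 \<le> A n * (2^n * (exp (\<phi> s / 2^n) - 1)) - s * r" for n
      unfolding scaled1[symmetric] by (intro mult_nonneg_nonneg A(3)) simp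
    have upper: "A n * (2^n * (exp (\<phi> s / 2^n) - 1)) - s * r
        \<le> \<eta> * r + K * (2^n * p n) + \<eta> * (2^n * (exp (\<phi> (2 * s) / 2^n) - 1) - 2 * s * r)" for n
      unfolding scaled1[symmetric] scaled2[symmetric] by (intro mult_left_mono A(4)) simp
    show "0 \<le> L * \<phi> s - s * r"
      by (rule LIMSEQ_le_const[OF lim1]) (use nonneg in blast)
    have "L * \<phi> s - s * r \<le> \<eta> * r + K * 0 + \<eta> * (\<phi> (2 * s) - 2 * s * r)"
      by (rule LIMSEQ_le[OF lim1 lim2]) (use upper in blast)
    then show "L * \<phi> s - s * r \<le> \<eta> * (r + \<phi> (2 * s) - 2 * s * r)"
      by (simp add: algebra_simps)
  qed
  have "L * \<phi> s - s * r \<le> 0"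
  proof (rule tendsto_lowerbound)
    show "((\<lambda>\<eta>. \<eta> * (r + \<phi> (2 * s) - 2 * s * r)) \<longlongrightarrow> 0) (at_right 0)"
      by (auto intro!: tendsto_eq_intros)
    show "\<forall>\<^sub>F \<eta> in at_right 0. L * \<phi> s - s * r \<le> \<eta> * (r + \<phi> (2 * s) - 2 * s * r)"
      using bounds(2) by (auto simp: eventually_at_right_field intro!: exI[of _ 1])
  qed simp
  with bounds(1)[of 1] show ?thesis unfolding L_def \<phi>_def r_def by linarith
qed

end

section \<open>The log-Laplace transform near zero\<close>

lemma exp_second_order: "((\<lambda>u::real. (exp (- u * y) - 1 + u * y) / u\<^sup>2) \<longlongrightarrow> y\<^sup>2 / 2) (at_right 0)"
proof -
  consider "y = 0" | "y > 0" | "y < 0" by linarith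
  then show ?thesis
    by cases (simp, real_asymp simp: power2_eq_square, real_asymp simp: power2_eq_square)
qed

text \<open>
  Dominated convergence: for \<open>u < 1\<close> the second-order quotient is at most \<open>Y^2\<close> where \<open>Y\<close> is nonnegative, and at most
  \<open>exp (- 2 * Y)\<close> where it is negative.
\<close>

lemma (in prob_space) ln_laplace_second_order:
  fixes Y :: "'a \<Rightarrow> real"
  assumes [measurable]: "Y \<in> borel_measurable M"
    and sq: "integrable M (\<lambda>\<omega>. (Y \<omega>)\<^sup>2)" and mean: "expectation Y = 0"
    and exp_int: "\<And>s. 0 \<le> s \<Longrightarrow> integrable M (\<lambda>\<omega>. exp (- s * Y \<omega>))"
  shows "((\<lambda>u. ln (expectation (\<lambda>\<omega>. exp (- u * Y \<omega>))) / u\<^sup>2) \<longlongrightarrow> expectation (\<lambda>\<omega>. (Y \<omega>)\<^sup>2) / 2) (at_right 0)"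
proof -
  define g where "g u = expectation (\<lambda>\<omega>. (exp (- u * Y \<omega>) - 1 + u * Y \<omega>) / u\<^sup>2)" for u
  have int1: "integrable M Y" by (rule integrable_of_square[OF _ sq]) simp
  have g_eq: "expectation (\<lambda>\<omega>. exp (- u * Y \<omega>)) = 1 + u\<^sup>2 * g u" if "0 < u" for u
    unfolding g_def using that exp_int[of u] int1 by (simp add: prob_space mean)
  have g_nonneg: "0 \<le> g u" for u
    unfolding g_def
  proof (rule integral_nonneg_AE[OF AE_I2])
    fix \<omega> show "0 \<le> (exp (- u * Y \<omega>) - 1 + u * Y \<omega>) / u\<^sup>2"
      using exp_ge_add_one_self[of "- u * Y \<omega>"] by (intro divide_nonneg_nonneg) auto
  qed
  have g_lim: "(g \<longlongrightarrow> expectation (\<lambda>\<omega>. (Y \<omega>)\<^sup>2 / 2)) (at_right 0)"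
    unfolding tendsto_at_iff_sequentially
  proof (intro allI impI)
    fix X :: "nat \<Rightarrow> real" assume X: "\<forall>i. X i \<in> {0<..} - {0}" "X \<longlonglongrightarrow> 0"
    then obtain N where N: "\<And>j. j \<ge> N \<Longrightarrow> X j < 1"
      using order_tendstoD(2)[OF X(2), of 1] by (auto simp: eventually_sequentially)
    have Xpos: "0 < X j" for j using X(1) by auto
    have Xne: "X j \<noteq> 0" for j using Xpos[of j] by simp
    have Xright: "filterlim (\<lambda>j. X (j + N)) (at_right 0) sequentially"
      unfolding filterlim_at using LIMSEQ_ignore_initial_segment[OF X(2), of N] Xpos Xne by auto
    \<comment> \<open>Indices beyond \<open>N\<close> have \<open>X j < 1\<close>, which makes the dominating function independent of \<open>j\<close>.\<close>
    have "(\<lambda>j. g (X (j + N))) \<longlonglongrightarrow> expectation (\<lambda>\<omega>. (Y \<omega>)\<^sup>2 / 2)"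
      unfolding g_def
    proof (rule integral_dominated_convergence[where w = "\<lambda>\<omega>. (Y \<omega>)\<^sup>2 + exp (- 2 * Y \<omega>)"])
      show "integrable M (\<lambda>\<omega>. (Y \<omega>)\<^sup>2 + exp (- 2 * Y \<omega>))" using sq exp_int[of 2] by simp
      show "AE \<omega> in M. (\<lambda>j. (exp (- X (j + N) * Y \<omega>) - 1 + X (j + N) * Y \<omega>) / (X (j + N))\<^sup>2) \<longlonglongrightarrow> (Y \<omega>)\<^sup>2 / 2"
        by (intro AE_I2 filterlim_compose[OF exp_second_order Xright])
      show "AE \<omega> in M. norm ((exp (- X (j + N) * Y \<omega>) - 1 + X (j + N) * Y \<omega>) / (X (j + N))\<^sup>2) \<le> (Y \<omega>)\<^sup>2 + exp (- 2 * Y \<omega>)" for j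
      proof (rule AE_I2)
        fix \<omega>
        define u y where "u = X (j + N)" and "y = Y \<omega>"
        have u: "0 < u" "u < 1" using N[of "j + N"] Xpos by (auto simp: u_def)
        have nn: "0 \<le> exp (- u * y) - 1 + u * y" using exp_ge_add_one_self[of "- u * y"] by simp
        have "- u * y \<le> max 0 (- y)"
        proof (cases "y \<ge> 0")
          case False
          then have "u * (- y) \<le> 1 * (- y)" using u by (intro mult_right_mono) auto
          then show ?thesis by simp
        qed (use u in simp)
        then have "exp (- u * y) \<le> 1 + (- u * y) + (- u * y)\<^sup>2 / 2 * exp (max 0 (- y))"
          by (intro exp_quadratic_upper) auto
        then have "(exp (- u * y) - 1 + u * y) / u\<^sup>2 \<le> y\<^sup>2 / 2 * exp (max 0 (- y))"
          using u by (simp add: field_simps power_mult_distrib)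
        also have "\<dots> \<le> y\<^sup>2 + exp (- 2 * y)"
        proof (cases "y \<ge> 0")
          case True
          then show ?thesis by simp
        next
          case False
          have "y\<^sup>2 / 2 \<le> exp (- y)"
            using exp_lower_Taylor_quadratic[of "- y"] False by simp
          then have "y\<^sup>2 / 2 * exp (- y) \<le> exp (- y) * exp (- y)" by (intro mult_right_mono) auto
          also have "\<dots> = exp (- 2 * y)" by (simp flip: exp_add)
          finally show ?thesis using False by (simp add: add_increasing)
        qed
        finally have "(exp (- u * y) - 1 + u * y) / u\<^sup>2 \<le> y\<^sup>2 + exp (- 2 * y)" .
        then show "norm ((exp (- X (j + N) * Y \<omega>) - 1 + X (j + N) * Y \<omega>) / (X (j + N))\<^sup>2) \<le> (Y \<omega>)\<^sup>2 + exp (- 2 * Y \<omega>)"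
          using nn unfolding u_def[symmetric] y_def[symmetric] by simp
      qed
    qed auto
    then show "(g \<circ> X) \<longlonglongrightarrow> expectation (\<lambda>\<omega>. (Y \<omega>)\<^sup>2 / 2)"
      unfolding comp_def by (rule LIMSEQ_offset)
  qed
  have lim0: "((\<lambda>u. u\<^sup>2 * g u) \<longlongrightarrow> 0\<^sup>2 * expectation (\<lambda>\<omega>. (Y \<omega>)\<^sup>2 / 2)) (at_right 0)"
    by (intro tendsto_intros g_lim)
  have "((\<lambda>u. g u - u\<^sup>2 * g u * g u) \<longlongrightarrow> expectation (\<lambda>\<omega>. (Y \<omega>)\<^sup>2 / 2) - 0\<^sup>2 * expectation (\<lambda>\<omega>. (Y \<omega>)\<^sup>2 / 2) * expectation (\<lambda>\<omega>. (Y \<omega>)\<^sup>2 / 2)) (at_right 0)"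
    by (intro tendsto_intros g_lim)
  then have low: "((\<lambda>u. g u - u\<^sup>2 * g u * g u) \<longlongrightarrow> expectation (\<lambda>\<omega>. (Y \<omega>)\<^sup>2 / 2)) (at_right 0)" by simp
  have "((\<lambda>u. ln (expectation (\<lambda>\<omega>. exp (- u * Y \<omega>))) / u\<^sup>2) \<longlongrightarrow> expectation (\<lambda>\<omega>. (Y \<omega>)\<^sup>2 / 2)) (at_right 0)"
  proof (rule tendsto_sandwich[OF _ _ low g_lim])
    have small: "\<forall>\<^sub>F u in at_right 0. u\<^sup>2 * g u < 1" using order_tendstoD(2)[OF lim0, of 1] by simp
    have pos: "\<forall>\<^sub>F u in at_right (0::real). 0 < u" by (simp add: eventually_at_right_less)
    show "\<forall>\<^sub>F u in at_right 0. g u - u\<^sup>2 * g u * g u \<le> ln (expectation (\<lambda>\<omega>. exp (- u * Y \<omega>))) / u\<^sup>2"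
      using small pos
    proof eventually_elim
      case (elim u)
      have "u\<^sup>2 * g u - (u\<^sup>2 * g u)\<^sup>2 \<le> ln (1 + u\<^sup>2 * g u)"
        using elim g_nonneg[of u] by (intro ln_one_plus_pos_lower_bound) auto
      then show ?case using elim(2) unfolding g_eq[OF elim(2)] by (simp add: field_simps power2_eq_square)
    qed
    show "\<forall>\<^sub>F u in at_right 0. ln (expectation (\<lambda>\<omega>. exp (- u * Y \<omega>))) / u\<^sup>2 \<le> g u"
      using pos
    proof eventually_elim
      case (elim u)
      have "ln (1 + u\<^sup>2 * g u) \<le> u\<^sup>2 * g u"
        using g_nonneg[of u] by (intro ln_add_one_self_le_self) auto
      then show ?case using elim unfolding g_eq[OF elim] by (simp add: field_simps)
    qed
  qed
  then show ?thesis by simp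
qed

section \<open>Weak convergence on the quadrant\<close>

text \<open>
  The indicator of a closed set is a decreasing limit of continuous functions of the distance to the set, and closed sets
  form an intersection-stable generator.
\<close>

lemma integral_bounded_continuous_eq_imp_measure_eq:
  fixes \<mu> \<nu> :: "'b::metric_space measure"
  assumes \<mu>: "prob_space \<mu>" "sets \<mu> = sets borel" and \<nu>: "prob_space \<nu>" "sets \<nu> = sets borel"
    and eq: "\<And>f :: 'b \<Rightarrow> real. continuous_on UNIV f \<Longrightarrow> bounded (range f) \<Longrightarrow> (\<integral>x. f x \<partial>\<mu>) = (\<integral>x. f x \<partial>\<nu>)"
  shows "\<mu> = \<nu>"
proof -
  interpret \<mu>: prob_space \<mu> by fact
  interpret \<nu>: prob_space \<nu> by fact
  have closed_eq: "emeasure \<mu> C = emeasure \<nu> C" if C: "closed C" for C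
  proof (cases "C = {}")
    case False
    define f where "f n x = max 0 (1 - real n * infdist x C)" for n x
    have cont: "continuous_on UNIV (f n)" for n unfolding f_def by (intro continuous_intros)
    have f01: "0 \<le> f n x" "f n x \<le> 1" for n x
      by (auto simp: f_def infdist_nonneg)
    have bdd: "bounded (range (f n))" for n
      using f01 by (intro boundedI[of _ 1]) auto
    have pointwise: "(\<lambda>n. f n x) \<longlonglongrightarrow> indicator C x" for x
    proof (cases "x \<in> C")
      case True
      then have "f n x = 1" for n by (simp add: f_def infdist_zero)
      with True show ?thesis by simp
    next
      case False
      with C \<open>C \<noteq> {}\<close> have "infdist x C \<noteq> 0" using in_closed_iff_infdist_zero by blast
      then have pos: "0 < infdist x C" using infdist_nonneg[of x C] by linarith
      then obtain N where N: "1 < real N * infdist x C" using reals_Archimedean3 by blast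
      have "f n x = 0" if "n \<ge> N" for n
      proof -
        have "real N * infdist x C \<le> real n * infdist x C" using that pos by simp
        with N show ?thesis by (simp add: f_def)
      qed
      then have "\<forall>\<^sub>F n in sequentially. f n x = 0" by (auto simp: eventually_sequentially)
      with False show ?thesis by (simp add: tendsto_eventually)
    qed
    have lim: "(\<lambda>n. \<integral>x. f n x \<partial>\<rho>) \<longlonglongrightarrow> (\<integral>x. indicator C x \<partial>\<rho>)"
      if "prob_space \<rho>" "sets \<rho> = sets borel" for \<rho>
    proof (rule integral_dominated_convergence[where w = "\<lambda>_. 1"])
      interpret prob_space \<rho> by fact
      show "integrable \<rho> (\<lambda>_. 1::real)" by simp
      show "f n \<in> borel_measurable \<rho>" for n
        using borel_measurable_continuous_onI[OF cont] that(2) by (simp cong: measurable_cong_sets)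
      show "indicator C \<in> borel_measurable \<rho>"
        using C that(2) by (intro borel_measurable_indicator) auto
    qed (use pointwise f01 in auto)
    have "(\<integral>x. indicator C x \<partial>\<mu>) = (\<integral>x. indicator C x \<partial>\<nu> :: real)"
      by (rule LIMSEQ_unique[OF lim[OF \<mu>]]) (use lim[OF \<nu>] in \<open>simp add: eq[OF cont bdd]\<close>)
    then show ?thesis
      using C \<mu>(2) \<nu>(2) by (simp add: \<mu>.emeasure_eq_measure \<nu>.emeasure_eq_measure)
  qed simp
  show ?thesis
  proof (rule measure_eqI_generator_eq[where E = "Collect closed" and \<Omega> = UNIV and A = "\<lambda>_. UNIV"])
    show "Int_stable (Collect (closed :: 'b set \<Rightarrow> bool))" by (auto simp: Int_stable_def)
    have "sets (borel :: 'b measure) = sigma_sets UNIV (Collect closed)" by (subst borel_eq_closed) simp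
    then show "sets \<mu> = sigma_sets UNIV (Collect closed)" "sets \<nu> = sigma_sets UNIV (Collect closed)"
      using \<mu>(2) \<nu>(2) by auto
  qed (use closed_eq in auto)
qed

lemma converges_weakly_unique:
  fixes \<nu>1 \<nu>2 :: "'b::metric_space measure"
  assumes "converges_weakly \<mu> \<nu>1 F" "converges_weakly \<mu> \<nu>2 F" "F \<noteq> bot"
  shows "\<nu>1 = \<nu>2"
proof (rule integral_bounded_continuous_eq_imp_measure_eq)
  fix f :: "'b \<Rightarrow> real" assume "continuous_on UNIV f" "bounded (range f)"
  with assms show "(\<integral>x. f x \<partial>\<nu>1) = (\<integral>x. f x \<partial>\<nu>2)"
    unfolding converges_weakly_def by (metis tendsto_unique)
qed (use assms in \<open>auto simp: converges_weakly_def\<close>)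

text \<open>
  In the coordinates \<open>exp (- x)\<close>, \<open>exp (- y)\<close> the quadrant becomes a bounded square and the functions
  \<open>exp (- (k * x + l * y))\<close> become monomials.
\<close>

definition exp_neg :: "real \<times> real \<Rightarrow> real \<times> real" where
  "exp_neg q = (exp (- fst q), exp (- snd q))"

definition quadrant_law :: "(real \<times> real) measure \<Rightarrow> bool" where
  "quadrant_law \<mu> \<longleftrightarrow> prob_space \<mu> \<and> sets \<mu> = sets borel \<and> (AE q in \<mu>. 0 \<le> fst q \<and> 0 \<le> snd q)"

lemma quadrant_integrable:
  assumes \<mu>: "quadrant_law \<mu>" and g: "continuous_on UNIV g"
  shows "integrable \<mu> (\<lambda>q. g (exp_neg q) :: real)"
proof -
  interpret prob_space \<mu> using \<mu> by (simp add: quadrant_law_def)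
  have "compact (g ` ({0..1} \<times> {0..1}))"
    using g by (intro compact_continuous_image compact_Times) (auto intro: continuous_on_subset)
  then obtain B where B: "\<And>x. x \<in> {0..1} \<times> {0..1} \<Longrightarrow> norm (g x) \<le> B"
    by (meson bounded_iff compact_imp_bounded image_eqI)
  show ?thesis
  proof (rule integrable_const_bound)
    have "AE q in \<mu>. 0 \<le> fst q \<and> 0 \<le> snd q" using \<mu> by (simp add: quadrant_law_def)
    then show "AE q in \<mu>. norm (g (exp_neg q)) \<le> B"
    proof eventually_elim
      case (elim q)
      then have "exp_neg q \<in> {0..1} \<times> {0..1}" by (auto simp: exp_neg_def)
      then show ?case by (rule B)
    qed
    have "continuous_on UNIV (\<lambda>q. g (exp_neg q))"
      unfolding exp_neg_def by (intro continuous_intros continuous_on_compose2[OF g]) auto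
    then show "(\<lambda>q. g (exp_neg q)) \<in> borel_measurable \<mu>"
      using borel_measurable_continuous_onI \<mu> unfolding quadrant_law_def
      by (metis measurable_cong_sets)
  qed
qed

text \<open>
  Polynomials are built from linear functions and constants by sums and products.  Convergence is not visibly preserved by
  products, so the induction runs over the operator that multiplies by the polynomial: it preserves the class
  \<open>stable\<close> of functions for which convergence holds after multiplication by any monomial.
\<close>

lemma polynomial_laplace_convergence:
  fixes \<mu> :: "'i \<Rightarrow> (real \<times> real) measure"
  assumes \<mu>: "\<forall>\<^sub>F i in F. quadrant_law (\<mu> i)" and \<nu>: "quadrant_law \<nu>"
    and mono: "\<And>(k :: nat) (l :: nat). ((\<lambda>i. \<integral>q. exp (- (k * fst q + l * snd q)) \<partial>\<mu> i)
        \<longlongrightarrow> (\<integral>q. exp (- (k * fst q + l * snd q)) \<partial>\<nu>)) F"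
    and p: "real_polynomial_function p"
  shows "((\<lambda>i. \<integral>q. p (exp_neg q) \<partial>\<mu> i) \<longlongrightarrow> (\<integral>q. p (exp_neg q) \<partial>\<nu>)) F"
proof -
  define conv :: "(real \<times> real \<Rightarrow> real) \<Rightarrow> bool" where
    "conv g \<longleftrightarrow> ((\<lambda>i. \<integral>q. g (exp_neg q) \<partial>\<mu> i) \<longlongrightarrow> (\<integral>q. g (exp_neg q) \<partial>\<nu>)) F" for g
  have conv_add: "conv (\<lambda>x. g x + h x)"
    if "conv g" "conv h" "continuous_on UNIV g" "continuous_on UNIV h" for g h
  proof -
    have "((\<lambda>i. (\<integral>q. g (exp_neg q) \<partial>\<mu> i) + (\<integral>q. h (exp_neg q) \<partial>\<mu> i)) \<longlongrightarrow> (\<integral>q. g (exp_neg q) \<partial>\<nu>) + (\<integral>q. h (exp_neg q) \<partial>\<nu>)) F"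
      using that(1,2) unfolding conv_def by (rule tendsto_add)
    then have "((\<lambda>i. \<integral>q. g (exp_neg q) + h (exp_neg q) \<partial>\<mu> i) \<longlongrightarrow> (\<integral>q. g (exp_neg q) \<partial>\<nu>) + (\<integral>q. h (exp_neg q) \<partial>\<nu>)) F"
    proof (rule Lim_transform_eventually)
      show "\<forall>\<^sub>F i in F. (\<integral>q. g (exp_neg q) \<partial>\<mu> i) + (\<integral>q. h (exp_neg q) \<partial>\<mu> i) = (\<integral>q. g (exp_neg q) + h (exp_neg q) \<partial>\<mu> i)"
        using \<mu> by eventually_elim (simp add: quadrant_integrable that)
    qed
    then show ?thesis unfolding conv_def by (simp add: quadrant_integrable[OF \<nu>] that)
  qed
  have conv_scale: "conv (\<lambda>x. c * g x)" if "conv g" for c g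
    using tendsto_mult_left[of _ _ _ c] that unfolding conv_def by simp
  define stable where "stable g \<longleftrightarrow> continuous_on UNIV g \<and> (\<forall>(k :: nat) (l :: nat). conv (\<lambda>x. g x * (fst x ^ k * snd x ^ l)))" for g
  have stable_add: "stable (\<lambda>x. g x + h x)" if "stable g" "stable h" for g h
    using that unfolding stable_def
    by (auto simp: distrib_right intro!: continuous_intros conv_add continuous_on_mult)
  have stable_scale: "stable (\<lambda>x. c * g x)" if "stable g" for c g
    using that conv_scale unfolding stable_def
    by (auto simp: mult.assoc intro!: continuous_intros)
  have stable_fst: "stable (\<lambda>x. fst x * g x)" if "stable g" for g
    unfolding stable_def
  proof (intro conjI allI)
    show "continuous_on UNIV (\<lambda>x. fst x * g x)" using that by (auto simp: stable_def intro!: continuous_intros)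
    fix k l :: nat
    have "conv (\<lambda>x. g x * (fst x ^ Suc k * snd x ^ l))" using that unfolding stable_def by blast
    then show "conv (\<lambda>x. fst x * g x * (fst x ^ k * snd x ^ l))" by (simp add: ac_simps)
  qed
  have stable_snd: "stable (\<lambda>x. snd x * g x)" if "stable g" for g
    unfolding stable_def
  proof (intro conjI allI)
    show "continuous_on UNIV (\<lambda>x. snd x * g x)" using that by (auto simp: stable_def intro!: continuous_intros)
    fix k l :: nat
    have "conv (\<lambda>x. g x * (fst x ^ k * snd x ^ Suc l))" using that unfolding stable_def by blast
    then show "conv (\<lambda>x. snd x * g x * (fst x ^ k * snd x ^ l))" by (simp add: ac_simps)
  qed
  have "\<forall>g. stable g \<longrightarrow> stable (\<lambda>x. p x * g x)"
    using p
  proof induction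
    case (linear f)
    show ?case
    proof (intro allI impI)
      fix g assume g: "stable g"
      have lin: "linear f" using linear by (rule bounded_linear.linear)
      have f_eq: "f x = f (1, 0) * fst x + f (0, 1) * snd x" for x
      proof -
        have "x = fst x *\<^sub>R (1, 0) + snd x *\<^sub>R (0, 1)" by (cases x) simp
        then have "f x = f (fst x *\<^sub>R (1, 0) + snd x *\<^sub>R (0, 1))" by simp
        also have "\<dots> = fst x * f (1, 0) + snd x * f (0, 1)"
          by (simp only: linear_add[OF lin] linear_scale[OF lin] real_scaleR_def)
        finally show ?thesis by (simp add: mult.commute)
      qed
      have "stable (\<lambda>x. f (1, 0) * (fst x * g x) + f (0, 1) * (snd x * g x))"
        by (intro stable_add stable_scale stable_fst stable_snd g)
      moreover have "(\<lambda>x. f x * g x) = (\<lambda>x. f (1, 0) * (fst x * g x) + f (0, 1) * (snd x * g x))"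
        by (rule ext, subst f_eq) (simp add: algebra_simps)
      ultimately show "stable (\<lambda>x. f x * g x)" by simp
    qed
  next
    case (const c)
    then show ?case using stable_scale by blast
  next
    case (add f1 f2)
    then show ?case using stable_add by (simp add: distrib_right)
  next
    case (mult f1 f2)
    then show ?case by (simp add: mult.assoc)
  qed
  moreover have "stable (\<lambda>_. 1)"
    unfolding stable_def conv_def
  proof (intro conjI allI)
    fix k l :: nat
    have "1 * (fst (exp_neg q) ^ k * snd (exp_neg q) ^ l) = exp (- (k * fst q + l * snd q))" for q :: "real \<times> real"
      by (simp add: exp_neg_def exp_of_nat_mult[symmetric] exp_add[symmetric])
    then show "((\<lambda>i. \<integral>q. 1 * (fst (exp_neg q) ^ k * snd (exp_neg q) ^ l) \<partial>\<mu> i)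
        \<longlongrightarrow> (\<integral>q. 1 * (fst (exp_neg q) ^ k * snd (exp_neg q) ^ l) \<partial>\<nu>)) F"
      using mono[of k l] by simp
  qed simp
  ultimately have "stable (\<lambda>x. p x * 1)" by blast
  then have "conv (\<lambda>x. p x * 1 * (fst x ^ 0 * snd x ^ 0))" unfolding stable_def by blast
  then show ?thesis by (simp add: conv_def)
qed

text \<open>
  A bounded continuous function, in the coordinates \<open>exp_neg\<close>, may fail to extend continuously to the sides of the
  square that correspond to infinity.  Multiplication by a factor that vanishes there makes it continuous on the compact
  square, where Stone-Weierstrass applies.  The factor is close to \<open>1\<close> on most of the mass of \<open>\<nu>\<close>, and by the same convergence on
  most of the mass of \<open>\<mu> i\<close>.
\<close>

lemma converges_weakly_laplace:
  fixes \<mu> :: "'i \<Rightarrow> (real \<times> real) measure"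
  assumes \<mu>: "\<forall>\<^sub>F i in F. quadrant_law (\<mu> i)" and \<nu>: "quadrant_law \<nu>"
    and mono: "\<And>(k :: nat) (l :: nat). ((\<lambda>i. \<integral>q. exp (- (k * fst q + l * snd q)) \<partial>\<mu> i)
        \<longlongrightarrow> (\<integral>q. exp (- (k * fst q + l * snd q)) \<partial>\<nu>)) F"
  shows "converges_weakly \<mu> \<nu> F"
proof -
  interpret \<nu>: prob_space \<nu> using \<nu> by (simp add: quadrant_law_def)
  define cut :: "real \<Rightarrow> real \<times> real \<Rightarrow> real" where
    "cut \<delta> x = min 1 (fst x / \<delta>) * min 1 (snd x / \<delta>)" for \<delta> x
  have cut01: "0 \<le> cut \<delta> x" "cut \<delta> x \<le> 1" if "0 < \<delta>" "0 \<le> fst x" "0 \<le> snd x" for \<delta> x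
    using that by (auto simp: cut_def intro!: mult_nonneg_nonneg mult_le_one)
  have cut_cont: "continuous_on UNIV (cut \<delta>)" if "0 < \<delta>" for \<delta>
    unfolding cut_def using that by (intro continuous_intros) auto
  have E_nonneg: "0 \<le> fst (exp_neg q)" "0 \<le> snd (exp_neg q)" for q by (auto simp: exp_neg_def)
  have E_cont: "continuous_on UNIV exp_neg" unfolding exp_neg_def by (intro continuous_intros)
  have meas: "f \<in> borel_measurable \<rho>" if "continuous_on UNIV f" "quadrant_law \<rho>" for f :: "real \<times> real \<Rightarrow> real" and \<rho>
    using borel_measurable_continuous_onI[OF that(1)] that(2)
    unfolding quadrant_law_def by (metis measurable_cong_sets)
  have integ: "integrable \<rho> f"
    if f: "continuous_on UNIV f" "\<And>x. \<bar>f x\<bar> \<le> B" and \<rho>: "quadrant_law \<rho>" for f :: "real \<times> real \<Rightarrow> real" and \<rho> B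
  proof -
    interpret prob_space \<rho> using \<rho> by (simp add: quadrant_law_def)
    show ?thesis by (rule integrable_const_bound[of _ B]) (use f meas[OF f(1) \<rho>] in auto)
  qed
  have truncated: "((\<lambda>i. \<integral>q. f q * cut \<delta> (exp_neg q) \<partial>\<mu> i) \<longlongrightarrow> (\<integral>q. f q * cut \<delta> (exp_neg q) \<partial>\<nu>)) F"
    if f: "continuous_on UNIV f" "\<And>x. \<bar>f x\<bar> \<le> B" and \<delta>: "0 < \<delta>" for f :: "real \<times> real \<Rightarrow> real" and B \<delta>
  proof (rule tendstoI)
    fix e :: real assume e: "0 < e"
    let ?S = "{0..1::real} \<times> {0..1::real}"
    define h where "h x = f (- ln (fst x), - ln (snd x)) * cut \<delta> x" for x
    have hE: "h (exp_neg q) = f q * cut \<delta> (exp_neg q)" for q by (simp add: h_def exp_neg_def)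
    have "continuous_on ?S h"
      unfolding continuous_on_eq_continuous_within
    proof
      fix x assume x: "x \<in> ?S"
      show "continuous (at x within ?S) h"
      proof (cases "fst x = 0 \<or> snd x = 0")
        case False
        then have pos: "0 < fst x" "0 < snd x" using x by (auto simp: mem_Times_iff)
        have 1: "((\<lambda>y. (- ln (fst y), - ln (snd y))) \<longlongrightarrow> (- ln (fst x), - ln (snd x))) (at x within ?S)"
          using pos by (intro tendsto_intros) auto
        have 2: "isCont f (- ln (fst x), - ln (snd x))" using f(1) by (simp add: continuous_on_eq_continuous_at)
        have 3: "(cut \<delta> \<longlongrightarrow> cut \<delta> x) (at x within ?S)"
          using cut_cont[OF \<delta>] by (meson UNIV_I continuous_on_def subset_UNIV tendsto_within_subset)
        show ?thesis
          unfolding continuous_within h_def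
          by (intro tendsto_mult isCont_tendsto_compose[OF 2 1] 3)
      next
        \<comment> \<open>At a side at infinity boundedness of \<open>f\<close> suffices, since the factor tends to \<open>0\<close>.\<close>
        case True
        then have cx: "cut \<delta> x = 0" by (auto simp: cut_def)
        have 3: "(cut \<delta> \<longlongrightarrow> 0) (at x within ?S)"
          using cut_cont[OF \<delta>] unfolding cx[symmetric]
          by (meson UNIV_I continuous_on_def subset_UNIV tendsto_within_subset)
        have "(h \<longlongrightarrow> 0) (at x within ?S)"
        proof (rule Lim_null_comparison)
          show "((\<lambda>y. B * cut \<delta> y) \<longlongrightarrow> 0) (at x within ?S)"
            using tendsto_mult_left[OF 3, of B] by simp
          have "norm (h y) \<le> B * cut \<delta> y" if "y \<in> ?S" for y
          proof -
            have "0 \<le> cut \<delta> y" using that \<delta> by (intro cut01) (auto simp: mem_Times_iff)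
            then show ?thesis using f(2) by (auto simp: h_def abs_mult intro!: mult_right_mono)
          qed
          then show "\<forall>\<^sub>F y in at x within ?S. norm (h y) \<le> B * cut \<delta> y"
            by (simp add: eventually_at_filter)
        qed
        then show ?thesis unfolding continuous_within by (simp add: h_def cx)
      qed
    qed
    then obtain p where p: "real_polynomial_function p" "\<And>x. x \<in> ?S \<Longrightarrow> \<bar>h x - p x\<bar> < e / 3"
      using Stone_Weierstrass_real_polynomial_function[of ?S h "e / 3"] e by (auto intro: compact_Times)
    have p_cont: "continuous_on UNIV p"
      using p(1) by (simp add: continuous_on_polymonial_function continuous_real_polymonial_function continuous_at_imp_continuous_on)
    have close: "\<bar>(\<integral>q. f q * cut \<delta> (exp_neg q) \<partial>\<rho>) - (\<integral>q. p (exp_neg q) \<partial>\<rho>)\<bar> \<le> e / 3" if \<rho>: "quadrant_law \<rho>" for \<rho>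
    proof -
      interpret prob_space \<rho> using \<rho> by (simp add: quadrant_law_def)
      have int1: "integrable \<rho> (\<lambda>q. f q * cut \<delta> (exp_neg q))"
      proof (rule integ[OF _ _ \<rho>])
        show "continuous_on UNIV (\<lambda>q. f q * cut \<delta> (exp_neg q))"
          by (intro continuous_intros f continuous_on_compose2[OF cut_cont[OF \<delta>] E_cont]) auto
        fix q
        have "\<bar>f q\<bar> * cut \<delta> (exp_neg q) \<le> B * 1"
          using f(2)[of q] cut01[OF \<delta> E_nonneg, of q] by (intro mult_mono) (auto intro: order_trans[OF abs_ge_zero])
        then show "\<bar>f q * cut \<delta> (exp_neg q)\<bar> \<le> B" using cut01[OF \<delta> E_nonneg, of q] by (simp add: abs_mult)
      qed
      have int2: "integrable \<rho> (\<lambda>q. p (exp_neg q))" by (rule quadrant_integrable[OF \<rho> p_cont])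
      have "\<bar>(\<integral>q. f q * cut \<delta> (exp_neg q) \<partial>\<rho>) - (\<integral>q. p (exp_neg q) \<partial>\<rho>)\<bar>
          = \<bar>\<integral>q. f q * cut \<delta> (exp_neg q) - p (exp_neg q) \<partial>\<rho>\<bar>"
        using int1 int2 by simp
      also have "\<dots> \<le> (\<integral>q. \<bar>f q * cut \<delta> (exp_neg q) - p (exp_neg q)\<bar> \<partial>\<rho>)"
        by (rule integral_abs_bound)
      also have "\<dots> \<le> (\<integral>q. e / 3 \<partial>\<rho>)"
      proof (rule integral_mono_AE)
        show "integrable \<rho> (\<lambda>q. \<bar>f q * cut \<delta> (exp_neg q) - p (exp_neg q)\<bar>)" using int1 int2 by simp
        have "AE q in \<rho>. 0 \<le> fst q \<and> 0 \<le> snd q" using \<rho> by (simp add: quadrant_law_def)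
        then show "AE q in \<rho>. \<bar>f q * cut \<delta> (exp_neg q) - p (exp_neg q)\<bar> \<le> e / 3"
        proof eventually_elim
          case (elim q)
          then have "exp_neg q \<in> ?S" by (auto simp: exp_neg_def)
          from p(2)[OF this] show ?case by (simp add: hE)
        qed
      qed simp
      also have "\<dots> = e / 3" by (simp add: prob_space)
      finally show ?thesis .
    qed
    have "\<forall>\<^sub>F i in F. dist (\<integral>q. p (exp_neg q) \<partial>\<mu> i) (\<integral>q. p (exp_neg q) \<partial>\<nu>) < e / 3"
      using polynomial_laplace_convergence[OF \<mu> \<nu> mono p(1)] e by (intro tendstoD) auto
    with \<mu> show "\<forall>\<^sub>F i in F. dist (\<integral>q. f q * cut \<delta> (exp_neg q) \<partial>\<mu> i) (\<integral>q. f q * cut \<delta> (exp_neg q) \<partial>\<nu>) < e"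
    proof eventually_elim
      case (elim i)
      with close[OF elim(1)] close[OF \<nu>] show ?case unfolding dist_real_def by linarith
    qed
  qed
  have tight: "(\<lambda>n. \<integral>q. cut (1 / real (Suc n)) (exp_neg q) \<partial>\<nu>) \<longlonglongrightarrow> (\<integral>q. 1 \<partial>\<nu>)"
  proof (rule integral_dominated_convergence[where w = "\<lambda>_. 1"])
    show "(\<lambda>q. cut (1 / real (Suc n)) (exp_neg q)) \<in> borel_measurable \<nu>" for n
      by (rule meas[OF _ \<nu>]) (auto intro!: continuous_on_compose2[OF cut_cont E_cont])
    show "AE q in \<nu>. (\<lambda>n. cut (1 / real (Suc n)) (exp_neg q)) \<longlonglongrightarrow> 1"
    proof (rule AE_I2)
      fix q
      obtain N where N: "1 / exp (- fst q) < real N" "1 / exp (- snd q) < real N"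
        using reals_Archimedean2[of "max (1 / exp (- fst q)) (1 / exp (- snd q))"] by auto
      have "cut (1 / real (Suc n)) (exp_neg q) = 1" if "n \<ge> N" for n
      proof -
        have "1 / exp (- fst q) < real (Suc n)" "1 / exp (- snd q) < real (Suc n)"
          using N that by linarith+
        then have "1 < real (Suc n) * exp (- fst q)" "1 < real (Suc n) * exp (- snd q)"
          unfolding pos_divide_less_eq[OF exp_gt_zero] .
        then have "1 < exp (- fst q) * real (Suc n)" "1 < exp (- snd q) * real (Suc n)"
          by (simp_all only: mult.commute)
        then show ?thesis by (simp add: cut_def exp_neg_def)
      qed
      then show "(\<lambda>n. cut (1 / real (Suc n)) (exp_neg q)) \<longlonglongrightarrow> 1"
        by (intro tendsto_eventually) (auto simp: eventually_sequentially)
    qed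
    show "AE q in \<nu>. norm (cut (1 / real (Suc n)) (exp_neg q)) \<le> 1" for n
      using cut01[of "1 / real (Suc n)", OF _ E_nonneg] by auto
  qed auto
  show ?thesis
    unfolding converges_weakly_def
  proof (intro conjI allI impI)
    show "prob_space \<nu>" "sets \<nu> = sets borel" using \<nu> by (auto simp: quadrant_law_def)
    fix f :: "real \<times> real \<Rightarrow> real" assume f: "continuous_on UNIV f \<and> bounded (range f)"
    then obtain B where B: "\<And>x. \<bar>f x\<bar> \<le> B" by (auto simp: bounded_iff)
    have B0: "0 \<le> B" using B[of undefined] by linarith
    show "((\<lambda>i. \<integral>x. f x \<partial>\<mu> i) \<longlongrightarrow> (\<integral>x. f x \<partial>\<nu>)) F"
    proof (rule tendstoI)
      fix e :: real assume e: "0 < e"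
      \<comment> \<open>Two remainders of at most \<open>B * e'\<close> and the difference of the truncated integrals add up to less than \<open>e\<close>.\<close>
      define e' where "e' = e / (3 * B + 2)"
      have e': "0 < e'" using e B0 by (auto simp: e'_def intro!: divide_pos_pos)
      have "(\<lambda>n. \<integral>q. cut (1 / real (Suc n)) (exp_neg q) \<partial>\<nu>) \<longlonglongrightarrow> 1" using tight by (simp add: \<nu>.prob_space)
      then have "\<forall>\<^sub>F n in sequentially. 1 - e' < (\<integral>q. cut (1 / real (Suc n)) (exp_neg q) \<partial>\<nu>)"
        using e' by (intro order_tendstoD(1)) auto
      then obtain n where n: "1 - e' < (\<integral>q. cut (1 / real (Suc n)) (exp_neg q) \<partial>\<nu>)"
        by (auto simp: eventually_sequentially)
      define \<delta> where "\<delta> = 1 / real (Suc n)"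
      have \<delta>: "0 < \<delta>" by (simp add: \<delta>_def)
      define c where "c q = cut \<delta> (exp_neg q)" for q
      have c01: "0 \<le> c q" "c q \<le> 1" for q using cut01[OF \<delta> E_nonneg] by (auto simp: c_def)
      have c_cont: "continuous_on UNIV c"
        unfolding c_def by (auto intro!: continuous_on_compose2[OF cut_cont[OF \<delta>] E_cont])
      have remainder: "\<bar>(\<integral>q. f q \<partial>\<rho>) - (\<integral>q. f q * c q \<partial>\<rho>)\<bar> \<le> B * (1 - (\<integral>q. c q \<partial>\<rho>))" if \<rho>: "quadrant_law \<rho>" for \<rho>
      proof -
        interpret prob_space \<rho> using \<rho> by (simp add: quadrant_law_def)
        have intc: "integrable \<rho> c" by (rule integ[OF c_cont _ \<rho>, of 1]) (use c01 in auto)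
        have intf: "integrable \<rho> f" by (rule integ[OF _ B \<rho>]) (use f in auto)
        have bnd: "\<bar>f q * c q\<bar> \<le> B" for q
          using mult_mono[OF B[of q] c01(2)[of q]] c01[of q] B0 by (simp add: abs_mult)
        have intfc: "integrable \<rho> (\<lambda>q. f q * c q)"
          by (rule integ[OF _ bnd \<rho>]) (use f c_cont in \<open>auto intro!: continuous_intros\<close>)
        have "\<bar>(\<integral>q. f q \<partial>\<rho>) - (\<integral>q. f q * c q \<partial>\<rho>)\<bar> = \<bar>\<integral>q. f q - f q * c q \<partial>\<rho>\<bar>"
          using intf intfc by simp
        also have "\<dots> \<le> (\<integral>q. \<bar>f q - f q * c q\<bar> \<partial>\<rho>)" by (rule integral_abs_bound)
        also have "\<dots> \<le> (\<integral>q. B * (1 - c q) \<partial>\<rho>)"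
        proof (rule integral_mono)
          fix q
          have "\<bar>f q - f q * c q\<bar> = \<bar>f q\<bar> * (1 - c q)"
          proof -
            have "f q - f q * c q = f q * (1 - c q)" by (simp add: algebra_simps)
            then show ?thesis using c01(2)[of q] by (simp add: abs_mult)
          qed
          also have "\<dots> \<le> B * (1 - c q)" using c01(2)[of q] by (intro mult_right_mono B) auto
          finally show "\<bar>f q - f q * c q\<bar> \<le> B * (1 - c q)" .
        qed (use intf intfc intc in auto)
        also have "\<dots> = B * (1 - (\<integral>q. c q \<partial>\<rho>))" using intc by (simp add: prob_space)
        finally show ?thesis .
      qed
      have lim1: "((\<lambda>i. \<integral>q. f q * c q \<partial>\<mu> i) \<longlongrightarrow> (\<integral>q. f q * c q \<partial>\<nu>)) F"
        unfolding c_def by (rule truncated[OF conjunct1[OF f] B \<delta>])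
      have lim2: "((\<lambda>i. \<integral>q. c q \<partial>\<mu> i) \<longlongrightarrow> (\<integral>q. c q \<partial>\<nu>)) F"
        using truncated[of "\<lambda>_. 1" 1 \<delta>] \<delta> unfolding c_def by simp
      have n': "1 - e' < (\<integral>q. c q \<partial>\<nu>)" using n unfolding c_def \<delta>_def .
      have "\<forall>\<^sub>F i in F. dist (\<integral>q. f q * c q \<partial>\<mu> i) (\<integral>q. f q * c q \<partial>\<nu>) < e'" using tendstoD[OF lim1 e'] .
      moreover have "\<forall>\<^sub>F i in F. 1 - e' < (\<integral>q. c q \<partial>\<mu> i)" using order_tendstoD(1)[OF lim2 n'] .
      ultimately show "\<forall>\<^sub>F i in F. dist (\<integral>x. f x \<partial>\<mu> i) (\<integral>x. f x \<partial>\<nu>) < e"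
        using \<mu>
      proof eventually_elim
        case (elim i)
        have 1: "B * (1 - (\<integral>q. c q \<partial>\<mu> i)) \<le> B * e'" using elim(2) B0 by (intro mult_left_mono) auto
        have 2: "B * (1 - (\<integral>q. c q \<partial>\<nu>)) \<le> B * e'" using n' B0 by (intro mult_left_mono) auto
        have "dist (\<integral>x. f x \<partial>\<mu> i) (\<integral>x. f x \<partial>\<nu>) < B * e' + B * e' + e'"
          using remainder[OF elim(3)] remainder[OF \<nu>] elim(1) 1 2 unfolding dist_real_def by linarith
        also have "\<dots> \<le> (3 * B + 2) * e'" using B0 e' by (simp add: algebra_simps)
        also have "\<dots> = e" using B0 by (simp add: e'_def)
        finally show ?case .
      qed
    qed
  qed
qed

section \<open>Net input as a Levy process\<close>

lemma increment_net_input: "increment (net_input J c) h i \<omega> = increment J h i \<omega> - c * h"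
  by (simp add: increment_def net_input_def algebra_simps)

lemma cadlag_linear:
  assumes "cadlag f"
  shows "cadlag (\<lambda>t. b * f t - c * t)"
  unfolding cadlag_def
proof (intro conjI allI impI)
  fix t :: real assume "0 \<le> t"
  then show "continuous (at_right t) (\<lambda>t. b * f t - c * t)"
    using assms by (auto simp: cadlag_def intro!: continuous_intros)
next
  fix t :: real assume "0 < t"
  then obtain l where "(f \<longlongrightarrow> l) (at_left t)" using assms by (auto simp: cadlag_def)
  then have "((\<lambda>t. b * f t - c * t) \<longlongrightarrow> b * l - c * t) (at_left t)" by (intro tendsto_intros)
  then show "\<exists>l. ((\<lambda>t. b * f t - c * t) \<longlongrightarrow> l) (at_left t)" by blast
qed

lemma (in square_integrable_levy) square_integrable_levy_net_input:
  "square_integrable_levy M (net_input J c)"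
proof unfold_locales
  fix t :: real assume "0 \<le> t"
  then have [measurable]: "J t \<in> borel_measurable M" by (rule measurable_at)
  show "random_variable borel (net_input J c t)" unfolding net_input_def[abs_def] by measurable
next
  show "AE \<omega> in M. net_input J c 0 \<omega> = 0" using start_zero by (simp add: net_input_def)
next
  fix \<tau> :: "nat \<Rightarrow> real" and n :: nat
  assume \<tau>: "0 \<le> \<tau> 0" "\<And>k. k < n \<Longrightarrow> \<tau> k \<le> \<tau> (Suc k)"
  have "indep_vars (\<lambda>_. borel) (\<lambda>k \<omega>. (J (\<tau> (Suc k)) \<omega> - J (\<tau> k) \<omega>) - c * (\<tau> (Suc k) - \<tau> k)) {..<n}"
    by (rule indep_vars_compose2[OF indep_increments[of \<tau> n], where Y = "\<lambda>k x. x - c * (\<tau> (Suc k) - \<tau> k)"])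
       (use \<tau> in auto)
  then show "indep_vars (\<lambda>_. borel) (\<lambda>k \<omega>. net_input J c (\<tau> (Suc k)) \<omega> - net_input J c (\<tau> k) \<omega>) {..<n}"
    by (simp add: net_input_def algebra_simps)
next
  fix s h :: real assume sh: "0 \<le> s" "0 \<le> h"
  have [measurable]: "J (s + h) \<in> borel_measurable M" "J (h + s) \<in> borel_measurable M" "J s \<in> borel_measurable M" "J h \<in> borel_measurable M"
    using sh by (auto intro: measurable_at)
  have "distr M borel (\<lambda>\<omega>. net_input J c (s + h) \<omega> - net_input J c s \<omega>)
      = distr (distr M borel (\<lambda>\<omega>. J (s + h) \<omega> - J s \<omega>)) borel (\<lambda>x. x - c * h)"
    by (subst distr_distr) (auto simp: net_input_def comp_def algebra_simps)
  also have "\<dots> = distr (distr M borel (J h)) borel (\<lambda>x. x - c * h)"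
    by (simp only: stationary_increments[OF sh])
  also have "\<dots> = distr M borel (net_input J c h)"
    by (subst distr_distr) (auto simp: net_input_def[abs_def] comp_def)
  finally show "distr M borel (\<lambda>\<omega>. net_input J c (s + h) \<omega> - net_input J c s \<omega>) = distr M borel (net_input J c h)" .
next
  show "AE \<omega> in M. cadlag (\<lambda>t. net_input J c t \<omega>)"
    using cadlag_paths
  proof eventually_elim
    case (elim \<omega>)
    show ?case using cadlag_linear[OF elim, of 1 c] by (simp add: net_input_def)
  qed
next
  show "AE \<omega> in M. \<forall>t>0. \<forall>l. ((\<lambda>s. net_input J c s \<omega>) \<longlongrightarrow> l) (at_left t) \<longrightarrow> l \<le> net_input J c t \<omega>"
    using no_negative_jumps
  proof eventually_elim
    case (elim \<omega>)
    show ?case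
    proof (intro allI impI)
      fix t l :: real assume t: "0 < t" and l: "((\<lambda>s. net_input J c s \<omega>) \<longlongrightarrow> l) (at_left t)"
      have "((\<lambda>s. net_input J c s \<omega> + c * s) \<longlongrightarrow> l + c * t) (at_left t)"
        by (intro tendsto_intros l)
      then have "((\<lambda>s. J s \<omega>) \<longlongrightarrow> l + c * t) (at_left t)" by (simp add: net_input_def)
      with elim t have "l + c * t \<le> J t \<omega>" by blast
      then show "l \<le> net_input J c t \<omega>" by (simp add: net_input_def)
    qed
  qed
next
  have "integrable M (\<lambda>\<omega>. (J 1 \<omega> + (- c))\<^sup>2)"
    by (rule integrable_add_square[OF _ _ square_integrable]) auto
  then show "integrable M (\<lambda>\<omega>. (net_input J c 1 \<omega>)\<^sup>2)" by (simp add: net_input_def)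
qed

lemma (in square_integrable_levy) integrable_J1: "integrable M (J 1)"
  by (rule integrable_of_square[OF measurable_J1 square_integrable])

lemma (in square_integrable_levy) expectation_net_input:
  "expectation (net_input J c 1) = expectation (J 1) - c"
  unfolding net_input_def[abs_def] using integrable_J1 by (simp add: prob_space)

lemma (in square_integrable_levy) negative_drift_levy_net_input:
  "expectation (J 1) < c \<Longrightarrow> negative_drift_levy M (net_input J c)"
  using square_integrable_levy_net_input[of c] expectation_net_input[of c]
  by (simp add: negative_drift_levy_def negative_drift_levy_axioms_def)

section \<open>Time reversal and the stationary law\<close>

text \<open>
  For \<open>t \<ge> 0\<close> these are, almost surely, the maximum of the path over \<open>[0, t]\<close> and the reflected process at
  time \<open>t\<close>; \<open>reflected\<close> takes the same steps as \<open>interval_max\<close>, in reversed order.  As limits along grids both are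
  measurable.
\<close>

definition interval_max :: "(real \<Rightarrow> 'a \<Rightarrow> real) \<Rightarrow> real \<Rightarrow> 'a \<Rightarrow> real" where
  "interval_max X t \<omega> = lim (\<lambda>n. wmax (2^n) (\<lambda>i. increment X (t / 2^n) i \<omega>))"

definition reflected :: "(real \<Rightarrow> 'a \<Rightarrow> real) \<Rightarrow> real \<Rightarrow> 'a \<Rightarrow> real" where
  "reflected X t \<omega> = lim (\<lambda>n. wmax (2^n) (\<lambda>i. increment X (t / 2^n) (2^n - Suc i) \<omega>))"

lemma sum_increment_reversed:
  assumes "j \<le> N"
  shows "(\<Sum>i<j. increment X h (N - Suc i) \<omega>) = X (h * real N) \<omega> - X (h * real (N - j)) \<omega>"
  using assms
proof (induction j)
  case (Suc j)
  then have "Suc (N - Suc j) = N - j" by simp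
  then have "increment X h (N - Suc j) \<omega> = X (h * real (N - j)) \<omega> - X (h * real (N - Suc j)) \<omega>"
    unfolding increment_def by simp
  with Suc show ?case by simp
qed simp

lemma wmax_increment_reversed:
  "wmax N (\<lambda>i. increment X h (N - Suc i) \<omega>) = (MAX k\<in>{..N}. X (h * real N) \<omega> - X (h * real k) \<omega>)"
proof -
  have "wmax N (\<lambda>i. increment X h (N - Suc i) \<omega>)
      = Max ((\<lambda>j. X (h * real N) \<omega> - X (h * real (N - j)) \<omega>) ` {..N})"
    unfolding wmax_eq_Max by (intro arg_cong[where f = Max] image_cong) (auto simp: sum_increment_reversed)
  also have "(\<lambda>j. X (h * real N) \<omega> - X (h * real (N - j)) \<omega>) ` {..N} = (\<lambda>k. X (h * real N) \<omega> - X (h * real k) \<omega>) ` (\<lambda>j. N - j) ` {..N}"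
    by (simp add: image_image)
  also have "(\<lambda>j. N - j) ` {..N} = {..N}"
  proof (intro equalityI subsetI)
    fix x assume "x \<in> {..N}"
    then have "x = N - (N - x)" "N - x \<in> {..N}" by auto
    then show "x \<in> (\<lambda>j. N - j) ` {..N}" by (rule image_eqI)
  qed auto
  finally show ?thesis .
qed

context square_integrable_levy
begin

lemma measurable_wmax_increment [measurable]:
  "0 \<le> h \<Longrightarrow> (\<lambda>\<omega>. wmax k (\<lambda>i. incr h i \<omega>)) \<in> borel_measurable M"
  "0 \<le> h \<Longrightarrow> (\<lambda>\<omega>. wmax k (\<lambda>i. incr h (N - Suc i) \<omega>)) \<in> borel_measurable M"
  by (intro borel_measurable_wmax measurable_incr; assumption)+

lemma measurable_interval_max: "0 \<le> t \<Longrightarrow> interval_max J t \<in> borel_measurable M"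
  and measurable_reflected: "0 \<le> t \<Longrightarrow> reflected J t \<in> borel_measurable M"
  unfolding interval_max_def[abs_def] reflected_def[abs_def]
  by (intro borel_measurable_lim_metric measurable_wmax_increment; simp)+

lemma AE_interval_max:
  assumes t: "0 \<le> t"
  shows "AE \<omega> in M. (\<lambda>n. wmax (2^n) (\<lambda>i. incr (t / 2^n) i \<omega>)) \<longlonglongrightarrow> interval_max J t \<omega> \<and>
    interval_max J t \<omega> = (SUP s\<in>{0..t}. J s \<omega>)"
  using start_zero cadlag_paths
proof eventually_elim
  case (elim \<omega>)
  have "(\<lambda>n. wmax (2^n) (\<lambda>i. incr (t / 2^n) i \<omega>)) \<longlonglongrightarrow> (SUP s\<in>{0..t}. J s \<omega>)"
    using SUP_grid_interval[OF elim(2) t] elim(1) by (simp add: wmax_increment)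
  then show ?case by (simp add: interval_max_def limI)
qed

lemma AE_reflected:
  assumes t: "0 \<le> t"
  shows "AE \<omega> in M. (\<lambda>n. wmax (2^n) (\<lambda>i. incr (t / 2^n) (2^n - Suc i) \<omega>)) \<longlonglongrightarrow> reflected J t \<omega> \<and>
    reflected J t \<omega> = J t \<omega> - (INF s\<in>{0..t}. J s \<omega>)"
  using cadlag_paths
proof eventually_elim
  case (elim \<omega>)
  have cad: "cadlag (\<lambda>s. - J s \<omega>)" using cadlag_linear[OF elim, of "- 1" 0] by simp
  have Max_eq: "(MAX k\<in>{..N}. J t \<omega> - J (x k) \<omega>) = (MAX k\<in>{..N}. - J (x k) \<omega>) + J t \<omega>"
    for x and N :: nat
    using Max_add_commute[of "{..N}" "\<lambda>k. - J (x k) \<omega>" "J t \<omega>"] by simp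
  have "(\<lambda>n. (MAX k\<in>{..2^n}. - J (t * (real k / 2^n)) \<omega>) + J t \<omega>) \<longlonglongrightarrow> (SUP s\<in>{0..t}. - J s \<omega>) + J t \<omega>"
    using SUP_grid_interval[OF cad t] by (intro tendsto_intros) simp
  then have "(\<lambda>n. wmax (2^n) (\<lambda>i. incr (t / 2^n) (2^n - Suc i) \<omega>)) \<longlonglongrightarrow> (SUP s\<in>{0..t}. - J s \<omega>) + J t \<omega>"
    by (simp add: wmax_increment_reversed Max_eq)
  moreover have "(INF s\<in>{0..t}. J s \<omega>) = - (SUP s\<in>{0..t}. - J s \<omega>)"
    by (simp add: Inf_real_def image_image)
  ultimately show ?case by (simp add: reflected_def limI)
qed

text \<open>
  Both walks are functionals of the same increments of \<open>J\<close>, so reversing the increments preserves the joint law.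
\<close>

lemma reversal_law:
  fixes c1 c2 h :: real
  assumes h: "0 \<le> h"
  shows "distr M borel (\<lambda>\<omega>. (wmax N (\<lambda>i. increment (net_input J c1) h (N - Suc i) \<omega>),
                wmax N (\<lambda>i. increment (net_input J c2) h (N - Suc i) \<omega>)))
    = distr M borel (\<lambda>\<omega>. (wmax N (\<lambda>i. increment (net_input J c1) h i \<omega>),
                wmax N (\<lambda>i. increment (net_input J c2) h i \<omega>)))"
proof -
  define F where "F x = (wmax N (\<lambda>i. x i - c1 * h), wmax N (\<lambda>i. x i - c2 * h))" for x
  have F: "F \<in> measurable (PiM {..<N} (\<lambda>_. borel)) borel"
    unfolding F_def borel_prod[symmetric] by (intro measurable_Pair wmax_measurable_PiM order_refl)
  have D: "iid (distr M borel (J h)) (incr h) N" by (rule iid_incr[OF h])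
  have D': "iid (distr M borel (J h)) (\<lambda>i. incr h (N - Suc i)) N"
    by (rule iid_reindex[OF D]) (auto simp: inj_on_def)
  have F_restrict: "F (\<lambda>i\<in>{..<N}. E i \<omega>) = (wmax N (\<lambda>i. E i \<omega> - c1 * h), wmax N (\<lambda>i. E i \<omega> - c2 * h))"
    for E :: "nat \<Rightarrow> 'a \<Rightarrow> real" and \<omega>
    unfolding F_def by (auto intro!: wmax_cong)
  from iid_functional_distr[OF D' D F] show ?thesis
    unfolding F_restrict[of "\<lambda>i. incr h (N - Suc i)"] F_restrict[of "incr h"] increment_net_input .
qed

text \<open>
  The workloads are defined through infima over uncountably many times; they agree almost surely with measurable functions
  and are therefore measurable for the completion.
\<close>

lemma workload_law_eq:
  assumes t: "0 \<le> t"
  shows "workload_law M J c1 c2 t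
    = distr M borel (\<lambda>\<omega>. (reflected (net_input J c1) t \<omega>,
        reflected (net_input J c2) t \<omega> - reflected (net_input J c1) t \<omega>))"
proof -
  interpret N1: square_integrable_levy M "net_input J c1" by (rule square_integrable_levy_net_input)
  interpret N2: square_integrable_levy M "net_input J c2" by (rule square_integrable_levy_net_input)
  let ?pair = "\<lambda>\<omega>. (upstream J c1 t \<omega>, downstream J c1 c2 t \<omega>)"
  let ?g = "\<lambda>\<omega>. (reflected (net_input J c1) t \<omega>,
        reflected (net_input J c2) t \<omega> - reflected (net_input J c1) t \<omega>)"
  have [measurable]: "reflected (net_input J c1) t \<in> borel_measurable M" "reflected (net_input J c2) t \<in> borel_measurable M"
    using N1.measurable_reflected N2.measurable_reflected t by auto
  have g: "?g \<in> borel_measurable M" by measurable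
  have "AE \<omega> in M. ?pair \<omega> = ?g \<omega>"
    using N1.AE_reflected[OF t] N2.AE_reflected[OF t]
    by eventually_elim (simp add: upstream_def downstream_def regulator_def)
  then have ae: "AE \<omega> in completion M. ?pair \<omega> = ?g \<omega>" by (rule AE_completion)
  have pair: "?pair \<in> borel_measurable (completion M)"
  proof (rule measurableI)
    fix A :: "(real \<times> real) set" assume A: "A \<in> sets borel"
    show "?pair -` A \<inter> space (completion M) \<in> sets (completion M)"
    proof (rule completion.in_sets_AE)
      show "?g -` A \<inter> space (completion M) \<in> sets (completion M)"
        using measurable_sets[OF measurable_completion[OF g] A] .
      show "AE \<omega> in completion M. \<omega> \<in> ?g -` A \<inter> space (completion M) \<longleftrightarrow> \<omega> \<in> ?pair -` A \<inter> space (completion M)"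
        using ae by eventually_elim simp
    qed auto
  qed simp
  have "workload_law M J c1 c2 t = distr (completion M) borel ?g"
    unfolding workload_law_def
    by (rule distr_cong_AE[OF refl refl ae pair measurable_completion[OF g]])
  then show ?thesis using distr_completion[OF g] by simp
qed

lemma integral_workload_law:
  assumes t: "0 \<le> t" and f: "continuous_on UNIV f" "bounded (range (f :: real \<times> real \<Rightarrow> real))"
  shows "(\<integral>x. f x \<partial>workload_law M J c1 c2 t)
    = expectation (\<lambda>\<omega>. f (interval_max (net_input J c1) t \<omega>,
        interval_max (net_input J c2) t \<omega> - interval_max (net_input J c1) t \<omega>))"
proof -
  interpret N1: square_integrable_levy M "net_input J c1" by (rule square_integrable_levy_net_input)
  interpret N2: square_integrable_levy M "net_input J c2" by (rule square_integrable_levy_net_input)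
  obtain B where B: "\<And>x. \<bar>f x\<bar> \<le> B" using f(2) by (auto simp: bounded_iff)
  have f_meas [measurable]: "f \<in> borel_measurable borel" using f(1) by (rule borel_measurable_continuous_onI)
  have f_lim: "(\<lambda>n. f (a n, b n - a n)) \<longlonglongrightarrow> f (a', b' - a')"
    if "a \<longlonglongrightarrow> a'" "b \<longlonglongrightarrow> b'" for a b :: "nat \<Rightarrow> real" and a' b'
  proof -
    have "isCont f (a', b' - a')" using f(1) by (simp add: continuous_on_eq_continuous_at)
    then show ?thesis by (rule isCont_tendsto_compose) (intro tendsto_intros that)
  qed
  note [measurable] = N1.measurable_reflected[OF t] N2.measurable_reflected[OF t]
    N1.measurable_interval_max[OF t] N2.measurable_interval_max[OF t]
  define R where "R c n \<omega> = wmax (2^n) (\<lambda>i. increment (net_input J c) (t / 2^n) (2^n - Suc i) \<omega>)" for c n \<omega>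
  define I where "I c n \<omega> = wmax (2^n) (\<lambda>i. increment (net_input J c) (t / 2^n) i \<omega>)" for c n \<omega>
  have h: "0 \<le> t / 2^n" for n :: nat using t by simp
  have [measurable]: "R c1 n \<in> borel_measurable M" "R c2 n \<in> borel_measurable M"
    "I c1 n \<in> borel_measurable M" "I c2 n \<in> borel_measurable M" for n
    unfolding R_def[abs_def] I_def[abs_def]
    using N1.measurable_wmax_increment[OF h] N2.measurable_wmax_increment[OF h] by auto
  have same: "expectation (\<lambda>\<omega>. f (R c1 n \<omega>, R c2 n \<omega> - R c1 n \<omega>)) = expectation (\<lambda>\<omega>. f (I c1 n \<omega>, I c2 n \<omega> - I c1 n \<omega>))" for n
  proof -
    let ?k = "\<lambda>p. f (fst p, snd p - fst p)"
    have [measurable]: "?k \<in> borel_measurable borel"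
      by (intro borel_measurable_continuous_onI continuous_on_compose2[OF f(1)] continuous_intros) auto
    have "expectation (\<lambda>\<omega>. f (R c1 n \<omega>, R c2 n \<omega> - R c1 n \<omega>)) = (\<integral>p. ?k p \<partial>distr M borel (\<lambda>\<omega>. (R c1 n \<omega>, R c2 n \<omega>)))"
      by (subst integral_distr) auto
    also have "\<dots> = (\<integral>p. ?k p \<partial>distr M borel (\<lambda>\<omega>. (I c1 n \<omega>, I c2 n \<omega>)))"
      unfolding R_def I_def by (subst reversal_law[OF h]) simp
    also have "\<dots> = expectation (\<lambda>\<omega>. f (I c1 n \<omega>, I c2 n \<omega> - I c1 n \<omega>))"
      by (subst integral_distr) auto
    finally show ?thesis .
  qed
  have limR: "(\<lambda>n. expectation (\<lambda>\<omega>. f (R c1 n \<omega>, R c2 n \<omega> - R c1 n \<omega>)))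
     \<longlonglongrightarrow> expectation (\<lambda>\<omega>. f (reflected (net_input J c1) t \<omega>, reflected (net_input J c2) t \<omega> - reflected (net_input J c1) t \<omega>))"
  proof (rule integral_dominated_convergence[where w = "\<lambda>_. B"])
    show "AE \<omega> in M. (\<lambda>n. f (R c1 n \<omega>, R c2 n \<omega> - R c1 n \<omega>))
       \<longlonglongrightarrow> f (reflected (net_input J c1) t \<omega>, reflected (net_input J c2) t \<omega> - reflected (net_input J c1) t \<omega>)"
      using N1.AE_reflected[OF t] N2.AE_reflected[OF t]
      by eventually_elim (auto simp: R_def intro!: f_lim)
  qed (use B in auto)
  have limI: "(\<lambda>n. expectation (\<lambda>\<omega>. f (I c1 n \<omega>, I c2 n \<omega> - I c1 n \<omega>)))
     \<longlonglongrightarrow> expectation (\<lambda>\<omega>. f (interval_max (net_input J c1) t \<omega>, interval_max (net_input J c2) t \<omega> - interval_max (net_input J c1) t \<omega>))"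
  proof (rule integral_dominated_convergence[where w = "\<lambda>_. B"])
    show "AE \<omega> in M. (\<lambda>n. f (I c1 n \<omega>, I c2 n \<omega> - I c1 n \<omega>))
       \<longlonglongrightarrow> f (interval_max (net_input J c1) t \<omega>, interval_max (net_input J c2) t \<omega> - interval_max (net_input J c1) t \<omega>)"
      using N1.AE_interval_max[OF t] N2.AE_interval_max[OF t]
      by eventually_elim (auto simp: I_def intro!: f_lim)
  qed (use B in auto)
  have "(\<integral>x. f x \<partial>workload_law M J c1 c2 t)
      = expectation (\<lambda>\<omega>. f (reflected (net_input J c1) t \<omega>, reflected (net_input J c2) t \<omega> - reflected (net_input J c1) t \<omega>))"
    unfolding workload_law_eq[OF t] by (subst integral_distr) auto
  also have "\<dots> = expectation (\<lambda>\<omega>. f (interval_max (net_input J c1) t \<omega>, interval_max (net_input J c2) t \<omega> - interval_max (net_input J c1) t \<omega>))"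
    using LIMSEQ_unique[OF limR] limI unfolding same by blast
  finally show ?thesis .
qed

definition stationary_law :: "real \<Rightarrow> real \<Rightarrow> (real \<times> real) measure" where
  "stationary_law c1 c2 = distr M borel (\<lambda>\<omega>. (all_time_max (net_input J c1) \<omega>,
      all_time_max (net_input J c2) \<omega> - all_time_max (net_input J c1) \<omega>))"

lemma measurable_all_time_max_net_input [measurable]: "all_time_max (net_input J c) \<in> borel_measurable M"
proof -
  interpret N1: square_integrable_levy M "net_input J c" by (rule square_integrable_levy_net_input)
  show ?thesis by measurable
qed

lemma workload_law_converges:
  assumes c1: "expectation (J 1) < c1" and c2: "expectation (J 1) < c2"
  shows "converges_weakly (workload_law M J c1 c2) (stationary_law c1 c2) at_top"
  unfolding converges_weakly_def
proof (intro conjI allI impI)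
  interpret N1: negative_drift_levy M "net_input J c1" by (rule negative_drift_levy_net_input[OF c1])
  interpret N2: negative_drift_levy M "net_input J c2" by (rule negative_drift_levy_net_input[OF c2])
  let ?S = "\<lambda>\<omega>. (all_time_max (net_input J c1) \<omega>, all_time_max (net_input J c2) \<omega> - all_time_max (net_input J c1) \<omega>)"
  show "prob_space (stationary_law c1 c2)" unfolding stationary_law_def by (rule prob_space_distr) measurable
  show "sets (stationary_law c1 c2) = sets borel" by (simp add: stationary_law_def)
  fix f :: "real \<times> real \<Rightarrow> real" assume f: "continuous_on UNIV f \<and> bounded (range f)"
  obtain B where B: "\<And>x. \<bar>f x\<bar> \<le> B" using f by (auto simp: bounded_iff)
  have f_meas [measurable]: "f \<in> borel_measurable borel" using f by (auto intro: borel_measurable_continuous_onI)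
  let ?I = "\<lambda>c t. interval_max (net_input J c) (max 0 t)"
  have [measurable]: "?I c1 t \<in> borel_measurable M" "?I c2 t \<in> borel_measurable M" for t
    by (auto intro: N1.measurable_interval_max N2.measurable_interval_max)
  have "((\<lambda>t. expectation (\<lambda>\<omega>. f (?I c1 t \<omega>, ?I c2 t \<omega> - ?I c1 t \<omega>))) \<longlongrightarrow> expectation (\<lambda>\<omega>. f (?S \<omega>))) at_top"
  proof (rule tendsto_at_topI_sequentially)
    fix X :: "nat \<Rightarrow> real" assume X: "filterlim X at_top sequentially"
    \<comment> \<open>\<open>max 0\<close> keeps the integrands measurable at negative indices.\<close>
    have Xmax: "filterlim (\<lambda>n. max 0 (X n)) at_top sequentially"
      by (rule filterlim_at_top_mono[OF X]) simp
    have ae: "AE \<omega> in M. \<forall>n. ?I c1 (X n) \<omega> = (SUP s\<in>{0..max 0 (X n)}. net_input J c1 s \<omega>)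
        \<and> ?I c2 (X n) \<omega> = (SUP s\<in>{0..max 0 (X n)}. net_input J c2 s \<omega>)"
      unfolding AE_all_countable
    proof
      fix n
      have "0 \<le> max 0 (X n)" by simp
      from N1.AE_interval_max[OF this] N2.AE_interval_max[OF this]
      show "AE \<omega> in M. ?I c1 (X n) \<omega> = (SUP s\<in>{0..max 0 (X n)}. net_input J c1 s \<omega>)
        \<and> ?I c2 (X n) \<omega> = (SUP s\<in>{0..max 0 (X n)}. net_input J c2 s \<omega>)"
        by eventually_elim simp
    qed
    show "(\<lambda>n. expectation (\<lambda>\<omega>. f (?I c1 (X n) \<omega>, ?I c2 (X n) \<omega> - ?I c1 (X n) \<omega>))) \<longlonglongrightarrow> expectation (\<lambda>\<omega>. f (?S \<omega>))"
    proof (rule integral_dominated_convergence[where w = "\<lambda>_. B"])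
      show "AE \<omega> in M. (\<lambda>n. f (?I c1 (X n) \<omega>, ?I c2 (X n) \<omega> - ?I c1 (X n) \<omega>)) \<longlonglongrightarrow> f (?S \<omega>)"
        using ae N1.AE_all_time_max N2.AE_all_time_max
      proof eventually_elim
        case (elim \<omega>)
        have "((\<lambda>t. SUP s\<in>{0..t}. net_input J c1 s \<omega>) \<longlongrightarrow> all_time_max (net_input J c1) \<omega>) at_top"
          using SUP_interval_tendsto[of "\<lambda>s. net_input J c1 s \<omega>"] elim(2) by metis
        from filterlim_compose[OF this Xmax] have 1: "(\<lambda>n. ?I c1 (X n) \<omega>) \<longlonglongrightarrow> all_time_max (net_input J c1) \<omega>"
          using elim(1) by simp
        have "((\<lambda>t. SUP s\<in>{0..t}. net_input J c2 s \<omega>) \<longlongrightarrow> all_time_max (net_input J c2) \<omega>) at_top"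
          using SUP_interval_tendsto[of "\<lambda>s. net_input J c2 s \<omega>"] elim(3) by metis
        from filterlim_compose[OF this Xmax] have 2: "(\<lambda>n. ?I c2 (X n) \<omega>) \<longlonglongrightarrow> all_time_max (net_input J c2) \<omega>"
          using elim(1) by simp
        have "isCont f (?S \<omega>)" using f by (simp add: continuous_on_eq_continuous_at)
        then show ?case by (rule isCont_tendsto_compose) (intro tendsto_intros 1 2)
      qed
    qed (use B in auto)
  qed
  then have "((\<lambda>t. \<integral>x. f x \<partial>workload_law M J c1 c2 t) \<longlongrightarrow> expectation (\<lambda>\<omega>. f (?S \<omega>))) at_top"
  proof (rule Lim_transform_eventually)
    show "\<forall>\<^sub>F t in at_top. expectation (\<lambda>\<omega>. f (?I c1 t \<omega>, ?I c2 t \<omega> - ?I c1 t \<omega>)) = (\<integral>x. f x \<partial>workload_law M J c1 c2 t)"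
      using eventually_ge_at_top[of 0]
      by eventually_elim (use f in \<open>simp add: integral_workload_law max_absorb2\<close>)
  qed
  also have "expectation (\<lambda>\<omega>. f (?S \<omega>)) = (\<integral>x. f x \<partial>stationary_law c1 c2)"
    unfolding stationary_law_def by (subst integral_distr) auto
  finally show "((\<lambda>t. \<integral>x. f x \<partial>workload_law M J c1 c2 t) \<longlongrightarrow> (\<integral>x. f x \<partial>stationary_law c1 c2)) at_top" .
qed

lemma steady_state_law_eq:
  assumes "expectation (J 1) < c1" "expectation (J 1) < c2"
  shows "steady_state_law M J c1 c2 = stationary_law c1 c2"
  unfolding steady_state_law_def
proof (rule the_equality)
  show lim: "converges_weakly (workload_law M J c1 c2) (stationary_law c1 c2) at_top"
    by (rule workload_law_converges[OF assms])
  fix \<pi> assume "converges_weakly (workload_law M J c1 c2) \<pi> at_top"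
  then show "\<pi> = stationary_law c1 c2" by (rule converges_weakly_unique[OF _ lim]) simp
qed

end

section \<open>Heavy traffic for a single queue\<close>

context square_integrable_levy
begin

definition centred_exponent :: "real \<Rightarrow> real" where
  "centred_exponent u = ln (expectation (\<lambda>\<omega>. exp (- u * (J 1 \<omega> - expectation (J 1)))))"

lemma integrable_exp_shift: "0 \<le> u \<Longrightarrow> integrable M (\<lambda>\<omega>. exp (- u * (J 1 \<omega> - c)))"
proof -
  assume u: "0 \<le> u"
  have int: "integrable M (\<lambda>\<omega>. exp (u * c) * exp (- u * J 1 \<omega>))" using integrable_exp_J1[OF u] by simp
  have eq: "exp (u * c) * exp (- u * J 1 \<omega>) = exp (- u * (J 1 \<omega> - c))" for \<omega>
    by (simp add: algebra_simps flip: exp_add)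
  show ?thesis using int unfolding eq .
qed

text \<open>
  Separates the drift \<open>- c\<close> of the net input from the part of the exponent that does not depend on the service rate.
\<close>

lemma ln_laplace_net_input:
  assumes u: "0 \<le> u"
  shows "ln (expectation (\<lambda>\<omega>. exp (- u * net_input J (expectation (J 1) + c) 1 \<omega>))) = u * c + centred_exponent u"
proof -
  have "exp (- u * net_input J (expectation (J 1) + c) 1 \<omega>) = exp (u * c) * exp (- u * (J 1 \<omega> - expectation (J 1)))" for \<omega>
    by (simp add: net_input_def algebra_simps flip: exp_add)
  then have "expectation (\<lambda>\<omega>. exp (- u * net_input J (expectation (J 1) + c) 1 \<omega>))
      = exp (u * c) * expectation (\<lambda>\<omega>. exp (- u * (J 1 \<omega> - expectation (J 1))))" by simp
  then show ?thesis
    using expectation_exp_pos[OF integrable_exp_shift[OF u, of "expectation (J 1)"]]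
    by (simp add: ln_mult centred_exponent_def)
qed

lemma centred_exponent_second_order:
  "((\<lambda>u. centred_exponent u / u\<^sup>2) \<longlongrightarrow> variance (J 1) / 2) (at_right 0)"
  unfolding centred_exponent_def
proof (rule ln_laplace_second_order)
  have "integrable M (\<lambda>\<omega>. (J 1 \<omega> + (- expectation (J 1)))\<^sup>2)"
    by (rule integrable_add_square[OF _ _ square_integrable]) auto
  then show "integrable M (\<lambda>\<omega>. (J 1 \<omega> - expectation (J 1))\<^sup>2)" by simp
qed (use integrable_J1 integrable_exp_shift in \<open>auto simp: prob_space\<close>)

lemma right_deriv_laplace_exponent:
  "right_deriv (laplace_exponent M J (expectation (J 1) + c)) 0 = c"
proof -
  let ?\<phi> = "laplace_exponent M J (expectation (J 1) + c)"
  have \<phi>0: "?\<phi> 0 = 0" by (simp add: laplace_exponent_def prob_space)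
  have "((\<lambda>u. c + u * (centred_exponent u / u\<^sup>2)) \<longlongrightarrow> c + 0 * (variance (J 1) / 2)) (at_right 0)"
    by (intro tendsto_intros centred_exponent_second_order)
  then have "((\<lambda>u. c + u * (centred_exponent u / u\<^sup>2)) \<longlongrightarrow> c) (at_right 0)" by simp
  then have lim: "((\<lambda>u. (?\<phi> u - ?\<phi> 0) / (u - 0)) \<longlongrightarrow> c) (at_right 0)"
  proof (rule Lim_transform_eventually)
    have "\<forall>\<^sub>F u in at_right (0::real). 0 < u" by (simp add: eventually_at_right_less)
    then show "\<forall>\<^sub>F u in at_right 0. c + u * (centred_exponent u / u\<^sup>2) = (?\<phi> u - ?\<phi> 0) / (u - 0)"
    proof eventually_elim
      case (elim u)
      then have "?\<phi> u = u * c + centred_exponent u"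
        unfolding laplace_exponent_def by (intro ln_laplace_net_input) simp
      then have "(?\<phi> u - ?\<phi> 0) / (u - 0) = (u * c + centred_exponent u) / u" unfolding \<phi>0 by simp
      with elim show ?case by (simp add: field_simps power2_eq_square)
    qed
  qed
  show ?thesis
    unfolding right_deriv_def
  proof (rule the_equality)
    show "(?\<phi> has_real_derivative c) (at_right 0)"
      using lim by (simp add: has_field_derivative_iff)
    fix d assume "(?\<phi> has_real_derivative d) (at_right 0)"
    then have "((\<lambda>u. (?\<phi> u - ?\<phi> 0) / (u - 0)) \<longlongrightarrow> d) (at_right 0)"
      by (simp add: has_field_derivative_iff)
    from tendsto_unique[OF _ this lim] show "d = c" by simp
  qed
qed

text \<open>
  At the argument \<open>u = l * \<epsilon>\<close> the Pollaczek-Khinchine formula reads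
  \<open>u * \<epsilon> / (u * \<epsilon> + centred_exponent u) = 1 / (1 + l * (centred_exponent u / u^2))\<close>.
\<close>

lemma heavy_traffic_marginal:
  assumes l: "0 \<le> l"
  shows "((\<lambda>\<epsilon>. expectation (\<lambda>\<omega>. exp (- (l * \<epsilon>) * all_time_max (net_input J (expectation (J 1) + \<epsilon>)) \<omega>)))
    \<longlongrightarrow> 1 / (1 + l * (variance (J 1) / 2))) (at_right 0)"
proof (cases "l = 0")
  case True
  then show ?thesis by (simp add: prob_space)
next
  case False
  with l have l0: "0 < l" by simp
  have var: "0 \<le> variance (J 1)" by simp
  have scale: "filterlim (\<lambda>\<epsilon>. l * \<epsilon>) (at_right 0) (at_right 0)"
    unfolding filterlim_at
  proof (intro conjI)
    have "((\<lambda>\<epsilon>. l * \<epsilon>) \<longlongrightarrow> l * 0) (at_right 0)" by (intro tendsto_intros)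
    then show "((\<lambda>\<epsilon>. l * \<epsilon>) \<longlongrightarrow> 0) (at_right 0)" by simp
    have "\<forall>\<^sub>F \<epsilon> in at_right (0::real). 0 < \<epsilon>" by (simp add: eventually_at_right_less)
    then show "\<forall>\<^sub>F \<epsilon> in at_right 0. l * \<epsilon> \<in> {0<..} \<and> l * \<epsilon> \<noteq> 0"
      by eventually_elim (use l0 in auto)
  qed
  have "((\<lambda>\<epsilon>. 1 / (1 + l * (centred_exponent (l * \<epsilon>) / (l * \<epsilon>)\<^sup>2))) \<longlongrightarrow> 1 / (1 + l * (variance (J 1) / 2))) (at_right 0)"
  proof (rule tendsto_divide[OF tendsto_const tendsto_add[OF tendsto_const tendsto_mult[OF tendsto_const
        filterlim_compose[OF centred_exponent_second_order scale]]]])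
    have "0 \<le> l * (variance (J 1) / 2)" using var l0 by simp
    then show "1 + l * (variance (J 1) / 2) \<noteq> 0" by linarith
  qed
  then show ?thesis
  proof (rule Lim_transform_eventually)
    have "\<forall>\<^sub>F \<epsilon> in at_right (0::real). 0 < \<epsilon>" by (simp add: eventually_at_right_less)
    then show "\<forall>\<^sub>F \<epsilon> in at_right 0. 1 / (1 + l * (centred_exponent (l * \<epsilon>) / (l * \<epsilon>)\<^sup>2))
        = expectation (\<lambda>\<omega>. exp (- (l * \<epsilon>) * all_time_max (net_input J (expectation (J 1) + \<epsilon>)) \<omega>))"
    proof eventually_elim
      case (elim \<epsilon>)
      interpret N: negative_drift_levy M "net_input J (expectation (J 1) + \<epsilon>)"
        by (rule negative_drift_levy_net_input) (use elim in simp)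
      let ?E = "expectation (\<lambda>\<omega>. exp (- (l * \<epsilon>) * all_time_max (net_input J (expectation (J 1) + \<epsilon>)) \<omega>))"
      have le: "0 < l * \<epsilon>" using elim l0 by simp
      have "?E * (l * \<epsilon> * \<epsilon> + centred_exponent (l * \<epsilon>)) = l * \<epsilon> * \<epsilon>"
        using N.pollaczek_khinchine[OF le] le
        by (simp only: ln_laplace_net_input expectation_net_input less_imp_le) simp
      moreover from this have "l * \<epsilon> * \<epsilon> + centred_exponent (l * \<epsilon>) \<noteq> 0" using le elim by auto
      ultimately have "?E = l * \<epsilon> * \<epsilon> / (l * \<epsilon> * \<epsilon> + centred_exponent (l * \<epsilon>))"
        by (simp add: field_simps)
      also have "\<dots> = 1 / (1 + l * (centred_exponent (l * \<epsilon>) / (l * \<epsilon>)\<^sup>2))"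
      proof -
        have "1 + l * (centred_exponent (l * \<epsilon>) / (l * \<epsilon>)\<^sup>2) = (l * \<epsilon> * \<epsilon> + centred_exponent (l * \<epsilon>)) / (l * \<epsilon> * \<epsilon>)"
          using l0 elim by (simp add: field_simps power2_eq_square)
        then show ?thesis by simp
      qed
      finally show ?case by simp
    qed
  qed
qed

end

section \<open>Asymptotic independence\<close>

lemma tendsto_at_right_shift:
  fixes T t :: real
  shows "(f \<longlongrightarrow> l) (at_right (T + t)) \<longleftrightarrow> ((\<lambda>s. f (T + s)) \<longlongrightarrow> l) (at_right t)"
proof -
  have "at_right (T + t) = filtermap (\<lambda>s. T + s) (at_right t)"
    using filtermap_at_right_shift[of "- T" t] by (simp add: add.commute)
  then show ?thesis by (simp add: filterlim_filtermap)
qed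

lemma filtermap_at_left_shift: "filtermap (\<lambda>x. x - d) (at_left a) = at_left (a - d)"
  for a d :: "real"
  by (simp add: filter_eq_iff eventually_filtermap eventually_at_filter filtermap_nhds_shift[symmetric])

lemma tendsto_at_left_shift:
  fixes T t :: real
  shows "(f \<longlongrightarrow> l) (at_left (T + t)) \<longleftrightarrow> ((\<lambda>s. f (T + s)) \<longlongrightarrow> l) (at_left t)"
proof -
  have "at_left (T + t) = filtermap (\<lambda>s. T + s) (at_left t)"
    using filtermap_at_left_shift[of "- T" t] by (simp add: add.commute)
  then show ?thesis by (simp add: filterlim_filtermap)
qed

context square_integrable_levy
begin

text \<open>
  The process restarted at time \<open>T\<close> is again a Levy process with the same moments, so all results on all-time maxima apply to it.
\<close>

definition shifted :: "real \<Rightarrow> real \<Rightarrow> 'a \<Rightarrow> real" where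
  "shifted T t \<omega> = J (T + t) \<omega> - J T \<omega>"

lemma distr_shifted: "0 \<le> T \<Longrightarrow> 0 \<le> t \<Longrightarrow> distr M borel (shifted T t) = distr M borel (J t)"
  unfolding shifted_def[abs_def] by (rule stationary_increments)

lemma square_integrable_levy_shifted:
  assumes T: "0 \<le> T"
  shows "square_integrable_levy M (shifted T)"
proof unfold_locales
  fix t :: real assume "0 \<le> t"
  with T have [measurable]: "J (T + t) \<in> borel_measurable M" "J T \<in> borel_measurable M"
    by (auto intro: measurable_at)
  show "random_variable borel (shifted T t)" unfolding shifted_def[abs_def] by measurable
next
  show "AE \<omega> in M. shifted T 0 \<omega> = 0" by (simp add: shifted_def)
next
  fix \<tau> :: "nat \<Rightarrow> real" and n :: nat
  assume \<tau>: "0 \<le> \<tau> 0" "\<And>k. k < n \<Longrightarrow> \<tau> k \<le> \<tau> (Suc k)"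
  have "indep_vars (\<lambda>_. borel) (\<lambda>k \<omega>. J (T + \<tau> (Suc k)) \<omega> - J (T + \<tau> k) \<omega>) {..<n}"
    by (rule indep_increments[where \<tau> = "\<lambda>k. T + \<tau> k"]) (use T \<tau> in auto)
  then show "indep_vars (\<lambda>_. borel) (\<lambda>k \<omega>. shifted T (\<tau> (Suc k)) \<omega> - shifted T (\<tau> k) \<omega>) {..<n}"
    by (simp add: shifted_def)
next
  fix s h :: real assume sh: "0 \<le> s" "0 \<le> h"
  have "distr M borel (\<lambda>\<omega>. shifted T (s + h) \<omega> - shifted T s \<omega>) = distr M borel (\<lambda>\<omega>. J (T + s + h) \<omega> - J (T + s) \<omega>)"
    by (simp add: shifted_def add.assoc)
  also have "\<dots> = distr M borel (J h)" using T sh by (intro stationary_increments) auto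
  also have "\<dots> = distr M borel (shifted T h)" using distr_shifted[OF T sh(2)] by simp
  finally show "distr M borel (\<lambda>\<omega>. shifted T (s + h) \<omega> - shifted T s \<omega>) = distr M borel (shifted T h)" .
next
  show "AE \<omega> in M. cadlag (\<lambda>t. shifted T t \<omega>)"
    using cadlag_paths
  proof eventually_elim
    case (elim \<omega>)
    show ?case
      unfolding cadlag_def
    proof (intro conjI allI impI)
      fix t :: real assume t: "0 \<le> t"
      then have "((\<lambda>s. J s \<omega>) \<longlongrightarrow> J (T + t) \<omega>) (at_right (T + t))"
        using elim T by (auto simp: cadlag_def continuous_within)
      then show "continuous (at_right t) (\<lambda>t. shifted T t \<omega>)"
        unfolding continuous_within shifted_def tendsto_at_right_shift by (intro tendsto_intros)
    next
      fix t :: real assume "0 < t"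
      with T have "0 < T + t" by simp
      with elim obtain l where "((\<lambda>s. J s \<omega>) \<longlongrightarrow> l) (at_left (T + t))"
        unfolding cadlag_def by blast
      then have "((\<lambda>t. shifted T t \<omega>) \<longlongrightarrow> l - J T \<omega>) (at_left t)"
        unfolding shifted_def tendsto_at_left_shift by (intro tendsto_intros)
      then show "\<exists>l. ((\<lambda>t. shifted T t \<omega>) \<longlongrightarrow> l) (at_left t)" by blast
    qed
  qed
next
  show "AE \<omega> in M. \<forall>t>0. \<forall>l. ((\<lambda>s. shifted T s \<omega>) \<longlongrightarrow> l) (at_left t) \<longrightarrow> l \<le> shifted T t \<omega>"
    using no_negative_jumps
  proof eventually_elim
    case (elim \<omega>)
    show ?case
    proof (intro allI impI)
      fix t l :: real assume t: "0 < t" and l: "((\<lambda>s. shifted T s \<omega>) \<longlongrightarrow> l) (at_left t)"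
      have "((\<lambda>s. shifted T s \<omega> + J T \<omega>) \<longlongrightarrow> l + J T \<omega>) (at_left t)"
        by (intro tendsto_intros l)
      then have "((\<lambda>s. J s \<omega>) \<longlongrightarrow> l + J T \<omega>) (at_left (T + t))"
        by (simp add: shifted_def tendsto_at_left_shift)
      then have "l + J T \<omega> \<le> J (T + t) \<omega>" using elim t T by auto
      then show "l \<le> shifted T t \<omega>" by (simp add: shifted_def)
    qed
  qed
next
  have [measurable]: "J (T + 1) \<in> borel_measurable M" "J T \<in> borel_measurable M"
    using T by (auto intro: measurable_at)
  have [measurable]: "shifted T 1 \<in> borel_measurable M" unfolding shifted_def[abs_def] by measurable
  show "integrable M (\<lambda>\<omega>. (shifted T 1 \<omega>)\<^sup>2)"
    using square_integrable distr_shifted[OF T zero_le_one]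
    by (subst integral_cong_distr(2)[of "shifted T 1" "J 1" "\<lambda>x. x\<^sup>2"]) auto
qed

lemma shifted_moments:
  assumes T: "0 \<le> T"
  shows "expectation (shifted T 1) = expectation (J 1)" and "variance (shifted T 1) = variance (J 1)"
proof -
  interpret S: square_integrable_levy M "shifted T" by (rule square_integrable_levy_shifted[OF T])
  note same = distr_shifted[OF T zero_le_one]
  show mean: "expectation (shifted T 1) = expectation (J 1)"
    by (rule integral_cong_distr(1)[OF same S.measurable_J1 measurable_J1]) simp
  show "variance (shifted T 1) = variance (J 1)"
    unfolding mean by (rule integral_cong_distr(1)[OF same S.measurable_J1 measurable_J1]) simp
qed

abbreviation horizon :: "nat \<Rightarrow> real" where "horizon N \<equiv> 2^N"

text \<open>
  One sequence of times with the coarse mesh up to the horizon and the fine mesh after it exhibits the two maxima as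
  functionals of disjoint blocks of independent increments.
\<close>

lemma indep_grid_max_shifted:
  "indep_var borel (grid_max (net_input J c1) N) borel (grid_max (net_input (shifted (horizon N)) c2) n)"
proof -
  define K :: nat where "K = 4^N"
  define \<tau> :: "nat \<Rightarrow> real" where
    "\<tau> k = (if k \<le> K then mesh N * real k else horizon N + mesh n * (real k - real K))" for k
  have KN: "mesh N * real K = horizon N"
  proof -
    have "(4::real)^N = 2^N * 2^N" by (simp flip: power_mult_distrib)
    then show ?thesis by (simp add: K_def)
  qed
  have \<tau>1: "\<tau> k = mesh N * real k" if "k \<le> K" for k using that by (simp add: \<tau>_def)
  have \<tau>2: "\<tau> (K + i) = horizon N + mesh n * real i" for i
    using KN by (cases "i = 0") (simp_all add: \<tau>_def)
  have \<tau>_mono: "\<tau> k \<le> \<tau> (Suc k)" for k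
  proof (cases "k < K")
    case True
    then show ?thesis by (simp add: \<tau>1 divide_right_mono)
  next
    case False
    then obtain i where "k = K + i" by (metis le_Suc_ex not_less)
    then show ?thesis using \<tau>2[of i] \<tau>2[of "Suc i"] by (simp add: divide_right_mono)
  qed
  define D where "D k \<omega> = J (\<tau> (Suc k)) \<omega> - J (\<tau> k) \<omega>" for k \<omega>
  have ind: "indep_vars (\<lambda>_. borel) D {..<K + 4^n}"
    unfolding D_def[abs_def] by (rule indep_increments) (auto simp: \<tau>1 \<tau>_mono)
  have D1: "D i \<omega> = incr (mesh N) i \<omega>" if "i < K" for i \<omega>
    using that by (simp add: D_def increment_def \<tau>1)
  have D2: "D (K + i) \<omega> = increment (shifted (horizon N)) (mesh n) i \<omega>" for i \<omega>
    using \<tau>2[of i] \<tau>2[of "Suc i"] by (simp add: D_def increment_def shifted_def)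
  have "indep_var borel (\<lambda>\<omega>. wmax K (\<lambda>i. D i \<omega> - c1 * mesh N)) borel (\<lambda>\<omega>. wmax (4^n) (\<lambda>i. D (K + i) \<omega> - c2 * mesh n))"
    by (rule wmax_indep[OF ind])
  moreover have "(\<lambda>\<omega>. wmax K (\<lambda>i. D i \<omega> - c1 * mesh N)) = grid_max (net_input J c1) N"
    unfolding grid_max_def[abs_def] K_def[symmetric] increment_net_input
    by (intro ext wmax_cong) (simp add: D1)
  moreover have "(\<lambda>\<omega>. wmax (4^n) (\<lambda>i. D (K + i) \<omega> - c2 * mesh n)) = grid_max (net_input (shifted (horizon N)) c2) n"
    unfolding grid_max_def[abs_def] increment_net_input by (simp add: D2)
  ultimately show ?thesis by simp
qed

lemma expectation_past_future:
  assumes c2: "expectation (J 1) < c2" and k: "0 \<le> k" and u: "0 \<le> u"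
  shows "expectation (\<lambda>\<omega>. exp (- k * grid_max (net_input J c1) N \<omega>) * exp (- u * all_time_max (net_input (shifted (horizon N)) c2) \<omega>))
    = expectation (\<lambda>\<omega>. exp (- k * grid_max (net_input J c1) N \<omega>)) * expectation (\<lambda>\<omega>. exp (- u * all_time_max (net_input (shifted (horizon N)) c2) \<omega>))"
proof -
  interpret S: square_integrable_levy M "shifted (horizon N)" by (rule square_integrable_levy_shifted) simp
  interpret NS: negative_drift_levy M "net_input (shifted (horizon N)) c2"
    by (rule S.negative_drift_levy_net_input) (simp add: shifted_moments c2)
  interpret N1: square_integrable_levy M "net_input J c1" by (rule square_integrable_levy_net_input)
  let ?A = "grid_max (net_input J c1) N" and ?B = "grid_max (net_input (shifted (horizon N)) c2)"
  let ?Binf = "all_time_max (net_input (shifted (horizon N)) c2)"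
  have bA: "exp (- k * ?A \<omega>) \<le> 1" for \<omega> using mult_nonneg_nonneg[OF k grid_max_nonneg] by simp
  have bB: "exp (- u * ?B n \<omega>) \<le> 1" for n \<omega> using mult_nonneg_nonneg[OF u grid_max_nonneg] by simp
  have iA: "integrable M (\<lambda>\<omega>. exp (- k * ?A \<omega>))" by (rule integrable_const_bound[of _ 1]) (use bA in auto)
  have iB: "integrable M (\<lambda>\<omega>. exp (- u * ?B n \<omega>))" for n by (rule integrable_const_bound[of _ 1]) (use bB in auto)
  have ind: "indep_var borel (\<lambda>\<omega>. exp (- k * ?A \<omega>)) borel (\<lambda>\<omega>. exp (- u * ?B n \<omega>))" for n
    using indep_var_compose[OF indep_grid_max_shifted, of "\<lambda>x. exp (- k * x)" borel "\<lambda>x. exp (- u * x)" borel c1 N c2 n]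
    by (simp add: comp_def)
  have prod: "expectation (\<lambda>\<omega>. exp (- k * ?A \<omega>) * exp (- u * ?B n \<omega>)) = expectation (\<lambda>\<omega>. exp (- k * ?A \<omega>)) * expectation (\<lambda>\<omega>. exp (- u * ?B n \<omega>))" for n
    by (rule indep_var_lebesgue_integral[OF ind iA iB])
  have ae: "AE \<omega> in M. (\<lambda>n. exp (- u * ?B n \<omega>)) \<longlonglongrightarrow> exp (- u * ?Binf \<omega>)"
    using NS.AE_all_time_max by eventually_elim (auto intro!: tendsto_intros)
  have lim1: "(\<lambda>n. expectation (\<lambda>\<omega>. exp (- u * ?B n \<omega>))) \<longlonglongrightarrow> expectation (\<lambda>\<omega>. exp (- u * ?Binf \<omega>))"
    by (rule integral_dominated_convergence[where w = "\<lambda>_. 1", OF _ _ _ ae]) (use bB in auto)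
  have lim2: "(\<lambda>n. expectation (\<lambda>\<omega>. exp (- k * ?A \<omega>) * exp (- u * ?B n \<omega>))) \<longlonglongrightarrow> expectation (\<lambda>\<omega>. exp (- k * ?A \<omega>) * exp (- u * ?Binf \<omega>))"
  proof (rule integral_dominated_convergence[where w = "\<lambda>_. 1"])
    show "AE \<omega> in M. (\<lambda>n. exp (- k * ?A \<omega>) * exp (- u * ?B n \<omega>)) \<longlonglongrightarrow> exp (- k * ?A \<omega>) * exp (- u * ?Binf \<omega>)"
      using ae by eventually_elim (rule tendsto_mult[OF tendsto_const])
    show "AE \<omega> in M. norm (exp (- k * ?A \<omega>) * exp (- u * ?B n \<omega>)) \<le> 1" for n
    proof (rule AE_I2)
      fix \<omega> show "norm (exp (- k * ?A \<omega>) * exp (- u * ?B n \<omega>)) \<le> 1"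
        using mult_mono[OF bA[of \<omega>] bB[of n \<omega>]] by (simp add: abs_mult)
    qed
  qed auto
  have "(\<lambda>n. expectation (\<lambda>\<omega>. exp (- k * ?A \<omega>) * exp (- u * ?B n \<omega>)))
      \<longlonglongrightarrow> expectation (\<lambda>\<omega>. exp (- k * ?A \<omega>)) * expectation (\<lambda>\<omega>. exp (- u * ?Binf \<omega>))"
    unfolding prod by (rule tendsto_mult[OF tendsto_const lim1])
  then show ?thesis by (rule LIMSEQ_unique[OF lim2])
qed

text \<open>
  After time \<open>T\<close> the path is the restarted path raised by its value at \<open>T\<close>; before \<open>T\<close> it is bounded.  The bound depends on
  \<open>c2\<close> only through \<open>\<bar>c2\<bar> \<le> \<bar>expectation (J 1)\<bar> + \<bar>c1\<bar>\<close>, so it is uniform as \<open>c2\<close> decreases to the mean.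
\<close>

lemma max_close_to_future:
  assumes c1: "c2 \<le> c1" and c2: "expectation (J 1) < c2" and T: "0 \<le> T"
  shows "AE \<omega> in M. \<forall>C. (\<forall>s\<in>{0..T}. \<bar>J s \<omega>\<bar> \<le> C) \<longrightarrow>
    \<bar>all_time_max (net_input J c2) \<omega> - all_time_max (net_input (shifted T) c2) \<omega>\<bar>
      \<le> C + (\<bar>expectation (J 1)\<bar> + \<bar>c1\<bar>) * T"
proof -
  interpret S: square_integrable_levy M "shifted T" by (rule square_integrable_levy_shifted[OF T])
  interpret NS: negative_drift_levy M "net_input (shifted T) c2"
    by (rule S.negative_drift_levy_net_input) (simp add: shifted_moments T c2)
  interpret N: negative_drift_levy M "net_input J c2"
    by (rule negative_drift_levy_net_input[OF c2])
  define a where "a = \<bar>expectation (J 1)\<bar> + \<bar>c1\<bar>"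
  have a: "\<bar>c2\<bar> \<le> a" using c1 c2 by (auto simp: a_def)
  have shift: "net_input J c2 (T + u) \<omega> = net_input J c2 T \<omega> + net_input (shifted T) c2 u \<omega>" for u \<omega>
    by (simp add: net_input_def shifted_def algebra_simps)
  show ?thesis
    using N.AE_all_time_max NS.AE_all_time_max unfolding a_def[symmetric]
  proof (eventually_elim, intro allI impI)
    fix \<omega> C
    let ?S = "all_time_max (net_input J c2) \<omega>" and ?B = "all_time_max (net_input (shifted T) c2) \<omega>"
    assume A: "net_input J c2 0 \<omega> = 0 \<and> cadlag (\<lambda>t. net_input J c2 t \<omega>) \<and>
        (\<lambda>n. grid_max (net_input J c2) n \<omega>) \<longlonglongrightarrow> ?S \<and>
        (\<forall>t\<ge>0. net_input J c2 t \<omega> \<le> ?S) \<and> ?S = (SUP t\<in>{0..}. net_input J c2 t \<omega>)"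
      and B: "net_input (shifted T) c2 0 \<omega> = 0 \<and> cadlag (\<lambda>t. net_input (shifted T) c2 t \<omega>) \<and>
        (\<lambda>n. grid_max (net_input (shifted T) c2) n \<omega>) \<longlonglongrightarrow> ?B \<and>
        (\<forall>t\<ge>0. net_input (shifted T) c2 t \<omega> \<le> ?B) \<and> ?B = (SUP t\<in>{0..}. net_input (shifted T) c2 t \<omega>)"
      and C: "\<forall>s\<in>{0..T}. \<bar>J s \<omega>\<bar> \<le> C"
    have X: "\<bar>net_input J c2 s \<omega>\<bar> \<le> C + a * T" if "0 \<le> s" "s \<le> T" for s
    proof -
      have "\<bar>c2 * s\<bar> \<le> a * T" unfolding abs_mult using a that by (intro mult_mono) auto
      moreover have "\<bar>J s \<omega>\<bar> \<le> C" using C that by auto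
      ultimately show ?thesis unfolding net_input_def by linarith
    qed
    have B0: "0 \<le> ?B" using B by fastforce
    have "?S \<le> ?B + (C + a * T)"
    proof -
      have "(SUP t\<in>{0..}. net_input J c2 t \<omega>) \<le> ?B + (C + a * T)"
      proof (rule cSUP_least)
        fix t :: real assume "t \<in> {0..}"
        show "net_input J c2 t \<omega> \<le> ?B + (C + a * T)"
        proof (cases "t \<le> T")
          case True
          with X[of t] \<open>t \<in> {0..}\<close> B0 show ?thesis by auto
        next
          case False
          then have "net_input J c2 t \<omega> = net_input J c2 T \<omega> + net_input (shifted T) c2 (t - T) \<omega>"
            using shift[of "t - T" \<omega>] by simp
          moreover have "net_input (shifted T) c2 (t - T) \<omega> \<le> ?B" using B False by auto
          moreover have "net_input J c2 T \<omega> \<le> C + a * T" using X[of T] T by auto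
          ultimately show ?thesis by linarith
        qed
      qed simp
      with A show ?thesis by simp
    qed
    moreover have "?B \<le> ?S + (C + a * T)"
    proof -
      have "(SUP t\<in>{0..}. net_input (shifted T) c2 t \<omega>) \<le> ?S + (C + a * T)"
      proof (rule cSUP_least)
        fix t :: real assume t: "t \<in> {0..}"
        have "net_input J c2 (T + t) \<omega> \<le> ?S" using A t T by auto
        moreover have "- net_input J c2 T \<omega> \<le> C + a * T" using X[of T] T by auto
        ultimately show "net_input (shifted T) c2 t \<omega> \<le> ?S + (C + a * T)" using shift[of t \<omega>] by linarith
      qed simp
      with B show ?thesis by simp
    qed
    ultimately show "\<bar>?S - ?B\<bar> \<le> C + a * T" by linarith
  qed
qed

end

lemma abs_exp_minus_diff_le:
  fixes x y :: real
  assumes "0 \<le> x" "0 \<le> y"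
  shows "\<bar>exp (- x) - exp (- y)\<bar> \<le> \<bar>x - y\<bar>"
proof -
  have *: "exp (- a) - exp (- b) \<le> b - a" if "0 \<le> a" "a \<le> b" for a b :: real
  proof -
    have "exp (- a) - exp (- b) = exp (- a) * (1 - exp (- (b - a)))"
      by (simp add: algebra_simps flip: exp_add)
    also have "\<dots> \<le> 1 * (b - a)"
    proof (rule mult_mono)
      show "1 - exp (- (b - a)) \<le> b - a" using exp_ge_add_one_self[of "- (b - a)"] by linarith
    qed (use that in auto)
    finally show ?thesis by simp
  qed
  show ?thesis
  proof (cases "x \<le> y")
    case True
    with *[of x y] assms show ?thesis by simp
  next
    case False
    with *[of y x] assms show ?thesis by simp
  qed
qed

context square_integrable_levy
begin

lemma AE_all_time_max_order:
  assumes "expectation (J 1) < c2" "c2 \<le> c1"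
  shows "AE \<omega> in M. 0 \<le> all_time_max (net_input J c1) \<omega> \<and> all_time_max (net_input J c1) \<omega> \<le> all_time_max (net_input J c2) \<omega>"
proof -
  have c1: "expectation (J 1) < c1" using assms by (rule less_le_trans)
  interpret N1: negative_drift_levy M "net_input J c1" by (rule negative_drift_levy_net_input[OF c1])
  interpret N2: negative_drift_levy M "net_input J c2" by (rule negative_drift_levy_net_input[OF assms(1)])
  show ?thesis
    using N1.AE_all_time_max N2.AE_all_time_max
  proof eventually_elim
    case (elim \<omega>)
    have "(SUP t\<in>{0..}. net_input J c1 t \<omega>) \<le> all_time_max (net_input J c2) \<omega>"
    proof (rule cSUP_least)
      fix t :: real assume t: "t \<in> {0..}"
      then have "c2 * t \<le> c1 * t" using assms by (intro mult_right_mono) auto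
      then have "net_input J c1 t \<omega> \<le> net_input J c2 t \<omega>" by (simp add: net_input_def)
      also have "\<dots> \<le> all_time_max (net_input J c2) \<omega>" using elim t by auto
      finally show "net_input J c1 t \<omega> \<le> all_time_max (net_input J c2) \<omega>" .
    qed simp
    moreover have "net_input J c1 0 \<omega> \<le> all_time_max (net_input J c1) \<omega>" using elim by blast
    ultimately show ?case using elim by simp
  qed
qed

text \<open>
  Along a sequence \<open>\<epsilon> \<longlonglongrightarrow> 0\<close> the exponents differ by at most \<open>\<epsilon>\<close> times a random constant, and the integrands are bounded.
\<close>

lemma future_replacement:
  fixes r k l :: real and N :: nat
  assumes r: "0 < r" and k: "0 \<le> k" and l: "0 \<le> l"
  defines "m \<equiv> expectation (J 1)"
  defines "S \<equiv> \<lambda>\<epsilon>. all_time_max (net_input J (m + \<epsilon>))"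
  defines "B \<equiv> \<lambda>\<epsilon>. all_time_max (net_input (shifted (horizon N)) (m + \<epsilon>))"
  defines "A \<equiv> grid_max (net_input J (m + r)) N"
  shows "((\<lambda>\<epsilon>. expectation (\<lambda>\<omega>. exp (- k * A \<omega>) * exp (- l * (\<epsilon> * (S \<epsilon> \<omega> - S r \<omega>))))
            - expectation (\<lambda>\<omega>. exp (- k * A \<omega>) * exp (- l * (\<epsilon> * B \<epsilon> \<omega>)))) \<longlongrightarrow> 0) (at_right 0)"
  unfolding tendsto_at_iff_sequentially
proof (intro allI impI)
  fix X :: "nat \<Rightarrow> real" assume X: "\<forall>i. X i \<in> {0<..} - {0}" "X \<longlonglongrightarrow> 0"
  define T where "T = horizon N"
  have T: "0 \<le> T" by (simp add: T_def)
  interpret Sh: square_integrable_levy M "shifted T" by (rule square_integrable_levy_shifted[OF T])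
  obtain j0 where j0: "\<And>j. j \<ge> j0 \<Longrightarrow> X j < r"
    using order_tendstoD(2)[OF X(2) r] by (auto simp: eventually_sequentially)
  define e where "e j = X (j + j0)" for j
  have e: "0 < e j" "e j < r" for j using X(1) j0[of "j + j0"] by (auto simp: e_def)
  have e_lim: "e \<longlonglongrightarrow> 0" unfolding e_def by (rule LIMSEQ_ignore_initial_segment[OF X(2)])
  define F where "F j \<omega> = exp (- k * A \<omega>) * exp (- l * (e j * (S (e j) \<omega> - S r \<omega>)))" for j \<omega>
  define G where "G j \<omega> = exp (- k * A \<omega>) * exp (- l * (e j * B (e j) \<omega>))" for j \<omega>
  have [measurable]: "S \<epsilon> \<in> borel_measurable M" "B \<epsilon> \<in> borel_measurable M" for \<epsilon>
    unfolding S_def B_def T_def[symmetric]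
    by (rule measurable_all_time_max_net_input, rule Sh.measurable_all_time_max_net_input)
  interpret N1: square_integrable_levy M "net_input J (m + r)" by (rule square_integrable_levy_net_input)
  have [measurable]: "A \<in> borel_measurable M" unfolding A_def by measurable
  have [measurable]: "F j \<in> borel_measurable M" "G j \<in> borel_measurable M" for j
    unfolding F_def[abs_def] G_def[abs_def] by measurable
  have bA: "0 < exp (- k * A \<omega>)" "exp (- k * A \<omega>) \<le> 1" for \<omega>
    using mult_nonneg_nonneg[OF k grid_max_nonneg] by (auto simp: A_def)
  have ae: "AE \<omega> in M. \<forall>j. 0 \<le> S r \<omega> \<and> S r \<omega> \<le> S (e j) \<omega> \<and> 0 \<le> B (e j) \<omega> \<and>
     (\<forall>C. (\<forall>s\<in>{0..T}. \<bar>J s \<omega>\<bar> \<le> C) \<longrightarrow> \<bar>S (e j) \<omega> - B (e j) \<omega>\<bar> \<le> C + (\<bar>m\<bar> + \<bar>m + r\<bar>) * T)"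
    unfolding AE_all_countable
  proof
    fix j
    have 1: "expectation (J 1) < m + e j" "m + e j \<le> m + r" using e[of j] by (auto simp: m_def)
    have 2: "expectation (shifted T 1) < m + e j" using 1 shifted_moments(1)[OF T] by simp
    show "AE \<omega> in M. 0 \<le> S r \<omega> \<and> S r \<omega> \<le> S (e j) \<omega> \<and> 0 \<le> B (e j) \<omega> \<and>
     (\<forall>C. (\<forall>s\<in>{0..T}. \<bar>J s \<omega>\<bar> \<le> C) \<longrightarrow> \<bar>S (e j) \<omega> - B (e j) \<omega>\<bar> \<le> C + (\<bar>m\<bar> + \<bar>m + r\<bar>) * T)"
      using AE_all_time_max_order[OF 1] Sh.AE_all_time_max_order[OF 2 order_refl] max_close_to_future[OF 1(2,1) T]
      unfolding S_def B_def T_def[symmetric] m_def[symmetric] by eventually_elim simp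
  qed
  have bounds: "AE \<omega> in M. norm (F j \<omega>) \<le> 1 \<and> norm (G j \<omega>) \<le> 1" for j
    using ae
  proof eventually_elim
    case (elim \<omega>)
    have "0 \<le> l * (e j * (S (e j) \<omega> - S r \<omega>))" "0 \<le> l * (e j * B (e j) \<omega>)"
      using elim e(1)[of j] l by (auto intro!: mult_nonneg_nonneg)
    then show ?case
      using mult_mono[OF bA(2)[of \<omega>], of "exp (- l * (e j * (S (e j) \<omega> - S r \<omega>)))" 1]
        mult_mono[OF bA(2)[of \<omega>], of "exp (- l * (e j * B (e j) \<omega>))" 1]
      by (auto simp: F_def G_def abs_mult)
  qed
  have int1: "integrable M (F j)" for j
    by (rule integrable_const_bound[of _ 1]) (use bounds[of j] in auto)
  have int2: "integrable M (G j)" for j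
    by (rule integrable_const_bound[of _ 1]) (use bounds[of j] in auto)
  have "(\<lambda>j. expectation (\<lambda>\<omega>. F j \<omega> - G j \<omega>)) \<longlonglongrightarrow> expectation (\<lambda>\<omega>. 0)"
  proof (rule integral_dominated_convergence[where w = "\<lambda>_. 2"])
    show "AE \<omega> in M. norm (F j \<omega> - G j \<omega>) \<le> 2" for j
      using bounds[of j]
    proof eventually_elim
      case (elim \<omega>)
      then show ?case by (intro order_trans[OF norm_triangle_ineq4]) linarith
    qed
    show "AE \<omega> in M. (\<lambda>j. F j \<omega> - G j \<omega>) \<longlonglongrightarrow> 0"
      using ae cadlag_paths
    proof eventually_elim
      case (elim \<omega>)
      obtain C where C: "\<And>s. 0 \<le> s \<Longrightarrow> s \<le> T \<Longrightarrow> \<bar>J s \<omega>\<bar> \<le> C"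
        using cadlag_bounded[OF elim(2) T] by blast
      define C' where "C' = C + (\<bar>m\<bar> + \<bar>m + r\<bar>) * T"
      have close: "\<bar>S (e j) \<omega> - B (e j) \<omega>\<bar> \<le> C'" for j
        using elim(1) C unfolding C'_def by auto
      have pos: "0 \<le> S r \<omega>" "S r \<omega> \<le> S (e j) \<omega>" "0 \<le> B (e j) \<omega>" for j using elim(1) by auto
      show ?case
      proof (rule Lim_null_comparison)
        have "(\<lambda>j. l * (e j * (C' + S r \<omega>))) \<longlonglongrightarrow> l * (0 * (C' + S r \<omega>))"
          by (intro tendsto_intros e_lim)
        then show "(\<lambda>j. l * (e j * (C' + S r \<omega>))) \<longlonglongrightarrow> 0" by simp
        have "norm (F j \<omega> - G j \<omega>) \<le> l * (e j * (C' + S r \<omega>))" for j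
        proof -
          have nn: "0 \<le> l * (e j * (S (e j) \<omega> - S r \<omega>))" "0 \<le> l * (e j * B (e j) \<omega>)"
            using pos(1) pos(2)[of j] pos(3)[of j] e(1)[of j] l by (auto intro!: mult_nonneg_nonneg)
          have "norm (F j \<omega> - G j \<omega>)
            = exp (- k * A \<omega>) * \<bar>exp (- (l * (e j * (S (e j) \<omega> - S r \<omega>)))) - exp (- (l * (e j * B (e j) \<omega>)))\<bar>"
            unfolding F_def G_def by (simp add: abs_mult flip: right_diff_distrib)
          also have "\<dots> \<le> 1 * \<bar>l * (e j * (S (e j) \<omega> - S r \<omega>)) - l * (e j * B (e j) \<omega>)\<bar>"
            by (intro mult_mono bA abs_exp_minus_diff_le nn) auto
          also have "\<dots> = l * (e j * \<bar>S (e j) \<omega> - B (e j) \<omega> - S r \<omega>\<bar>)"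
          proof -
            have "l * (e j * (S (e j) \<omega> - S r \<omega>)) - l * (e j * B (e j) \<omega>) = l * (e j * (S (e j) \<omega> - B (e j) \<omega> - S r \<omega>))"
              by (simp add: algebra_simps)
            then show ?thesis using l e(1)[of j] by (simp add: abs_mult)
          qed
          also have "\<dots> \<le> l * (e j * (C' + S r \<omega>))"
            using close[of j] pos(1) l e(1)[of j] by (intro mult_left_mono) auto
          finally show ?thesis .
        qed
        then show "\<forall>\<^sub>F j in sequentially. norm (F j \<omega> - G j \<omega>) \<le> l * (e j * (C' + S r \<omega>))" by simp
      qed
    qed
  qed auto
  then have "(\<lambda>j. expectation (\<lambda>\<omega>. F j \<omega>)
      - expectation (\<lambda>\<omega>. G j \<omega>)) \<longlonglongrightarrow> 0"
    by (simp only: Bochner_Integration.integral_diff[OF int1 int2]) simp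
  then show "((\<lambda>\<epsilon>. expectation (\<lambda>\<omega>. exp (- k * A \<omega>) * exp (- l * (\<epsilon> * (S \<epsilon> \<omega> - S r \<omega>))))
            - expectation (\<lambda>\<omega>. exp (- k * A \<omega>) * exp (- l * (\<epsilon> * B \<epsilon> \<omega>)))) \<circ> X) \<longlonglongrightarrow> 0"
    unfolding comp_def F_def G_def e_def by (rule LIMSEQ_offset)
qed

text \<open>
  Replacing \<open>S r\<close> by the maximum \<open>A N\<close> over the grid up to the horizon costs at most \<open>d N\<close>, uniformly in \<open>\<epsilon>\<close>.  For fixed
  \<open>N\<close> the scaled difference may be replaced by the maximum of the restarted path, which is independent of \<open>A N\<close> and has the
  exponential limit.
\<close>

lemma joint_laplace_limit:
  fixes r k l :: real
  assumes r: "0 < r" and k: "0 \<le> k" and l: "0 \<le> l"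
  defines "m \<equiv> expectation (J 1)"
  defines "S \<equiv> \<lambda>\<epsilon>. all_time_max (net_input J (m + \<epsilon>))"
  shows "((\<lambda>\<epsilon>. expectation (\<lambda>\<omega>. exp (- k * S r \<omega>) * exp (- l * (\<epsilon> * (S \<epsilon> \<omega> - S r \<omega>)))))
    \<longlongrightarrow> expectation (\<lambda>\<omega>. exp (- k * S r \<omega>)) * (1 / (1 + l * (variance (J 1) / 2)))) (at_right 0)"
proof (rule tendstoI)
  fix \<eta> :: real assume \<eta>: "0 < \<eta>"
  interpret N1: negative_drift_levy M "net_input J (m + r)"
    by (rule negative_drift_levy_net_input) (use r in \<open>simp add: m_def\<close>)
  have [measurable]: "S \<epsilon> \<in> borel_measurable M" for \<epsilon>
    unfolding S_def by (rule measurable_all_time_max_net_input)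
  define A where "A N = grid_max (net_input J (m + r)) N" for N
  have [measurable]: "A N \<in> borel_measurable M" for N unfolding A_def by measurable
  define q where "q = 1 / (1 + l * (variance (J 1) / 2))"
  have q: "0 \<le> q" "q \<le> 1"
  proof -
    have "0 \<le> l * (variance (J 1) / 2)" using l by (intro mult_nonneg_nonneg) auto
    then show "0 \<le> q" "q \<le> 1" unfolding q_def by (auto simp: divide_le_eq_1)
  qed
  have bA: "exp (- k * A N \<omega>) \<le> 1" for N \<omega> using mult_nonneg_nonneg[OF k grid_max_nonneg] by (simp add: A_def)
  have aeS: "AE \<omega> in M. 0 \<le> S r \<omega> \<and> (\<lambda>N. A N \<omega>) \<longlonglongrightarrow> S r \<omega>"
    using N1.AE_all_time_max unfolding S_def A_def
  proof eventually_elim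
    case (elim \<omega>)
    then have "net_input J (m + r) 0 \<omega> = 0" "net_input J (m + r) 0 \<omega> \<le> all_time_max (net_input J (m + r)) \<omega>"
      and lim: "(\<lambda>n. grid_max (net_input J (m + r)) n \<omega>) \<longlonglongrightarrow> all_time_max (net_input J (m + r)) \<omega>"
      by blast+
    then have "0 \<le> all_time_max (net_input J (m + r)) \<omega>" by simp
    with lim show ?case by blast
  qed
  have bS: "AE \<omega> in M. norm (exp (- k * S r \<omega>)) \<le> 1"
    using aeS by eventually_elim (use k in auto)
  have iA: "integrable M (\<lambda>\<omega>. exp (- k * A N \<omega>))" for N by (rule integrable_const_bound[of _ 1]) (use bA in auto)
  have iS: "integrable M (\<lambda>\<omega>. exp (- k * S r \<omega>))" by (rule integrable_const_bound[of _ 1]) (use bS in auto)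
  define d where "d N = expectation (\<lambda>\<omega>. \<bar>exp (- k * S r \<omega>) - exp (- k * A N \<omega>)\<bar>)" for N
  have "d \<longlonglongrightarrow> expectation (\<lambda>\<omega>. 0)"
    unfolding d_def
  proof (rule integral_dominated_convergence[where w = "\<lambda>_. 2"])
    show "AE \<omega> in M. (\<lambda>N. \<bar>exp (- k * S r \<omega>) - exp (- k * A N \<omega>)\<bar>) \<longlonglongrightarrow> 0"
      using aeS
    proof eventually_elim
      case (elim \<omega>)
      then have "(\<lambda>N. \<bar>exp (- k * S r \<omega>) - exp (- k * A N \<omega>)\<bar>) \<longlonglongrightarrow> \<bar>exp (- k * S r \<omega>) - exp (- k * S r \<omega>)\<bar>"
        by (intro tendsto_intros) auto
      then show ?case by simp
    qed
    show "AE \<omega> in M. norm \<bar>exp (- k * S r \<omega>) - exp (- k * A N \<omega>)\<bar> \<le> 2" for N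
      using bS
    proof eventually_elim
      case (elim \<omega>)
      then show ?case using bA[of N \<omega>] exp_gt_zero[of "- k * A N \<omega>"] exp_gt_zero[of "- k * S r \<omega>"]
        unfolding real_norm_def by linarith
    qed
  qed auto
  then have "d \<longlonglongrightarrow> 0" by simp
  then obtain N where N: "d N < \<eta> / 4"
    using order_tendstoD(2)[of d 0 sequentially "\<eta> / 4"] \<eta> by (auto simp: eventually_sequentially)
  define T where "T = horizon N"
  have T: "0 \<le> T" by (simp add: T_def)
  interpret Sh: square_integrable_levy M "shifted T" by (rule square_integrable_levy_shifted[OF T])
  define B where "B \<epsilon> = all_time_max (net_input (shifted T) (m + \<epsilon>))" for \<epsilon>
  have marginal: "((\<lambda>\<epsilon>. expectation (\<lambda>\<omega>. exp (- (l * \<epsilon>) * B \<epsilon> \<omega>))) \<longlongrightarrow> q) (at_right 0)"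
    using Sh.heavy_traffic_marginal[OF l, unfolded shifted_moments(2)[OF T], unfolded shifted_moments(1)[OF T]]
    unfolding B_def q_def m_def .
  have replaced: "((\<lambda>\<epsilon>. expectation (\<lambda>\<omega>. exp (- k * A N \<omega>) * exp (- l * (\<epsilon> * (S \<epsilon> \<omega> - S r \<omega>))))
            - expectation (\<lambda>\<omega>. exp (- k * A N \<omega>) * exp (- l * (\<epsilon> * B \<epsilon> \<omega>)))) \<longlongrightarrow> 0) (at_right 0)"
    using future_replacement[OF r k l] unfolding S_def B_def A_def T_def m_def .
  have small: "\<forall>\<^sub>F \<epsilon> in at_right 0. 0 < \<epsilon> \<and> \<epsilon> < r"
    using r by (auto simp: eventually_at_right_field)
  have "\<forall>\<^sub>F \<epsilon> in at_right 0. dist (expectation (\<lambda>\<omega>. exp (- (l * \<epsilon>) * B \<epsilon> \<omega>))) q < \<eta> / 4"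
    by (rule tendstoD[OF marginal]) (use \<eta> in simp)
  moreover have "\<forall>\<^sub>F \<epsilon> in at_right 0. dist (expectation (\<lambda>\<omega>. exp (- k * A N \<omega>) * exp (- l * (\<epsilon> * (S \<epsilon> \<omega> - S r \<omega>))))
            - expectation (\<lambda>\<omega>. exp (- k * A N \<omega>) * exp (- l * (\<epsilon> * B \<epsilon> \<omega>)))) 0 < \<eta> / 4"
    by (rule tendstoD[OF replaced]) (use \<eta> in simp)
  ultimately show "\<forall>\<^sub>F \<epsilon> in at_right 0. dist (expectation (\<lambda>\<omega>. exp (- k * S r \<omega>) * exp (- l * (\<epsilon> * (S \<epsilon> \<omega> - S r \<omega>)))))
     (expectation (\<lambda>\<omega>. exp (- k * S r \<omega>)) * (1 / (1 + l * (variance (J 1) / 2)))) < \<eta>"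
    unfolding q_def[symmetric] using small
  proof eventually_elim
    case (elim \<epsilon>)
    let ?Z = "\<lambda>\<omega>. exp (- l * (\<epsilon> * (S \<epsilon> \<omega> - S r \<omega>)))"
    let ?EA = "expectation (\<lambda>\<omega>. exp (- k * A N \<omega>))" and ?ES = "expectation (\<lambda>\<omega>. exp (- k * S r \<omega>))"
    let ?EB = "expectation (\<lambda>\<omega>. exp (- (l * \<epsilon>) * B \<epsilon> \<omega>))"
    have order: "expectation (J 1) < m + \<epsilon>" "m + \<epsilon> \<le> m + r" using elim(3) by (auto simp: m_def)
    have aeZ: "AE \<omega> in M. ?Z \<omega> \<le> 1"
      using AE_all_time_max_order[OF order]
    proof eventually_elim
      case (elim \<omega>)
      have "0 \<le> l * (\<epsilon> * (S \<epsilon> \<omega> - S r \<omega>))"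
        using elim l \<open>0 < \<epsilon> \<and> \<epsilon> < r\<close> by (auto simp: S_def intro!: mult_nonneg_nonneg)
      then show ?case by simp
    qed
    have intSZ: "integrable M (\<lambda>\<omega>. exp (- k * S r \<omega>) * ?Z \<omega>)"
    proof (rule integrable_const_bound)
      show "AE \<omega> in M. norm (exp (- k * S r \<omega>) * ?Z \<omega>) \<le> 1"
        using aeZ bS
      proof eventually_elim
        case (elim \<omega>)
        then show ?case using mult_mono[of "exp (- k * S r \<omega>)" 1 "?Z \<omega>" 1] by (simp add: abs_mult)
      qed
    qed measurable
    have intAZ: "integrable M (\<lambda>\<omega>. exp (- k * A N \<omega>) * ?Z \<omega>)"
    proof (rule integrable_const_bound)
      show "AE \<omega> in M. norm (exp (- k * A N \<omega>) * ?Z \<omega>) \<le> 1"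
        using aeZ
      proof eventually_elim
        case (elim \<omega>)
        then show ?case using mult_mono[OF bA[of N \<omega>], of "?Z \<omega>" 1] by (simp add: abs_mult)
      qed
    qed measurable
    have 1: "\<bar>expectation (\<lambda>\<omega>. exp (- k * S r \<omega>) * ?Z \<omega>) - expectation (\<lambda>\<omega>. exp (- k * A N \<omega>) * ?Z \<omega>)\<bar> \<le> d N"
    proof -
      have "\<bar>expectation (\<lambda>\<omega>. exp (- k * S r \<omega>) * ?Z \<omega>) - expectation (\<lambda>\<omega>. exp (- k * A N \<omega>) * ?Z \<omega>)\<bar>
          = \<bar>expectation (\<lambda>\<omega>. exp (- k * S r \<omega>) * ?Z \<omega> - exp (- k * A N \<omega>) * ?Z \<omega>)\<bar>"
        by (simp only: Bochner_Integration.integral_diff[OF intSZ intAZ])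
      also have "\<dots> \<le> expectation (\<lambda>\<omega>. \<bar>exp (- k * S r \<omega>) * ?Z \<omega> - exp (- k * A N \<omega>) * ?Z \<omega>\<bar>)"
        by (rule integral_abs_bound)
      also have "\<dots> \<le> d N"
        unfolding d_def
      proof (rule integral_mono_AE)
        show "integrable M (\<lambda>\<omega>. \<bar>exp (- k * S r \<omega>) * ?Z \<omega> - exp (- k * A N \<omega>) * ?Z \<omega>\<bar>)"
          using intSZ intAZ by (intro integrable_abs Bochner_Integration.integrable_diff)
        show "integrable M (\<lambda>\<omega>. \<bar>exp (- k * S r \<omega>) - exp (- k * A N \<omega>)\<bar>)"
          using iS iA by (intro integrable_abs Bochner_Integration.integrable_diff)
        show "AE \<omega> in M. \<bar>exp (- k * S r \<omega>) * ?Z \<omega> - exp (- k * A N \<omega>) * ?Z \<omega>\<bar> \<le> \<bar>exp (- k * S r \<omega>) - exp (- k * A N \<omega>)\<bar>"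
          using aeZ
        proof eventually_elim
          case (elim \<omega>)
          have "\<bar>exp (- k * S r \<omega>) * ?Z \<omega> - exp (- k * A N \<omega>) * ?Z \<omega>\<bar> = \<bar>exp (- k * S r \<omega>) - exp (- k * A N \<omega>)\<bar> * ?Z \<omega>"
            by (simp add: abs_mult flip: left_diff_distrib)
          also have "\<dots> \<le> \<bar>exp (- k * S r \<omega>) - exp (- k * A N \<omega>)\<bar>" using elim by (intro mult_left_le) auto
          finally show ?case .
        qed
      qed
      finally show ?thesis .
    qed
    have 2: "\<bar>?EA - ?ES\<bar> \<le> d N"
    proof -
      have "\<bar>?EA - ?ES\<bar> = \<bar>expectation (\<lambda>\<omega>. exp (- k * S r \<omega>) - exp (- k * A N \<omega>))\<bar>"
        by (simp only: Bochner_Integration.integral_diff[OF iS iA] abs_minus_commute)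
      also have "\<dots> \<le> d N" unfolding d_def by (rule integral_abs_bound)
      finally show ?thesis .
    qed
    have 3: "expectation (\<lambda>\<omega>. exp (- k * A N \<omega>) * exp (- l * (\<epsilon> * B \<epsilon> \<omega>))) = ?EA * ?EB"
      using expectation_past_future[OF order(1) k, of "l * \<epsilon>" "m + r" N] elim(3) l
      unfolding A_def B_def T_def by (simp add: mult.assoc)
    have EA: "0 \<le> ?EA" "?EA \<le> 1"
    proof -
      show "0 \<le> ?EA" by simp
      have "?EA \<le> expectation (\<lambda>\<omega>. 1)" by (intro integral_mono iA bA) simp
      then show "?EA \<le> 1" by (simp add: prob_space)
    qed
    have 4: "\<bar>?EA * ?EB - ?EA * q\<bar> \<le> \<bar>?EB - q\<bar>"
    proof -
      have "\<bar>?EA * ?EB - ?EA * q\<bar> = ?EA * \<bar>?EB - q\<bar>" using EA(1) by (simp add: abs_mult flip: right_diff_distrib)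
      also have "\<dots> \<le> 1 * \<bar>?EB - q\<bar>" using EA by (intro mult_right_mono) auto
      finally show ?thesis by simp
    qed
    have 5: "\<bar>?EA * q - ?ES * q\<bar> \<le> \<bar>?EA - ?ES\<bar>"
    proof -
      have "\<bar>?EA * q - ?ES * q\<bar> = \<bar>?EA - ?ES\<bar> * q" using q(1) by (simp add: abs_mult flip: left_diff_distrib)
      also have "\<dots> \<le> \<bar>?EA - ?ES\<bar> * 1" using q by (intro mult_left_mono) auto
      finally show ?thesis by simp
    qed
    show ?case
      using elim(1,2) 1 2 4 5 N unfolding 3 dist_real_def by linarith
  qed
qed

end

section \<open>The limiting product law\<close>

text \<open>
  The exponentially tilted density is, up to the factor \<open>\<kappa> / (\<kappa> + u)\<close>, the exponential density of rate \<open>\<kappa> + u\<close>.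
\<close>

lemma integral_exponential_laplace:
  fixes \<kappa> u :: real
  assumes \<kappa>: "0 < \<kappa>" and u: "0 \<le> u"
  shows "(\<integral>y. exp (- u * y) \<partial>density lborel (exponential_density \<kappa>)) = \<kappa> / (\<kappa> + u)"
proof -
  interpret E: prob_space "density lborel (exponential_density (\<kappa> + u))"
    by (rule prob_space_exponential_density) (use assms in simp)
  have "(\<integral>y. exp (- u * y) \<partial>density lborel (exponential_density \<kappa>)) = (\<integral>y. exponential_density \<kappa> y * exp (- u * y) \<partial>lborel)"
    using \<kappa> by (subst integral_density) (auto simp: exponential_density_nonneg)
  also have "\<dots> = (\<integral>y. \<kappa> / (\<kappa> + u) * exponential_density (\<kappa> + u) y \<partial>lborel)"
  proof (rule Bochner_Integration.integral_cong[OF refl])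
    fix y :: real
    have "\<kappa> + u \<noteq> 0" using assms by simp
    moreover have "exp (- y * \<kappa>) * exp (- u * y) = exp (- y * (\<kappa> + u))"
      by (simp add: algebra_simps flip: exp_add)
    ultimately show "exponential_density \<kappa> y * exp (- u * y) = \<kappa> / (\<kappa> + u) * exponential_density (\<kappa> + u) y"
      by (simp add: exponential_density_def)
  qed
  also have "\<dots> = \<kappa> / (\<kappa> + u) * (\<integral>y. exponential_density (\<kappa> + u) y * 1 \<partial>lborel)" by simp
  also have "(\<integral>y. exponential_density (\<kappa> + u) y * 1 \<partial>lborel) = (\<integral>y. 1 \<partial>density lborel (exponential_density (\<kappa> + u)))"
    using assms by (subst integral_density) (auto simp: exponential_density_nonneg)
  also have "\<dots> = 1" using E.prob_space by simp
  finally show ?thesis by simp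
qed

lemma distr_pair_snd:
  assumes "prob_space M1" "sigma_finite_measure M2"
  shows "distr (M1 \<Otimes>\<^sub>M M2) M2 snd = M2"
proof (rule measure_eqI)
  interpret M1: prob_space M1 by fact
  interpret M2: sigma_finite_measure M2 by fact
  fix A assume "A \<in> sets (distr (M1 \<Otimes>\<^sub>M M2) M2 snd)"
  then have A: "A \<in> sets M2" by simp
  have "snd -` A \<inter> space (M1 \<Otimes>\<^sub>M M2) = space M1 \<times> A"
    using sets.sets_into_space[OF A] by (auto simp: space_pair_measure)
  then show "emeasure (distr (M1 \<Otimes>\<^sub>M M2) M2 snd) A = emeasure M2 A"
    using A by (simp add: emeasure_distr M2.emeasure_pair_measure_Times M1.emeasure_space_1)
qed simp

lemma product_law:
  fixes M1 M2 :: "real measure"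
  assumes M1: "prob_space M1" "sets M1 = sets borel" and M2: "prob_space M2" "sets M2 = sets borel"
  shows "prob_space (M1 \<Otimes>\<^sub>M M2)" and "prob_space.indep_var (M1 \<Otimes>\<^sub>M M2) borel fst borel snd"
    and "distr (M1 \<Otimes>\<^sub>M M2) borel fst = M1" and "distr (M1 \<Otimes>\<^sub>M M2) borel snd = M2"
    and "distr (M1 \<Otimes>\<^sub>M M2) borel (\<lambda>\<omega>. (fst \<omega>, snd \<omega>)) = M1 \<Otimes>\<^sub>M M2"
proof -
  interpret M1: prob_space M1 by fact
  interpret M2: prob_space M2 by fact
  interpret P: pair_prob_space M1 M2 ..
  show "prob_space (M1 \<Otimes>\<^sub>M M2)" by (rule P.prob_space_axioms)
  have sets: "sets (M1 \<Otimes>\<^sub>M M2) = sets (borel :: (real \<times> real) measure)"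
    using sets_pair_measure_cong[OF M1(2) M2(2)] unfolding borel_prod .
  have d1: "distr (M1 \<Otimes>\<^sub>M M2) borel fst = M1"
    using M2.distr_pair_fst[of M1] distr_cong[of "M1 \<Otimes>\<^sub>M M2" "M1 \<Otimes>\<^sub>M M2" borel M1 fst fst] M1(2) by simp
  have d2: "distr (M1 \<Otimes>\<^sub>M M2) borel snd = M2"
    using distr_pair_snd[OF M1(1) M2.sigma_finite_measure_axioms]
      distr_cong[of "M1 \<Otimes>\<^sub>M M2" "M1 \<Otimes>\<^sub>M M2" borel M2 snd snd] M2(2) by simp
  show "distr (M1 \<Otimes>\<^sub>M M2) borel fst = M1" "distr (M1 \<Otimes>\<^sub>M M2) borel snd = M2" by fact+
  show id: "distr (M1 \<Otimes>\<^sub>M M2) borel (\<lambda>\<omega>. (fst \<omega>, snd \<omega>)) = M1 \<Otimes>\<^sub>M M2"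
    using distr_id2[OF sets[symmetric]] by simp
  have "fst \<in> measurable (M1 \<Otimes>\<^sub>M M2) borel" "snd \<in> measurable (M1 \<Otimes>\<^sub>M M2) borel"
    by (simp_all add: measurable_cong_sets[OF sets refl] borel_prod[symmetric])
  then show "P.indep_var borel fst borel snd"
    unfolding P.indep_var_distribution_eq d1 d2 using id by (simp add: borel_prod)
qed

text \<open>
  The witness is the product of the law of \<open>S r\<close> with the exponential law, with the coordinate projections as the
  two random variables.
\<close>

theorem proposition3p2:
  fixes M :: "'a measure" and J :: "real \<Rightarrow> 'a \<Rightarrow> real" and r \<sigma> :: real
  defines "m \<equiv> prob_space.expectation M (J 1)"
  defines "\<pi> \<equiv> (\<lambda>\<epsilon>. steady_state_law M J (m + r) (m + \<epsilon>))"
  defines "\<phi> \<equiv> laplace_exponent M J (m + r)"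
  assumes "spectrally_positive_levy_process M J"
    and "integrable M (J 1)"
    and "integrable M (\<lambda>\<omega>. (J 1 \<omega>)\<^sup>2)"
    and "prob_space.variance M (J 1) = \<sigma>\<^sup>2"
    and "0 < \<sigma>\<^sup>2"
    and "0 < r"
  shows "(\<forall>\<epsilon>. 0 < \<epsilon> \<and> \<epsilon> < r \<longrightarrow>
            (\<forall>s>0. (\<integral>q. exp (- s * fst q) \<partial>\<pi> \<epsilon>) = s * right_deriv \<phi> 0 / \<phi> s)) \<and>
         (\<exists>(N :: (real \<times> real) measure) Y1 Y2.
            prob_space N \<and>
            prob_space.indep_var N borel Y1 borel Y2 \<and>
            (\<forall>\<epsilon>. 0 < \<epsilon> \<and> \<epsilon> < r \<longrightarrow> distr N borel Y1 = distr (\<pi> \<epsilon>) borel fst) \<and>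
            distributed N lborel Y2 (exponential_density (2 / \<sigma>\<^sup>2)) \<and>
            converges_weakly (\<lambda>\<epsilon>. distr (\<pi> \<epsilon>) borel (\<lambda>q. (fst q, \<epsilon> * snd q)))
              (distr N borel (\<lambda>\<omega>. (Y1 \<omega>, Y2 \<omega>))) (at_right 0))"
proof -
  interpret square_integrable_levy M J
    using assms(4,6) by (simp add: square_integrable_levy_def square_integrable_levy_axioms_def)
  define S where "S \<epsilon> = all_time_max (net_input J (m + \<epsilon>))" for \<epsilon>
  have S_meas [measurable]: "S \<epsilon> \<in> borel_measurable M" for \<epsilon>
    unfolding S_def by (rule measurable_all_time_max_net_input)
  have r: "0 < r" by fact
  have [measurable]: "fst \<in> borel_measurable (borel :: (real \<times> real) measure)"
    "snd \<in> borel_measurable (borel :: (real \<times> real) measure)"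
    by (auto intro!: borel_measurable_continuous_onI continuous_intros)
  have law: "\<pi> \<epsilon> = distr M borel (\<lambda>\<omega>. (S r \<omega>, S \<epsilon> \<omega> - S r \<omega>))" if "0 < \<epsilon>" for \<epsilon>
    unfolding \<pi>_def S_def stationary_law_def[symmetric]
    by (rule steady_state_law_eq) (use that r in \<open>simp_all add: m_def\<close>)
  have order: "AE \<omega> in M. 0 \<le> S r \<omega> \<and> S r \<omega> \<le> S \<epsilon> \<omega>" if "0 < \<epsilon>" "\<epsilon> < r" for \<epsilon>
    unfolding S_def by (rule AE_all_time_max_order) (use that in \<open>simp_all add: m_def\<close>)
  have transform: "(\<integral>q. exp (- s * fst q) \<partial>\<pi> \<epsilon>) = s * right_deriv \<phi> 0 / \<phi> s"
    if "0 < \<epsilon>" "\<epsilon> < r" "0 < s" for \<epsilon> s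
  proof -
    have drift: "expectation (J 1) < m + r" using r by (simp add: m_def)
    interpret Nr: negative_drift_levy M "net_input J (m + r)" by (rule negative_drift_levy_net_input[OF drift])
    have "(\<integral>q. exp (- s * fst q) \<partial>\<pi> \<epsilon>) = expectation (\<lambda>\<omega>. exp (- s * S r \<omega>))"
      unfolding law[OF that(1)] by (subst integral_distr) auto
    moreover have "expectation (\<lambda>\<omega>. exp (- s * S r \<omega>)) * \<phi> s = s * r"
      using Nr.pollaczek_khinchine[OF that(3)]
      unfolding S_def \<phi>_def laplace_exponent_def expectation_net_input by (simp add: m_def)
    moreover from this have "\<phi> s \<noteq> 0" using that r by auto
    moreover have "right_deriv \<phi> 0 = r"
      unfolding \<phi>_def m_def by (rule right_deriv_laplace_exponent)
    ultimately show ?thesis by (simp add: field_simps)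
  qed
  define \<kappa> where "\<kappa> = 2 / \<sigma>\<^sup>2"
  have \<kappa>: "0 < \<kappa>" using assms(8) by (simp add: \<kappa>_def)
  define Exp where "Exp = density lborel (exponential_density \<kappa>)"
  define M1 where "M1 = distr M borel (S r)"
  define N where "N = M1 \<Otimes>\<^sub>M Exp"
  have M1: "prob_space M1" "sets M1 = sets borel"
    unfolding M1_def by (auto intro: prob_space_distr)
  have Exp: "prob_space Exp" "sets Exp = sets borel"
    unfolding Exp_def using prob_space_exponential_density[OF \<kappa>] by auto
  note N = product_law[OF M1 Exp, folded N_def]
  interpret N: prob_space N by (rule N(1))
  have setsN: "sets N = sets borel"
    using sets_distr[of N borel "\<lambda>\<omega>. (fst \<omega>, snd \<omega>)"] unfolding N(5) .
  have fst_meas [measurable]: "fst \<in> borel_measurable N" and snd_meas [measurable]: "snd \<in> borel_measurable N"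
    using N.indep_var_rv1[OF N(2)] N.indep_var_rv2[OF N(2)] by auto
  have marginal1: "distr N borel fst = distr (\<pi> \<epsilon>) borel fst" if "0 < \<epsilon>" for \<epsilon>
    unfolding N(3) law[OF that] M1_def by (subst distr_distr) (auto simp: comp_def)
  have marginal2: "distributed N lborel snd (exponential_density (2 / \<sigma>\<^sup>2))"
    unfolding distributed_def
  proof (intro conjI)
    have "distr N lborel snd = distr N borel snd" by (rule distr_cong) auto
    then show "distr N lborel snd = density lborel (exponential_density (2 / \<sigma>\<^sup>2))"
      unfolding N(4) Exp_def \<kappa>_def .
  qed auto
  have scaled: "distr (\<pi> \<epsilon>) borel (\<lambda>q. (fst q, \<epsilon> * snd q)) = distr M borel (\<lambda>\<omega>. (S r \<omega>, \<epsilon> * (S \<epsilon> \<omega> - S r \<omega>)))"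
    if "0 < \<epsilon>" for \<epsilon>
    unfolding law[OF that] by (subst distr_distr) (auto simp: comp_def)
  have quadrant: "quadrant_law (distr (\<pi> \<epsilon>) borel (\<lambda>q. (fst q, \<epsilon> * snd q)))" if "0 < \<epsilon>" "\<epsilon> < r" for \<epsilon>
  proof -
    have "AE \<omega> in M. 0 \<le> S r \<omega> \<and> 0 \<le> \<epsilon> * (S \<epsilon> \<omega> - S r \<omega>)"
      using order[OF that] by eventually_elim (use that in auto)
    then have "AE q in distr M borel (\<lambda>\<omega>. (S r \<omega>, \<epsilon> * (S \<epsilon> \<omega> - S r \<omega>))). 0 \<le> fst q \<and> 0 \<le> snd q"
      by (subst AE_distr_iff) auto
    then show ?thesis
      unfolding quadrant_law_def scaled[OF that(1)] by (auto intro!: prob_space_distr)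
  qed
  have quadrantN: "quadrant_law N"
  proof -
    have "AE x in distr N borel fst. 0 \<le> x"
      unfolding N(3) M1_def using order[of "r / 2"] r by (subst AE_distr_iff) auto
    then have "AE q in N. 0 \<le> fst q" by (subst (asm) AE_distr_iff) auto
    moreover have "AE x in distr N borel snd. 0 \<le> x"
      unfolding N(4) Exp_def by (subst AE_density) (auto simp: exponential_density_def)
    then have "AE q in N. 0 \<le> snd q" by (subst (asm) AE_distr_iff) auto
    ultimately have "AE q in N. 0 \<le> fst q \<and> 0 \<le> snd q" by eventually_elim simp
    then show ?thesis using N(1) setsN by (simp add: quadrant_law_def)
  qed
  have "converges_weakly (\<lambda>\<epsilon>. distr (\<pi> \<epsilon>) borel (\<lambda>q. (fst q, \<epsilon> * snd q))) N (at_right 0)"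
  proof (rule converges_weakly_laplace[OF _ quadrantN])
    have small: "\<forall>\<^sub>F \<epsilon> in at_right 0. 0 < \<epsilon> \<and> \<epsilon> < r"
      using r by (auto simp: eventually_at_right_field)
    then show "\<forall>\<^sub>F \<epsilon> in at_right 0. quadrant_law (distr (\<pi> \<epsilon>) borel (\<lambda>q. (fst q, \<epsilon> * snd q)))"
      by eventually_elim (rule quadrant, auto)
    fix k l :: nat
    have target: "(\<integral>q. exp (- (k * fst q + l * snd q)) \<partial>N)
        = expectation (\<lambda>\<omega>. exp (- real k * S r \<omega>)) * (1 / (1 + l * (variance (J 1) / 2)))"
    proof -
      have bounded: "AE q in N. norm (exp (- real k * fst q)) \<le> 1 \<and> norm (exp (- real l * snd q)) \<le> 1"
        using quadrantN unfolding quadrant_law_def by (auto elim!: AE_mp)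
      have int1: "integrable N (\<lambda>q. exp (- real k * fst q))"
        by (rule N.integrable_const_bound[of _ 1]) (use bounded in auto)
      have int2: "integrable N (\<lambda>q. exp (- real l * snd q))"
        by (rule N.integrable_const_bound[of _ 1]) (use bounded in auto)
      have ind: "N.indep_var borel (\<lambda>q. exp (- real k * fst q)) borel (\<lambda>q. exp (- real l * snd q))"
        using N.indep_var_compose[OF N(2), of "\<lambda>x. exp (- real k * x)" borel "\<lambda>x. exp (- real l * x)" borel]
        by (simp add: comp_def)
      have "(\<integral>q. exp (- (k * fst q + l * snd q)) \<partial>N) = (\<integral>q. exp (- real k * fst q) * exp (- real l * snd q) \<partial>N)"
        by (simp flip: exp_add)
      also have "\<dots> = (\<integral>q. exp (- real k * fst q) \<partial>N) * (\<integral>q. exp (- real l * snd q) \<partial>N)"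
        by (rule N.indep_var_lebesgue_integral[OF ind int1 int2])
      also have "(\<integral>q. exp (- real k * fst q) \<partial>N) = (\<integral>x. exp (- real k * x) \<partial>distr N borel fst)"
        by (subst integral_distr) auto
      also have "\<dots> = expectation (\<lambda>\<omega>. exp (- real k * S r \<omega>))"
        unfolding N(3) M1_def by (subst integral_distr) auto
      also have "(\<integral>q. exp (- real l * snd q) \<partial>N) = (\<integral>x. exp (- real l * x) \<partial>distr N borel snd)"
        by (subst integral_distr) auto
      also have "\<dots> = \<kappa> / (\<kappa> + l)"
        unfolding N(4) Exp_def by (rule integral_exponential_laplace[OF \<kappa>]) simp
      also have "\<dots> = 1 / (1 + l * (variance (J 1) / 2))"
        using assms(8) unfolding assms(7) \<kappa>_def by (simp add: field_simps)
      finally show ?thesis .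
    qed
    have "((\<lambda>\<epsilon>. expectation (\<lambda>\<omega>. exp (- real k * S r \<omega>) * exp (- real l * (\<epsilon> * (S \<epsilon> \<omega> - S r \<omega>)))))
        \<longlongrightarrow> (\<integral>q. exp (- (k * fst q + l * snd q)) \<partial>N)) (at_right 0)"
      unfolding target S_def m_def by (rule joint_laplace_limit[OF r]) auto
    then show "((\<lambda>\<epsilon>. \<integral>q. exp (- (k * fst q + l * snd q)) \<partial>distr (\<pi> \<epsilon>) borel (\<lambda>q. (fst q, \<epsilon> * snd q)))
        \<longlongrightarrow> (\<integral>q. exp (- (k * fst q + l * snd q)) \<partial>N)) (at_right 0)"
    proof (rule Lim_transform_eventually)
      show "\<forall>\<^sub>F \<epsilon> in at_right 0. expectation (\<lambda>\<omega>. exp (- real k * S r \<omega>) * exp (- real l * (\<epsilon> * (S \<epsilon> \<omega> - S r \<omega>))))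
          = (\<integral>q. exp (- (k * fst q + l * snd q)) \<partial>distr (\<pi> \<epsilon>) borel (\<lambda>q. (fst q, \<epsilon> * snd q)))"
        using small
      proof eventually_elim
        case (elim \<epsilon>)
        show ?case
          unfolding scaled[OF conjunct1[OF elim]]
          by (subst integral_distr) (auto simp flip: exp_add)
      qed
    qed
  qed
  then have weak: "converges_weakly (\<lambda>\<epsilon>. distr (\<pi> \<epsilon>) borel (\<lambda>q. (fst q, \<epsilon> * snd q)))
      (distr N borel (\<lambda>\<omega>. (fst \<omega>, snd \<omega>))) (at_right 0)"
    unfolding N(5) .
  show ?thesis
    using transform N(1,2) marginal1 marginal2 weak by blast
qed

end
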